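(* Suppose that the following hold: (A1) $\sum_{i=1}^{\infty} w_i = \infty$ and $\sum_{i=1}^{\infty} w_i^2 < \infty$; (A2) the map $F\mapsto\int_\Theta p(x|\theta)\,F(d\theta)$ is injective; that is, the mixing distribution $F$ is identifiable from the mixture $\int_\Theta p(x|\theta)\,F(d\theta)$; (A3) for each $x\in\mathcal{X}$, the map $\theta\mapsto p(x|\theta)$ is bounded and continuous; (A4) for any $\varepsilon>0$ and any compact $\mathcal{X}_0\subset\mathcal{X}$, there exists a compact $\Theta_0\subset\Theta$ such that $\int_{\mathcal{X}_0}p(x|\theta)\,\nu(dx)<\varepsilon$ for all $\theta\notin\Theta_0$; (A5) there exists a constant $B<\infty$ such that, for every $\theta_1,\theta_2,\theta_3\in\Theta$, $$\int_{\mathcal{X}} \left(\frac{p(x|\theta_1)}{p(x|\theta_2)}\right)^2 p(x|\theta_3)\,\nu(dx) < B.$$ Then the recursive estimate $f_n$ converges almost surely to $f$ in the weak topology.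
   Context: Setting. For each $\theta\in\Theta$, $p(\cdot|\theta)$ is a known sampling density on $\mathcal{X}$ with respect to a dominating $\sigma$-finite measure $\nu$. The mixing distribution $F$ is a probability measure on $\Theta$, absolutely continuous with respect to a $\sigma$-finite measure $\mu$ on $\Theta$, with density $f=dF/d\mu$. The observations $X_1,X_2,\ldots$ are i.i.d. with density (with respect to $\nu$) $$p(x)=\int_\Theta p(x|\theta)f(\theta)\,\mu(d\theta).$$ Recursive estimate. Fix an initial estimate $f_0$ (a density on $\Theta$ with respect to $\mu$) and a sequence of weights $w_1,w_2,\ldots\in(0,1)$. For $i\ge 1$ define $$f_i(\theta)=(1-w_i)f_{i-1}(\theta)+w_i\,\frac{p(X_i|\theta)f_{i-1}(\theta)}{\int_\Theta p(X_i|\theta')f_{i-1}(\theta')\,\mu(d\theta')},\qquad \theta\in\Theta.$$ Compactness and continuity refer to the topologies of $\mathcal{X}$ and $\Theta$. In (A2), $F$ ranges over probability measures on $\Theta$. Convergence of $f_n$ to $f$ in the weak topology means weak convergence of the probability measures $f_n\,d\mu$ to $f\,d\mu$.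
   Formalization: The initial density f_0 is assumed to have support containing that of f (every open set null for f_0 dμ is null for f dμ), without which the claim fails; 𝒳 is taken Polish, Θ separable metric, and mixtures in (A2) are compared ν-almost everywhere. *)

theory Defs
  imports "HOL-Probability.Probability"
begin

text \<open>Densities are real-valued, so that pointwise continuity and boundedness in the parameter can
  be stated directly; their total mass is measured by the nonnegative integral, because the
  Bochner integral of a non-integrable function is 0.\<close>

definition is_prob_density :: "'a measure \<Rightarrow> ('a \<Rightarrow> real) \<Rightarrow> bool" where
  "is_prob_density N g \<longleftrightarrow>
     g \<in> borel_measurable N \<and> (\<forall>z. 0 \<le> g z) \<and> (\<integral>\<^sup>+z. ennreal (g z) \<partial>N) = 1"

text \<open>A sampling density is a function \<open>p\<close> of the observation and then the parameter.\<close>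

definition mixture_of_measure :: "('x \<Rightarrow> 't \<Rightarrow> real) \<Rightarrow> 't measure \<Rightarrow> 'x \<Rightarrow> real" where
  "mixture_of_measure p F x = (\<integral>\<theta>. p x \<theta> \<partial>F)"

definition mixture_density :: "'t measure \<Rightarrow> ('x \<Rightarrow> 't \<Rightarrow> real) \<Rightarrow> ('t \<Rightarrow> real) \<Rightarrow> 'x \<Rightarrow> real" where
  "mixture_density \<mu> p g x = (\<integral>\<theta>. p x \<theta> * g \<theta> \<partial>\<mu>)"

text \<open>Injectivity of \<open>F \<mapsto> \<integral> p(x|\<theta>) F(d\<theta>)\<close> on Borel probability measures. The images are densities
  with respect to \<open>\<nu>\<close>, so two of them are identified when they agree \<open>\<nu>\<close>-almost everywhere.\<close>

definition identifiable_mixing ::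
    "'x measure \<Rightarrow> ('x \<Rightarrow> 't::topological_space \<Rightarrow> real) \<Rightarrow> bool" where
  "identifiable_mixing \<nu> p \<longleftrightarrow>
     (\<forall>F G. prob_space F \<longrightarrow> prob_space G \<longrightarrow> sets F = sets borel \<longrightarrow> sets G = sets borel \<longrightarrow>
        (AE x in \<nu>. mixture_of_measure p F x = mixture_of_measure p G x) \<longrightarrow> F = G)"

text \<open>\<open>xs i\<close> and \<open>w i\<close> are used for \<open>i \<ge> 1\<close> only.\<close>

primrec recursive_estimate ::
    "'t measure \<Rightarrow> ('x \<Rightarrow> 't \<Rightarrow> real) \<Rightarrow> (nat \<Rightarrow> real) \<Rightarrow> ('t \<Rightarrow> real) \<Rightarrow> (nat \<Rightarrow> 'x) \<Rightarrow> nat \<Rightarrow> 't \<Rightarrow> real"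
where
  "recursive_estimate \<mu> p w f0 xs 0 = f0"
| "recursive_estimate \<mu> p w f0 xs (Suc n) =
     (\<lambda>\<theta>. (1 - w (Suc n)) * recursive_estimate \<mu> p w f0 xs n \<theta>
        + w (Suc n) * (p (xs (Suc n)) \<theta> * recursive_estimate \<mu> p w f0 xs n \<theta>
            / mixture_density \<mu> p (recursive_estimate \<mu> p w f0 xs n) (xs (Suc n))))"

text \<open>The library's weak convergence is confined to measures on the real line.\<close>

definition weakly_converges :: "(nat \<Rightarrow> 'a::topological_space measure) \<Rightarrow> 'a measure \<Rightarrow> bool" where
  "weakly_converges Fs F \<longleftrightarrow>
     (\<forall>g :: 'a \<Rightarrow> real. continuous_on UNIV g \<longrightarrow> bounded (range g) \<longrightarrow>
        (\<lambda>n. \<integral>z. g z \<partial>Fs n) \<longlonglongrightarrow> (\<integral>z. g z \<partial>F))"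

end

theory Submission
  imports Defs
begin

text \<open>
  Notation for this explanation: \<open>mix G\<close> is the mixture of a mixing distribution \<open>G\<close>, \<open>P\<close> is the law
  of an observation, \<open>F\<^sub>n\<close> is the measure with density \<open>f\<^sub>n\<close>, and \<open>F\<close> and \<open>F\<^sub>0\<close> are those of \<open>f\<close> and
  \<open>f0\<close>. One update replaces \<open>F\<^sub>n\<close> by a convex combination of \<open>F\<^sub>n\<close> and its Bayes posterior given the next
  observation, with weight \<open>w\<close> on the posterior. Two potentials are followed along the recursion.

  The first is the fit, minus the Kullback--Leibler divergence of \<open>mix F\<^sub>n\<close> from the true mixture. An update
  changes it by at least \<open>w Z - O(w\<^sup>2)\<close>, and the conditional mean of \<open>Z\<close> given the past is
  \<open>\<integral> a\<^sup>2 \<partial>F\<^sub>n - 1\<close>, where \<open>a \<theta>\<close> is the \<open>P\<close>-mean of \<open>p x \<theta> / mix F\<^sub>n x\<close>. Since \<open>a\<close> has mean one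
  under \<open>F\<^sub>n\<close>, this is nonnegative (\<open>expected_gain_nonneg\<close>). As the squared weights are summable, the
  fluctuations form an almost surely convergent martingale, and the fit, being bounded above by zero,
  converges (\<open>fit_convergent\<close>).

  The second identifies the limit. Let \<open>Q\<close> have a bounded density \<open>q\<close> with respect to \<open>F\<^sub>0\<close>. Then the
  \<open>Q\<close>-mean of the logarithm of \<open>dF\<^sub>n/dF\<^sub>0\<close> never exceeds \<open>sup q\<close>, while an update raises it, on
  conditional average and up to \<open>O(w\<^sup>2)\<close>, by at least \<open>w\<close> times the fit of \<open>Q\<close> minus the fit of \<open>F\<^sub>n\<close>.
  The weights have an infinite sum, so the limiting fit is at least that of \<open>Q\<close>
  (\<open>gain_towards_bounded\<close>, \<open>fit_tendsto_0\<close>). Bounded densities suffice because the support of \<open>F\<close> lies in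
  that of \<open>F\<^sub>0\<close>: averaging \<open>F\<close> over small balls gives such \<open>Q\<close> converging weakly to \<open>F\<close>, with fit
  tending to zero, even when \<open>F\<close> is singular with respect to \<open>F\<^sub>0\<close>
  (\<open>bounded_densities_weakly_dense\<close>, \<open>fit_weakly_continuous_at_truth\<close>). Hence the fit of \<open>F\<^sub>n\<close> tends to zero.

  All second moments come from the bound on squared likelihood ratios, which passes from single
  parameters to arbitrary mixtures by convexity (\<open>nn_integral_mixture_ratio\<close>).

  A fit tending to zero makes \<open>mix F\<^sub>n\<close> converge to \<open>mix F\<close> in \<open>L\<^sup>1\<close>. The condition on compact sets then
  makes the \<open>F\<^sub>n\<close> tight, so every subsequence has a weakly convergent one
  (\<open>tight_imp_weakly_convergent_subsequence\<close>). By continuity of \<open>p x\<close> its limit has the mixture \<open>mix F\<close>, and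
  identifiability makes it equal to \<open>F\<close>.
\<close>

section \<open>Weak compactness of tight sequences on a separable metric space\<close>

text \<open>Base 4 leaves a gap between codes with binary digits: at the first place where two digit sequences
  differ, the later digits together can undo only a third of the difference.\<close>
lemma quarter_code_gap:
  fixes a b :: "nat \<Rightarrow> real"
  assumes a: "\<And>n. a n \<in> {0, 1}" and b: "\<And>n. b n \<in> {0, 1}" and k: "a k \<noteq> b k"
  shows "(1/4) ^ k / 2 \<le> \<bar>(\<Sum>n. a n * (1/4) ^ n) - (\<Sum>n. b n * (1/4) ^ n)\<bar>"
proof -
  define d where "d n = (a n - b n) * (1/4::real) ^ n" for n
  have ab: "\<bar>a n - b n\<bar> \<le> 1" for n using a[of n] b[of n] by auto
  have d_le: "\<bar>d n\<bar> \<le> (1/4) ^ n" for n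
    using ab[of n] by (simp add: d_def abs_mult mult_left_le_one_le)
  have geo: "summable (\<lambda>n. (1/4::real) ^ n)" by (simp add: summable_geometric)
  have bnd: "summable (\<lambda>n. c n * (1/4::real) ^ n)" if "\<And>n. \<bar>c n\<bar> \<le> (1::real)" for c
    using that by (intro summable_comparison_test'[OF geo, of 0]) (simp add: abs_mult mult_left_le_one_le)
  have "\<bar>a n\<bar> \<le> 1" "\<bar>b n\<bar> \<le> 1" for n using a[of n] b[of n] by auto
  then have sa: "summable (\<lambda>n. a n * (1/4) ^ n)" and sb: "summable (\<lambda>n. b n * (1/4) ^ n)"
    by (blast intro: bnd)+
  have sd: "summable d" unfolding d_def using ab by (rule bnd)
  define i where "i = (LEAST n. a n \<noteq> b n)"
  have i: "a i \<noteq> b i" unfolding i_def using k by (rule LeastI)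
  have i_le: "i \<le> k" unfolding i_def using k by (rule Least_le)
  have before: "d n = 0" if "n < i" for n
    using not_less_Least[OF that[unfolded i_def]] by (simp add: d_def)
  have di: "\<bar>d i\<bar> = (1/4) ^ i"
    using i a[of i] b[of i] by (auto simp: d_def abs_mult)
  have tail: "\<bar>\<Sum>n. d (n + Suc i)\<bar> \<le> (1/4) ^ i / 3"
  proof -
    have s1: "summable (\<lambda>n. \<bar>d (n + Suc i)\<bar>)"
    proof (rule summable_comparison_test'[of "\<lambda>n. (1/4) ^ (n + Suc i)" 0])
      show "summable (\<lambda>n. (1/4::real) ^ (n + Suc i))"
        by (rule summable_ignore_initial_segment[OF geo])
      show "norm \<bar>d (n + Suc i)\<bar> \<le> (1/4) ^ (n + Suc i)" for n
        using d_le[of "n + Suc i"] by (simp only: real_norm_def abs_abs)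
    qed
    have "\<bar>\<Sum>n. d (n + Suc i)\<bar> \<le> (\<Sum>n. \<bar>d (n + Suc i)\<bar>)"
      by (rule summable_rabs[OF s1])
    also have "\<dots> \<le> (\<Sum>n. (1/4) ^ (n + Suc i))"
      by (intro suminf_le d_le s1 summable_ignore_initial_segment[OF geo])
    also have "\<dots> = (1/4) ^ Suc i * (\<Sum>n. (1/4) ^ n)"
      by (subst suminf_mult[symmetric, OF geo]) (simp add: power_add mult_ac)
    also have "\<dots> = (1/4) ^ i / 3"
      by (simp add: suminf_geometric)
    finally show ?thesis .
  qed
  have "(\<Sum>n. a n * (1/4) ^ n) - (\<Sum>n. b n * (1/4) ^ n) = (\<Sum>n. d n)"
    unfolding d_def by (subst suminf_diff[OF sa sb]) (simp add: algebra_simps)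
  also have "\<dots> = (\<Sum>n. d (n + Suc i)) + (\<Sum>n<Suc i. d n)"
    by (rule suminf_split_initial_segment[OF sd])
  also have "(\<Sum>n<Suc i. d n) = d i" using before by simp
  finally have "(1/4) ^ i / 2 \<le> \<bar>(\<Sum>n. a n * (1/4) ^ n) - (\<Sum>n. b n * (1/4) ^ n)\<bar>"
    using tail di zero_le_power[of "1/4::real" i] by linarith
  moreover have "(1/4::real) ^ k \<le> (1/4) ^ i" using i_le by (intro power_decreasing) auto
  ultimately show ?thesis by linarith
qed

text \<open>The code of a point lists, as digits, the members of a countable base that contain it. It is not
  continuous, but around one of two distinct points there is a basic open set whose closure misses the other; for
  sequences converging to the two points the corresponding digit eventually differs, which keeps the codes
  apart. Its purpose is to transport
  weak compactness from the real line to an arbitrary separable metric space.\<close>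
lemma separating_code_exists:
  obtains T :: "'t::{metric_space,second_countable_topology} \<Rightarrow> real"
  where "T \<in> borel_measurable borel" "\<And>x. 0 \<le> T x \<and> T x \<le> 2"
    "\<And>u v x y c. u \<longlonglongrightarrow> x \<Longrightarrow> v \<longlonglongrightarrow> y \<Longrightarrow> (\<lambda>n. T (u n)) \<longlonglongrightarrow> c \<Longrightarrow> (\<lambda>n. T (v n)) \<longlonglongrightarrow> c \<Longrightarrow> x = y"
proof -
  obtain B :: "'t set set" where B: "countable B" "topological_basis B"
    using ex_countable_basis by blast
  have opB: "open A" if "A \<in> B" for A using B(2) that by (rule topological_basis_open)
  have "B \<noteq> {}"
    using topological_basisE[OF B(2), of UNIV undefined] by auto
  define A where "A = from_nat_into B"
  have A: "open (A k)" for k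
    unfolding A_def by (intro opB from_nat_into \<open>B \<noteq> {}\<close>)
  define T where "T x = (\<Sum>k. indicator (A k) x * (1/4::real) ^ k)" for x
  have geo: "summable (\<lambda>n. (1/4::real) ^ n)" by (simp add: summable_geometric)
  have sum: "summable (\<lambda>k. indicator (A k) x * (1/4::real) ^ k)" for x
    by (intro summable_comparison_test'[OF geo, of 0]) (auto simp: indicator_def)
  have [measurable]: "A k \<in> sets borel" for k using A by simp
  have m: "T \<in> borel_measurable borel" unfolding T_def by measurable
  have bd: "0 \<le> T x \<and> T x \<le> 2" for x
  proof
    show "0 \<le> T x" unfolding T_def by (intro suminf_nonneg sum) auto
    have "T x \<le> (\<Sum>k. (1/4::real) ^ k)"
      unfolding T_def by (intro suminf_le sum geo) (auto simp: indicator_def)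
    then show "T x \<le> 2" by (simp add: suminf_geometric)
  qed
  have sep: "x = y" if u: "u \<longlonglongrightarrow> x" and v: "v \<longlonglongrightarrow> y"
    and Tu: "(\<lambda>n. T (u n)) \<longlonglongrightarrow> c" and Tv: "(\<lambda>n. T (v n)) \<longlonglongrightarrow> c" for u v x y c
  proof (rule ccontr)
    assume "x \<noteq> y"
    then have "open (ball x (dist x y / 2))" "x \<in> ball x (dist x y / 2)" by auto
    then obtain C where C: "C \<in> B" "x \<in> C" "C \<subseteq> ball x (dist x y / 2)"
      using topological_basisE[OF B(2)] by blast
    obtain k where k: "A k = C"
      unfolding A_def using C(1) B(1) by (meson from_nat_into_surj)
    have "eventually (\<lambda>n. u n \<in> A k) sequentially"
      using topological_tendstoD[OF u A[of k]] C k by auto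
    moreover have "eventually (\<lambda>n. v n \<in> - cball x (dist x y / 2)) sequentially"
      using \<open>x \<noteq> y\<close> by (intro topological_tendstoD[OF v]) (auto simp: dist_commute)
    moreover have "eventually (\<lambda>n. dist (T (u n) - T (v n)) 0 < (1/4) ^ k / 2) sequentially"
      using tendstoD[OF tendsto_diff[OF Tu Tv], of "(1/4) ^ k / 2"] by simp
    ultimately have "eventually (\<lambda>n. False) sequentially"
    proof eventually_elim
      case (elim n)
      then have "v n \<notin> A k" using C k by auto
      then have "indicator (A k) (u n) \<noteq> (indicator (A k) (v n) :: real)" using elim by auto
      from quarter_code_gap[of "\<lambda>k. indicator (A k) (u n)" "\<lambda>k. indicator (A k) (v n)", OF _ _ this]
      show False using elim by (auto simp: T_def dist_real_def indicator_def)
    qed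
    then show False by simp
  qed
  show ?thesis by (rule that[OF m bd sep])
qed

lemma portmanteau_closed:
  fixes D :: "'a::metric_space set"
  assumes Ms: "\<And>n. prob_space (Ms n)" "\<And>n. sets (Ms n) = sets borel"
    and M: "prob_space M" "sets M = sets borel"
    and conv: "\<And>h::'a \<Rightarrow> real. continuous_on UNIV h \<Longrightarrow> bounded (range h) \<Longrightarrow>
        (\<lambda>n. \<integral>z. h z \<partial>Ms n) \<longlonglongrightarrow> (\<integral>z. h z \<partial>M)"
    and D: "closed D" and ev: "eventually (\<lambda>n. b \<le> measure (Ms n) D) sequentially" and b: "0 < b"
  shows "b \<le> measure M D"
proof -
  interpret M: prob_space M by fact
  have D_ne: "D \<noteq> {}"
  proof
    assume "D = {}"
    then have "eventually (\<lambda>n. False) sequentially" using ev b by simp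
    then show False by simp
  qed
  define h where "h k z = max 0 (1 - real k * infdist z D)" for k and z :: 'a
  have hcont: "continuous_on UNIV (h k)" for k
    unfolding h_def by (intro continuous_intros)
  have h01: "0 \<le> h k z \<and> h k z \<le> 1" for k z
    by (auto simp: h_def infdist_nonneg)
  have hb: "bounded (range (h k))" for k
    using h01 by (intro boundedI[of _ 1]) (auto simp: abs_le_iff intro: order_trans[of _ 0])
  have hD: "h k z = 1" if "z \<in> D" for k z using that by (simp add: h_def)
  have [measurable]: "D \<in> sets borel" using D by auto
  have hm: "h k \<in> borel_measurable borel" for k
    by (rule borel_measurable_continuous_onI[OF hcont])
  note hm[measurable]
  have bk: "b \<le> (\<integral>z. h k z \<partial>M)" for k
  proof (rule tendsto_lowerbound[OF conv[OF hcont hb]])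
    show "eventually (\<lambda>n. b \<le> (\<integral>z. h k z \<partial>Ms n)) sequentially"
      using ev
    proof eventually_elim
      case (elim n)
      interpret N: prob_space "Ms n" by fact
      have [measurable_cong]: "sets (Ms n) = sets borel" by fact
      have "measure (Ms n) D = (\<integral>z. indicator D z \<partial>Ms n)"
        using Ms(2)[of n, THEN sets_eq_imp_space_eq] by simp
      also have "\<dots> \<le> (\<integral>z. h k z \<partial>Ms n)"
      proof (rule integral_mono)
        show "integrable (Ms n) (h k)"
          using h01 by (intro N.integrable_const_bound[of _ 1]) auto
      qed (use h01 hD in \<open>auto simp: indicator_def intro!: N.integrable_const_bound[of _ 1]\<close>)
      finally show ?case using elim by simp
    qed
  qed simp
  have [measurable_cong]: "sets M = sets borel" by fact
  have "(\<lambda>k. \<integral>z. h k z \<partial>M) \<longlonglongrightarrow> (\<integral>z. indicator D z \<partial>M)"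
  proof (rule integral_dominated_convergence[where w="\<lambda>_. 1"])
    show "AE z in M. (\<lambda>k. h k z) \<longlonglongrightarrow> indicator D z"
    proof (intro AE_I2)
      fix z
      show "(\<lambda>k. h k z) \<longlonglongrightarrow> indicator D z"
      proof (cases "z \<in> D")
        case True then show ?thesis by (simp add: hD)
      next
        case False
        then have pos: "0 < infdist z D"
          using D D_ne by (simp add: infdist_pos_not_in_closed)
        obtain k0 where k0: "1 < real k0 * infdist z D"
          using reals_Archimedean3[OF pos] by blast
        have "h k z = 0" if "k0 \<le> k" for k
        proof -
          have "real k0 * infdist z D \<le> real k * infdist z D"
            using that pos by (intro mult_right_mono) auto
          then show ?thesis using k0 by (simp add: h_def)
        qed
        then have "eventually (\<lambda>k. h k z = 0) sequentially"
          by (auto simp: eventually_sequentially)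
        then show ?thesis using False by (simp add: tendsto_eventually)
      qed
    qed
  qed (use h01 in auto)
  then have "b \<le> (\<integral>z. indicator D z \<partial>M)"
    by (rule tendsto_lowerbound) (use bk in auto)
  then show ?thesis using M(2)[THEN sets_eq_imp_space_eq] by simp
qed


lemma (in prob_space) integral_diff_le_off_event:
  fixes a b :: "'a \<Rightarrow> real"
  assumes m: "a \<in> borel_measurable M" "b \<in> borel_measurable M"
    and bd: "\<And>z. \<bar>a z\<bar> \<le> C" "\<And>z. \<bar>b z\<bar> \<le> C" and eq: "\<And>z. z \<in> E \<Longrightarrow> a z = b z"
    and E: "E \<in> events" "1 - \<eta> \<le> prob E"
  shows "\<bar>(\<integral>z. a z \<partial>M) - (\<integral>z. b z \<partial>M)\<bar> \<le> 2 * C * \<eta>"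
proof -
  have C: "0 \<le> C" using bd(1)[of undefined] by linarith
  have i: "integrable M a" "integrable M b"
    using m bd by (auto intro!: integrable_const_bound[of _ C])
  have iE: "integrable M (indicat_real (space M - E))"
    using E by (intro integrable_const_bound[of _ 1]) (auto simp: indicator_def)
  have "\<bar>(\<integral>z. a z \<partial>M) - (\<integral>z. b z \<partial>M)\<bar> = \<bar>\<integral>z. a z - b z \<partial>M\<bar>" using i by simp
  also have "\<dots> \<le> (\<integral>z. \<bar>a z - b z\<bar> \<partial>M)" by (rule integral_abs_bound)
  also have "\<dots> \<le> (\<integral>z. 2 * C * indicator (space M - E) z \<partial>M)"
  proof (rule integral_mono)
    fix z assume "z \<in> space M"
    then show "\<bar>a z - b z\<bar> \<le> 2 * C * indicator (space M - E) z"
      using bd(1)[of z] bd(2)[of z] eq[of z] by (auto simp: indicator_def)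
  qed (use i iE in auto)
  also have "\<dots> = 2 * C * (1 - prob E)" using E by (simp add: prob_compl)
  also have "\<dots> \<le> 2 * C * \<eta>" using E C by (intro mult_left_mono) auto
  finally show ?thesis .
qed

text \<open>Prokhorov's theorem, reduced to Helly's selection theorem. The codes of the points form measures on
  a bounded interval, for which Helly gives a weak limit \<open>H\<close>. On the image of a compact set, decoding is a
  continuous map, because its graph is the closure of the graph of the code and that closure is compact
  and single-valued. Tightness puts almost all mass of \<open>H\<close> on such images, so the image of \<open>H\<close> under
  decoding is a weak limit of the original measures.\<close>
theorem tight_imp_weakly_convergent_subsequence:
  fixes Fs :: "nat \<Rightarrow> 't::{metric_space,second_countable_topology} measure"
  assumes prob: "\<And>n. prob_space (Fs n)" and sets: "\<And>n. sets (Fs n) = sets borel"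
    and tight: "\<And>e::real. 0 < e \<Longrightarrow> \<exists>K. compact K \<and> eventually (\<lambda>n. 1 - e \<le> measure (Fs n) K) sequentially"
  obtains r G where "strict_mono r" "prob_space G" "sets G = sets borel" "weakly_converges (\<lambda>n. Fs (r n)) G"
proof -
  have [measurable_cong]: "sets (Fs n) = sets borel" for n by fact
  have sp: "space (Fs n) = UNIV" for n using sets_eq_imp_space_eq[OF sets[of n]] by simp
  obtain T :: "'t \<Rightarrow> real" where T[measurable]: "T \<in> borel_measurable borel"
    and T02: "\<And>x. 0 \<le> T x \<and> T x \<le> 2"
    and Tsep: "\<And>u v x y c. u \<longlonglongrightarrow> x \<Longrightarrow> v \<longlonglongrightarrow> y \<Longrightarrow> (\<lambda>n. T (u n)) \<longlonglongrightarrow> c \<Longrightarrow> (\<lambda>n. T (v n)) \<longlonglongrightarrow> c \<Longrightarrow> x = y"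
    by (rule separating_code_exists) (rule that)

  \<comment> \<open>The closure of the graph of the code over \<open>K\<close>, as pairs of a code and a point. By the
    separation property of the code, each limiting code belongs to one point only.\<close>
  define \<Gamma> where "\<Gamma> K = closure ((\<lambda>u. (T u, u)) ` K)" for K :: "'t set"
  have \<Gamma>_unique: "x = y" if cx: "(c, x) \<in> \<Gamma> K" and cy: "(c, y) \<in> \<Gamma> L" for c x y K L
  proof -
    have lim: "\<exists>u. u \<longlonglongrightarrow> z \<and> (\<lambda>n. T (u n)) \<longlonglongrightarrow> c" if "(c, z) \<in> \<Gamma> J" for z J
    proof -
      from that have "\<exists>q. (\<forall>n. q n \<in> (\<lambda>u. (T u, u)) ` J) \<and> q \<longlonglongrightarrow> (c, z)"
        unfolding \<Gamma>_def closure_sequential .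
      then obtain q where q: "\<forall>n. q n \<in> (\<lambda>u. (T u, u)) ` J" "q \<longlonglongrightarrow> (c, z)" by (elim exE conjE)
      have "T (snd (q n)) = fst (q n)" for n using spec[OF q(1), of n] by auto
      moreover have "(\<lambda>n. fst (q n)) \<longlonglongrightarrow> c" "(\<lambda>n. snd (q n)) \<longlonglongrightarrow> z"
        using tendsto_fst[OF q(2)] tendsto_snd[OF q(2)] by auto
      ultimately show ?thesis by (intro exI[of _ "\<lambda>n. snd (q n)"]) simp
    qed
    obtain u where u: "u \<longlonglongrightarrow> x" "(\<lambda>n. T (u n)) \<longlonglongrightarrow> c" using lim[OF cx] by (elim exE conjE)
    obtain v where v: "v \<longlonglongrightarrow> y" "(\<lambda>n. T (v n)) \<longlonglongrightarrow> c" using lim[OF cy] by (elim exE conjE)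
    show ?thesis by (rule Tsep[OF u(1) v(1) u(2) v(2)])
  qed
  \<comment> \<open>The decoding map; points outside all the graphs get an arbitrary value.\<close>
  define S where "S c = (SOME x. (c, x) \<in> \<Gamma> UNIV)" for c
  have \<Gamma>_mono: "\<Gamma> K \<subseteq> \<Gamma> UNIV" for K unfolding \<Gamma>_def by (intro closure_mono) auto
  have S_eq: "S c = x" if "(c, x) \<in> \<Gamma> K" for c x K
  proof -
    have "(c, x) \<in> \<Gamma> UNIV" using that \<Gamma>_mono by blast
    then have "(c, S c) \<in> \<Gamma> UNIV" unfolding S_def by (rule someI)
    then show ?thesis using that by (rule \<Gamma>_unique)
  qed
  have \<Gamma>_compact: "compact (\<Gamma> K)" "\<Gamma> K \<subseteq> UNIV \<times> K" if "compact K" for K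
  proof -
    have sub: "\<Gamma> K \<subseteq> {0..2} \<times> K"
      unfolding \<Gamma>_def using T02 that by (intro closure_minimal closed_Times compact_imp_closed) auto
    then show "\<Gamma> K \<subseteq> UNIV \<times> K" by auto
    have "compact (({0..2::real} \<times> K) \<inter> \<Gamma> K)"
      using that by (intro compact_Int_closed compact_Times) (auto simp: \<Gamma>_def)
    then show "compact (\<Gamma> K)" using sub by (simp add: Int_absorb1)
  qed
  define D where "D K = fst ` \<Gamma> K" for K
  have TD: "T u \<in> D K" and ST: "S (T u) = u" if "u \<in> K" for u K
  proof -
    have *: "(T u, u) \<in> \<Gamma> K" using that unfolding \<Gamma>_def by (intro subsetD[OF closure_subset]) auto
    then show "T u \<in> D K" unfolding D_def by force
    show "S (T u) = u" by (rule S_eq[OF *])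
  qed
  have D_closed: "closed (D K)" if "compact K" for K
    unfolding D_def by (intro compact_imp_closed compact_continuous_image \<Gamma>_compact that continuous_intros)
  have S_cont: "continuous_on (D K) S" if "compact K" for K
    unfolding continuous_on_closed_invariant
  proof (intro allI impI)
    fix C :: "'t set" assume C: "closed C"
    have "compact (\<Gamma> K \<inter> UNIV \<times> C)"
      using \<Gamma>_compact(1)[OF that] C by (intro compact_Int_closed closed_Times) auto
    then have "closed (fst ` (\<Gamma> K \<inter> UNIV \<times> C))"
      by (intro compact_imp_closed compact_continuous_image continuous_intros)
    moreover have "fst ` (\<Gamma> K \<inter> UNIV \<times> C) \<inter> D K = S -` C \<inter> D K"
      unfolding D_def using S_eq by force
    ultimately show "\<exists>A. closed A \<and> A \<inter> D K = S -` C \<inter> D K" by blast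
  qed

  define \<mu> where "\<mu> n = distr (Fs n) borel T" for n
  have \<mu>_dist: "real_distribution (\<mu> n)" for n
  proof -
    interpret F: prob_space "Fs n" by fact
    have "prob_space (\<mu> n)" unfolding \<mu>_def by (intro F.prob_space_distr) measurable
    then show ?thesis by (simp add: real_distribution_def real_distribution_axioms_def \<mu>_def)
  qed
  have "Helly_Selection.tight \<mu>"
    unfolding tight_def
  proof (intro conjI allI impI)
    fix e :: real assume e: "0 < e"
    have "measure (\<mu> n) {-1<..3} = 1" for n
    proof -
      interpret F: prob_space "Fs n" by fact
      have "T -` {-1<..3} = UNIV" using T02 by (force intro: order_less_le_trans[of _ 0] order_trans[of _ 2])
      then show ?thesis
        using F.prob_space by (simp add: \<mu>_def measure_distr sp)
    qed
    then show "\<exists>a b. a < b \<and> (\<forall>n. 1 - e < measure (\<mu> n) {a<..b})"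
      using e by (intro exI[of _ "-1"] exI[of _ 3]) auto
  qed (rule \<mu>_dist)
  from tight_imp_convergent_subsubsequence[OF this strict_mono_id]
  obtain r H where r: "strict_mono r" and H: "real_distribution H" "weak_conv_m (\<mu> \<circ> r) H"
    by (auto simp: comp_def)
  interpret H: real_distribution H by fact
  have conv: "(\<lambda>n. \<integral>z. h z \<partial>\<mu> (r n)) \<longlonglongrightarrow> (\<integral>z. h z \<partial>H)"
    if "continuous_on UNIV h" and "bounded (range h)" for h :: "real \<Rightarrow> real"
  proof -
    obtain B where "\<And>x. norm (h x) \<le> B" using \<open>bounded (range h)\<close> by (auto simp: bounded_iff)
    then show ?thesis
      using weak_conv_imp_integral_bdd_continuous_conv[OF _ H, of h B] \<mu>_dist that(1)
      by (auto simp: comp_def continuous_on_eq_continuous_at)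
  qed

  \<comment> \<open>The index is shifted by two so that the mass \<open>1 - 1 / (j + 2)\<close> is positive, as the portmanteau lemma
    requires.\<close>
  have "\<forall>j. \<exists>K. compact K \<and> eventually (\<lambda>n. 1 - 1 / real (j + 2) \<le> measure (Fs n) K) sequentially"
    using tight by auto
  then obtain K where K: "\<And>j. compact (K j)"
    and FK: "\<And>j. eventually (\<lambda>n. 1 - 1 / real (j + 2) \<le> measure (Fs n) (K j)) sequentially"
    by metis
  have [measurable]: "K j \<in> sets borel" "D (K j) \<in> sets borel" for j
    using K D_closed[OF K] by (auto intro: borel_closed compact_imp_closed)
  have FKr: "eventually (\<lambda>n. 1 - 1 / real (j + 2) \<le> measure (Fs (r n)) (K j)) sequentially" for j
    using FK r by (rule eventually_subseq[rotated])
  have HD: "1 - 1 / real (j + 2) \<le> measure H (D (K j))" for j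
  proof (rule portmanteau_closed[where Ms="\<lambda>n. \<mu> (r n)"])
    show "eventually (\<lambda>n. 1 - 1 / real (j + 2) \<le> measure (\<mu> (r n)) (D (K j))) sequentially"
      using FKr[of j]
    proof eventually_elim
      case (elim n)
      interpret F: prob_space "Fs (r n)" by fact
      have "T -` D (K j) \<inter> space (Fs (r n)) \<in> sets (Fs (r n))" by measurable
      then have "measure (Fs (r n)) (K j) \<le> measure (Fs (r n)) (T -` D (K j) \<inter> space (Fs (r n)))"
        using TD by (intro F.finite_measure_mono) (auto simp: sp)
      also have "\<dots> = measure (\<mu> (r n)) (D (K j))" by (simp add: \<mu>_def measure_distr)
      finally show ?case using elim by simp
    qed
  qed (use \<mu>_dist conv D_closed[OF K] H.prob_space_axioms in \<open>auto simp: real_distribution_def real_distribution_axioms_def\<close>)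

  define S' where "S' c = (if c \<in> (\<Union>j. D (K j)) then S c else undefined)" for c
  have S'_eq: "S' c = S c" if "c \<in> D (K j)" for c j using that by (auto simp: S'_def)
  have S'[measurable]: "S' \<in> borel_measurable borel"
  proof (rule measurable_piecewise_restrict[where C="insert (- (\<Union>j. D (K j))) (range (\<lambda>j. D (K j)))"])
    fix \<Omega> assume "\<Omega> \<in> insert (- (\<Union>j. D (K j))) (range (\<lambda>j. D (K j)))"
    then consider "\<Omega> = - (\<Union>j. D (K j))" | j where "\<Omega> = D (K j)" by auto
    then show "S' \<in> restrict_space borel \<Omega> \<rightarrow>\<^sub>M borel"
    proof cases
      case 1
      have "(\<lambda>_. undefined) \<in> restrict_space borel \<Omega> \<rightarrow>\<^sub>M borel" by simp
      then show ?thesis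
        by (subst measurable_cong[where g="\<lambda>_. undefined"]) (auto simp: 1 S'_def space_restrict_space)
    next
      case 2
      have "S \<in> restrict_space borel \<Omega> \<rightarrow>\<^sub>M borel"
        unfolding 2 by (intro borel_measurable_continuous_on_restrict S_cont K)
      then show ?thesis
        by (subst measurable_cong[where g=S]) (auto simp: 2 S'_def space_restrict_space)
    qed
  qed auto
  define G where "G = distr H borel S'"
  have "weakly_converges (\<lambda>n. Fs (r n)) G"
    unfolding weakly_converges_def
  proof (intro allI impI)
    fix g :: "'t \<Rightarrow> real" assume g: "continuous_on UNIV g" "bounded (range g)"
    obtain C0 where C0: "\<And>x. \<bar>g x\<bar> \<le> C0" using g(2) by (auto simp: bounded_iff)
    define C where "C = C0 + 1"
    have C: "\<bar>g x\<bar> \<le> C" "0 < C" for x using C0[of x] by (auto simp: C_def)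
    have [measurable]: "g \<in> borel_measurable borel" by (rule borel_measurable_continuous_onI[OF g(1)])
    show "(\<lambda>n. \<integral>z. g z \<partial>Fs (r n)) \<longlonglongrightarrow> (\<integral>z. g z \<partial>G)"
    proof (rule tendstoI)
      fix e :: real assume e: "0 < e"
      obtain j :: nat where j: "6 * C / e < real j" using reals_Archimedean2 by blast
      define \<eta> where "\<eta> = 1 / real (j + 2)"
      have \<eta>: "2 * C * \<eta> < e / 3"
      proof -
        have "6 * C < e * real j" using j e by (simp add: field_simps)
        also have "\<dots> \<le> e * real (j + 2)" using e by simp
        finally show ?thesis using e by (simp add: \<eta>_def field_simps)
      qed
      obtain h where h: "continuous_on UNIV h" "\<And>c. c \<in> D (K j) \<Longrightarrow> h c = g (S c)" "\<And>c. \<bar>h c\<bar> \<le> C"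
      proof (rule Tietze[of "D (K j)" "\<lambda>c. g (S c)" UNIV C])
        show "continuous_on (D (K j)) (\<lambda>c. g (S c))"
          by (rule continuous_on_compose2[OF g(1) S_cont[OF K]]) auto
      qed (use C D_closed[OF K] in \<open>auto intro: less_imp_le\<close>)
      have [measurable]: "h \<in> borel_measurable borel" by (rule borel_measurable_continuous_onI[OF h(1)])
      have HG: "\<bar>(\<integral>z. h z \<partial>H) - (\<integral>z. g z \<partial>G)\<bar> \<le> 2 * C * \<eta>"
      proof -
        have "(\<integral>z. g z \<partial>G) = (\<integral>z. g (S' z) \<partial>H)"
          unfolding G_def by (subst integral_distr) auto
        moreover have "\<bar>(\<integral>z. h z \<partial>H) - (\<integral>z. g (S' z) \<partial>H)\<bar> \<le> 2 * C * \<eta>"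
          using HD[of j] h C S'_eq
          by (intro H.integral_diff_le_off_event[where E="D (K j)"]) (auto simp: \<eta>_def)
        ultimately show ?thesis by simp
      qed
      have "bounded (range h)" using h(3) by (auto simp: bounded_iff)
      from tendstoD[OF conv[OF h(1) this], of "e/3"]
      have "eventually (\<lambda>n. dist (\<integral>z. h z \<partial>\<mu> (r n)) (\<integral>z. h z \<partial>H) < e / 3) sequentially"
        using e by simp
      then show "eventually (\<lambda>n. dist (\<integral>z. g z \<partial>Fs (r n)) (\<integral>z. g z \<partial>G) < e) sequentially"
        using FKr[of j]
      proof eventually_elim
        case (elim n)
        interpret F: prob_space "Fs (r n)" by fact
        have "(\<integral>z. h z \<partial>\<mu> (r n)) = (\<integral>z. h (T z) \<partial>Fs (r n))"
          unfolding \<mu>_def by (subst integral_distr) auto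
        moreover have "\<bar>(\<integral>z. g z \<partial>Fs (r n)) - (\<integral>z. h (T z) \<partial>Fs (r n))\<bar> \<le> 2 * C * \<eta>"
          using elim h C TD[of _ "K j"] ST[of _ "K j"]
          by (intro F.integral_diff_le_off_event[where E="K j"]) (auto simp: \<eta>_def)
        ultimately show ?case using elim(1) HG \<eta> unfolding dist_real_def by linarith
      qed
    qed
  qed
  moreover have "prob_space G" unfolding G_def by (intro H.prob_space_distr) simp
  ultimately show ?thesis using that[OF r] by (simp add: G_def)
qed

section \<open>Square-summable martingale differences and independent observations\<close>

lemma integrable_mult_of_squares:
  fixes f g :: "'a \<Rightarrow> real"
  assumes [measurable]: "f \<in> borel_measurable M" "g \<in> borel_measurable M"
    and "integrable M (\<lambda>x. (f x)\<^sup>2)" "integrable M (\<lambda>x. (g x)\<^sup>2)"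
  shows "integrable M (\<lambda>x. f x * g x)"
proof (rule Bochner_Integration.integrable_bound)
  show "integrable M (\<lambda>x. (f x)\<^sup>2 + (g x)\<^sup>2)" using assms by simp
  have "\<bar>a * b\<bar> \<le> a\<^sup>2 + b\<^sup>2" for a b :: real
  proof -
    have "2 * (\<bar>a\<bar> * \<bar>b\<bar>) \<le> \<bar>a\<bar>\<^sup>2 + \<bar>b\<bar>\<^sup>2" using sum_squares_bound[of "\<bar>a\<bar>" "\<bar>b\<bar>"] by simp
    moreover have "\<bar>a * b\<bar> \<le> 2 * (\<bar>a\<bar> * \<bar>b\<bar>)" by (simp add: abs_mult)
    ultimately show ?thesis unfolding power2_abs by (rule order_trans[rotated])
  qed
  then show "AE x in M. norm (f x * g x) \<le> norm ((f x)\<^sup>2 + (g x)\<^sup>2)" by simp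
qed simp

lemma integrable_square_add:
  fixes f g :: "'a \<Rightarrow> real"
  assumes [measurable]: "f \<in> borel_measurable M" "g \<in> borel_measurable M"
    and "integrable M (\<lambda>x. (f x)\<^sup>2)" "integrable M (\<lambda>x. (g x)\<^sup>2)"
  shows "integrable M (\<lambda>x. (f x + g x)\<^sup>2)"
  using assms integrable_mult_of_squares[OF assms]
  by (simp add: power2_sum mult.assoc)

text \<open>The martingale property is stated as orthogonality to all square-integrable functions of the past:
  this is the only consequence of a vanishing conditional expectation that the convergence proof needs,
  and it follows directly from Fubini's theorem when the next observation is independent of the past.\<close>
locale martingale_differences = prob_space M for M :: "'w measure" +
  fixes Fil :: "nat \<Rightarrow> 'w measure" and D :: "nat \<Rightarrow> 'w \<Rightarrow> real"
  assumes Fil_mono: "\<And>m n f. m \<le> n \<Longrightarrow> f \<in> borel_measurable (Fil m) \<Longrightarrow> (f :: 'w \<Rightarrow> real) \<in> borel_measurable (Fil n)"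
    and Fil_M: "\<And>n f. f \<in> borel_measurable (Fil n) \<Longrightarrow> (f :: 'w \<Rightarrow> real) \<in> borel_measurable M"
    and D_adapted: "\<And>n. D n \<in> borel_measurable (Fil (Suc n))"
    and D_square: "\<And>n. integrable M (\<lambda>\<omega>. (D n \<omega>)\<^sup>2)"
    and D_orth: "\<And>n \<phi>. \<phi> \<in> borel_measurable (Fil n) \<Longrightarrow> integrable M (\<lambda>\<omega>. (\<phi> \<omega>)\<^sup>2) \<Longrightarrow> (\<integral>\<omega>. \<phi> \<omega> * D n \<omega> \<partial>M) = 0"
begin

lemma D_measurable[measurable]: "D n \<in> borel_measurable M"
  by (rule Fil_M[OF D_adapted])

text \<open>Switching increments on and off by a decision known beforehand preserves orthogonality, so the second
  moments still add up. The maximal inequality uses this with the decision to stop.\<close>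
lemma transform_second_moment:
  assumes \<phi>: "\<And>i. \<phi> i \<in> borel_measurable (Fil i)" "\<And>i \<omega>. \<phi> i \<omega> \<in> {0, 1}"
  shows "(\<lambda>\<omega>. \<Sum>i=n..<n+k. \<phi> i \<omega> * D i \<omega>) \<in> borel_measurable (Fil (n + k))"
    "integrable M (\<lambda>\<omega>. (\<Sum>i=n..<n+k. \<phi> i \<omega> * D i \<omega>)\<^sup>2)"
    "(\<integral>\<omega>. (\<Sum>i=n..<n+k. \<phi> i \<omega> * D i \<omega>)\<^sup>2 \<partial>M) \<le> (\<Sum>i=n..<n+k. \<integral>\<omega>. (D i \<omega>)\<^sup>2 \<partial>M)"
proof (induction k)
  case 0
  { case 1 show ?case by simp
  next case 2 show ?case by simp
  next case 3 show ?case by simp }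
next
  case (Suc k)
  define U where "U \<omega> = (\<Sum>i=n..<n+k. \<phi> i \<omega> * D i \<omega>)" for \<omega>
  define m where "m = n + k"
  have U: "U \<in> borel_measurable (Fil m)" "integrable M (\<lambda>\<omega>. (U \<omega>)\<^sup>2)"
    "(\<integral>\<omega>. (U \<omega>)\<^sup>2 \<partial>M) \<le> (\<Sum>i=n..<n+k. \<integral>\<omega>. (D i \<omega>)\<^sup>2 \<partial>M)"
    using Suc.IH by (simp_all add: U_def[abs_def] m_def)
  have step: "(\<Sum>i=n..<n + Suc k. \<phi> i \<omega> * D i \<omega>) = U \<omega> + \<phi> m \<omega> * D m \<omega>" for \<omega>
    by (simp add: U_def m_def)
  note \<phi>(1)[THEN Fil_M, measurable] U(1)[THEN Fil_M, measurable]
  have \<phi>m: "\<bar>\<phi> m \<omega>\<bar> \<le> 1" "(\<phi> m \<omega>)\<^sup>2 \<le> 1" for \<omega> using \<phi>(2)[of m \<omega>] by auto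
  have i2: "integrable M (\<lambda>\<omega>. (\<phi> m \<omega> * D m \<omega>)\<^sup>2)"
    using \<phi>m by (intro Bochner_Integration.integrable_bound[OF D_square[of m]])
      (auto simp: power_mult_distrib mult_left_le_one_le)
  have i3: "integrable M (\<lambda>\<omega>. (U \<omega> * \<phi> m \<omega>)\<^sup>2)"
    using \<phi>m by (intro Bochner_Integration.integrable_bound[OF U(2)])
      (auto simp: power_mult_distrib mult_right_le_one_le)
  have cross: "(\<integral>\<omega>. (U \<omega> * \<phi> m \<omega>) * D m \<omega> \<partial>M) = 0"
    by (rule D_orth[OF borel_measurable_times[OF U(1) \<phi>(1)] i3])
  have ic: "integrable M (\<lambda>\<omega>. (U \<omega> * \<phi> m \<omega>) * D m \<omega>)"
    by (rule integrable_mult_of_squares[OF _ _ i3 D_square]) measurable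
  { case 1
    have "\<phi> m \<in> borel_measurable (Fil (Suc m))" "U \<in> borel_measurable (Fil (Suc m))"
      by (rule Fil_mono[OF _ \<phi>(1)], simp) (rule Fil_mono[OF _ U(1)], simp)
    then have "(\<lambda>\<omega>. U \<omega> + \<phi> m \<omega> * D m \<omega>) \<in> borel_measurable (Fil (Suc m))"
      using D_adapted[of m] by simp
    then show ?case unfolding step by (simp add: m_def)
  next
    case 2
    show ?case unfolding step by (rule integrable_square_add[OF _ _ U(2) i2]) measurable
  next
    case 3
    have "(\<integral>\<omega>. (\<Sum>i=n..<n + Suc k. \<phi> i \<omega> * D i \<omega>)\<^sup>2 \<partial>M)
        = (\<integral>\<omega>. (U \<omega>)\<^sup>2 + ((\<phi> m \<omega> * D m \<omega>)\<^sup>2 + 2 * ((U \<omega> * \<phi> m \<omega>) * D m \<omega>)) \<partial>M)"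
      unfolding step by (intro Bochner_Integration.integral_cong) (auto simp: power2_sum)
    also have "\<dots> = (\<integral>\<omega>. (U \<omega>)\<^sup>2 \<partial>M) + (\<integral>\<omega>. (\<phi> m \<omega> * D m \<omega>)\<^sup>2 \<partial>M)"
      using U(2) i2 ic cross by simp
    also have "(\<integral>\<omega>. (\<phi> m \<omega> * D m \<omega>)\<^sup>2 \<partial>M) \<le> (\<integral>\<omega>. (D m \<omega>)\<^sup>2 \<partial>M)"
      using \<phi>m by (intro integral_mono i2 D_square) (auto simp: power_mult_distrib mult_left_le_one_le)
    finally show ?case using U(3) by (simp add: m_def)
  }
qed

lemma partial_sum_adapted: "n \<le> m \<Longrightarrow> (\<lambda>\<omega>. \<Sum>i=n..<m. D i \<omega>) \<in> borel_measurable (Fil m)"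
  using transform_second_moment(1)[of "\<lambda>_ _. 1" n "m - n"] by simp

text \<open>Kolmogorov's inequality. Stop the sum when it first reaches \<open>e\<close>: the stopped sum \<open>U\<close> stays at
  that value, so a large maximum forces a large \<open>U\<close>, and Markov's inequality applies to its square.\<close>
lemma maximal_inequality:
  assumes e: "0 < e"
  shows "prob {\<omega>\<in>space M. \<exists>k\<le>N. e \<le> \<bar>\<Sum>i=n..<n+k. D i \<omega>\<bar>} \<le> (\<Sum>i=n..<n+N. \<integral>\<omega>. (D i \<omega>)\<^sup>2 \<partial>M) / e\<^sup>2"
proof -
  define S where "S m \<omega> = (\<Sum>i=n..<m. D i \<omega>)" for m \<omega>
  \<comment> \<open>The decision to continue: the level has not been reached so far.\<close>
  define \<phi> where "\<phi> i \<omega> = (if \<forall>m\<in>{n..i}. \<bar>S m \<omega>\<bar> < e then 1 else 0 :: real)" for i \<omega>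
  define U where "U k \<omega> = (\<Sum>i=n..<n+k. \<phi> i \<omega> * D i \<omega>)" for k \<omega>
  have S_m: "S m \<in> borel_measurable (Fil i)" if "n \<le> m" "m \<le> i" for m i
    unfolding S_def by (rule Fil_mono[OF that(2) partial_sum_adapted[OF that(1)]])
  have \<phi>: "\<phi> i \<in> borel_measurable (Fil i)" for i
  proof -
    have "{\<omega>\<in>space (Fil i). \<forall>m\<in>{n..i}. \<bar>S m \<omega>\<bar> < e} \<in> sets (Fil i)"
      using S_m by (intro sets.sets_Collect_finite_All) auto
    then show ?thesis unfolding \<phi>_def by (intro measurable_If) auto
  qed
  have \<phi>01: "\<phi> i \<omega> \<in> {0, 1}" for i \<omega> by (simp add: \<phi>_def)
  note U = transform_second_moment[of \<phi> n, OF \<phi> \<phi>01, folded U_def]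
  note U(1)[THEN Fil_M, measurable]
  have [measurable]: "S m \<in> borel_measurable M" for m unfolding S_def by measurable
  have run: "(\<exists>k\<le>N. e \<le> \<bar>S (n + k) \<omega>\<bar>) \<Longrightarrow> e \<le> \<bar>U N \<omega>\<bar>" for \<omega>
  proof -
    assume ex: "\<exists>k\<le>N. e \<le> \<bar>S (n + k) \<omega>\<bar>"
    define j where "j = (LEAST k. e \<le> \<bar>S (n + k) \<omega>\<bar>)"
    have j: "e \<le> \<bar>S (n + j) \<omega>\<bar>" unfolding j_def using ex by (elim exE conjE) (rule LeastI)
    have "j \<le> N" unfolding j_def using ex by (auto intro: Least_le order_trans)
    have less: "\<bar>S (n + k) \<omega>\<bar> < e" if "k < j" for k
      using not_less_Least[OF that[unfolded j_def]] by simp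
    have one: "\<phi> i \<omega> = 1" if "n \<le> i" "i < n + j" for i
    proof -
      have "\<bar>S m \<omega>\<bar> < e" if "m \<in> {n..i}" for m
        using less[of "m - n"] that \<open>i < n + j\<close> by auto
      then show ?thesis unfolding \<phi>_def by simp
    qed
    have zero: "\<phi> i \<omega> = 0" if "n + j \<le> i" for i
      using j that unfolding \<phi>_def by (auto simp: not_less intro!: bexI[of _ "n + j"])
    have "U N \<omega> = (\<Sum>i\<in>{n..<n+j}. \<phi> i \<omega> * D i \<omega>)"
      unfolding U_def using \<open>j \<le> N\<close> zero
      by (intro sum.mono_neutral_right) auto
    also have "\<dots> = S (n + j) \<omega>" unfolding S_def using one by (intro sum.cong) auto
    finally show "e \<le> \<bar>U N \<omega>\<bar>" using j by simp
  qed
  have "prob {\<omega>\<in>space M. \<exists>k\<le>N. e \<le> \<bar>S (n + k) \<omega>\<bar>} \<le> prob {\<omega>\<in>space M. e\<^sup>2 \<le> (U N \<omega>)\<^sup>2}"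
    using run e by (intro finite_measure_mono) (auto simp: abs_le_square_iff[symmetric])
  also have "\<dots> \<le> (\<integral>\<omega>. (U N \<omega>)\<^sup>2 \<partial>M) / e\<^sup>2"
    using e U(2) by (intro integral_Markov_inequality_measure[where A="{}"]) auto
  also have "\<dots> \<le> (\<Sum>i=n..<n+N. \<integral>\<omega>. (D i \<omega>)\<^sup>2 \<partial>M) / e\<^sup>2"
    using U(3)[of N] by (intro divide_right_mono) auto
  finally show ?thesis unfolding S_def .
qed

text \<open>The maximal inequality bounds the oscillation after time \<open>n\<close> by the tail of the variances, so almost
  surely the partial sums are Cauchy.\<close>
theorem AE_summable:
  assumes sum: "summable (\<lambda>n. \<integral>\<omega>. (D n \<omega>)\<^sup>2 \<partial>M)"
  shows "AE \<omega> in M. summable (\<lambda>n. D n \<omega>)"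
proof -
  define v where "v = (\<lambda>n. \<integral>\<omega>. (D n \<omega>)\<^sup>2 \<partial>M)"
  have v0: "0 \<le> v n" for n by (simp add: v_def)
  have sv: "summable v" using sum by (simp add: v_def)
  have "AE \<omega> in M. \<exists>n. \<forall>k. \<bar>\<Sum>i=n..<n+k. D i \<omega>\<bar> < e" if e: "0 < e" for e
  proof -
    define B where "B n N = {\<omega>\<in>space M. \<exists>k\<le>N. e \<le> \<bar>\<Sum>i=n..<n+k. D i \<omega>\<bar>}" for n N :: nat
    define C where "C = (\<Inter>n. \<Union>N. B n N)"
    have [measurable]: "B n N \<in> events" for n N unfolding B_def by measurable
    have [measurable]: "C \<in> events" unfolding C_def by measurable
    have Bb: "prob (B n N) \<le> (\<Sum>i. v (i + n)) / e\<^sup>2" for n N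
    proof -
      have "prob (B n N) \<le> (\<Sum>i=n..<n+N. v i) / e\<^sup>2"
        unfolding B_def v_def by (rule maximal_inequality[OF e])
      also have "(\<Sum>i=n..<n+N. v i) = (\<Sum>i<N. v (i + n))"
        using sum.shift_bounds_nat_ivl[of v 0 n N] by (simp add: atLeast0LessThan add.commute)
      also have "(\<Sum>i<N. v (i + n)) \<le> (\<Sum>i. v (i + n))"
        using sv v0 by (intro sum_le_suminf) (auto simp: summable_iff_shift)
      finally show ?thesis by (simp add: divide_right_mono)
    qed
    have "prob C \<le> (\<Sum>i. v (i + n)) / e\<^sup>2" for n
    proof -
      have "incseq (B n)" unfolding B_def incseq_def by (auto intro: order_trans)
      then have "(\<lambda>N. prob (B n N)) \<longlonglongrightarrow> prob (\<Union>N. B n N)"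
        by (intro finite_Lim_measure_incseq) auto
      then have "prob (\<Union>N. B n N) \<le> (\<Sum>i. v (i + n)) / e\<^sup>2"
        by (rule LIMSEQ_le_const2) (use Bb in auto)
      moreover have "prob C \<le> prob (\<Union>N. B n N)"
        by (intro finite_measure_mono) (auto simp: C_def)
      ultimately show ?thesis by simp
    qed
    moreover have "(\<lambda>n. (\<Sum>i. v (i + n)) / e\<^sup>2) \<longlonglongrightarrow> 0 / e\<^sup>2"
      by (intro tendsto_divide suminf_exist_split2[OF sv] tendsto_const) (use e in auto)
    ultimately have "prob C \<le> 0" using LIMSEQ_le_const by fastforce
    then have "prob C = 0" by (simp add: measure_le_0_iff)
    then have "C \<in> null_sets M" by (intro null_setsI) (auto simp: emeasure_eq_measure)
    then have "AE \<omega> in M. \<omega> \<notin> C" by (rule AE_not_in)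
    with AE_space show ?thesis
    proof eventually_elim
      case (elim \<omega>)
      then obtain n where n: "\<And>N. \<omega> \<notin> B n N" unfolding C_def by auto
      have "\<bar>\<Sum>i=n..<n+k. D i \<omega>\<bar> < e" for k
        using n[of k] elim(1) unfolding B_def by (auto simp: not_le)
      then show ?case by blast
    qed
  qed
  then have "AE \<omega> in M. \<forall>q::nat. \<exists>n. \<forall>k. \<bar>\<Sum>i=n..<n+k. D i \<omega>\<bar> < 1 / real (Suc q)"
    by (intro AE_all_countable[THEN iffD2]) simp
  then show ?thesis
  proof eventually_elim
    case (elim \<omega>)
    show ?case
      unfolding summable_Cauchy
    proof (intro allI impI)
      fix e :: real assume "0 < e"
      then obtain q where q: "1 / real (Suc q) < e / 2"
        using reals_Archimedean[of "e/2"] by (auto simp: inverse_eq_divide)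
      obtain n where n: "\<And>k. \<bar>\<Sum>i=n..<n+k. D i \<omega>\<bar> < 1 / real (Suc q)" using elim by blast
      have *: "norm (\<Sum>i=a..<b. D i \<omega>) < e" if "n \<le> a" for a b
      proof (cases "a \<le> b")
        case True
        have "(\<Sum>i=n..<n + (b - n). D i \<omega>) = (\<Sum>i=n..<n + (a - n). D i \<omega>) + (\<Sum>i=a..<b. D i \<omega>)"
          using that True by (simp add: sum.atLeastLessThan_concat)
        then show ?thesis using n[of "a - n"] n[of "b - n"] q unfolding real_norm_def by linarith
      qed (use \<open>0 < e\<close> in auto)
      then show "\<exists>N. \<forall>m\<ge>N. \<forall>n. norm (sum (\<lambda>n. D n \<omega>) {m..<n}) < e" by blast
    qed
  qed
qed

end


locale iid_sequence = prob_space M for M :: "'w measure" +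
  fixes X :: "nat \<Rightarrow> 'w \<Rightarrow> 'x::topological_space" and P :: "'x measure"
  assumes X_indep: "indep_vars (\<lambda>_. borel) X {1..}"
    and X_distr: "\<And>i. 1 \<le> i \<Longrightarrow> distr M borel (X i) = P"
begin

text \<open>The past is a \<open>\<sigma>\<close>-algebra on the sample space itself, generated by the first \<open>n\<close> observations. A
  quantity computed from the history can then be written as a function of the sample point, with
  measurability with respect to \<open>past n\<close> recording what it depends on.\<close>
definition past :: "nat \<Rightarrow> 'w measure" where
  "past n = vimage_algebra (space M) (\<lambda>\<omega>. \<lambda>i\<in>{1..n}. X i \<omega>) (\<Pi>\<^sub>M i\<in>{1..n}. borel)"

lemma space_past[simp]: "space (past n) = space M"
  by (simp add: past_def)

lemma X_measurable[measurable]: "1 \<le> i \<Longrightarrow> X i \<in> M \<rightarrow>\<^sub>M borel"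
  using X_indep by (auto simp: indep_vars_def)

lemma sets_P[measurable_cong]: "sets P = sets borel"
  using X_distr[of 1] by auto

lemma prob_space_P: "prob_space P"
  using X_distr[of 1] prob_space_distr[OF X_measurable[of 1]] by simp

lemma X_past:
  assumes "1 \<le> i" "i \<le> n"
  shows "X i \<in> past n \<rightarrow>\<^sub>M borel"
proof -
  have "(\<lambda>\<omega>. \<lambda>i\<in>{1..n}. X i \<omega>) \<in> past n \<rightarrow>\<^sub>M (\<Pi>\<^sub>M i\<in>{1..n}. borel)"
    unfolding past_def by (intro measurable_vimage_algebra1) (auto simp: space_PiM)
  from measurable_compose[OF this measurable_component_singleton[of i]] assms
  show ?thesis by simp
qed

lemma measurable_into_past:
  assumes "f \<in> space N \<rightarrow> space M" "\<And>i. 1 \<le> i \<Longrightarrow> i \<le> n \<Longrightarrow> (\<lambda>z. X i (f z)) \<in> N \<rightarrow>\<^sub>M borel"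
  shows "f \<in> N \<rightarrow>\<^sub>M past n"
  unfolding past_def using assms by (intro measurable_vimage_algebra2 measurable_restrict) auto

lemma id_into_past: "(\<lambda>\<omega>. \<omega>) \<in> M \<rightarrow>\<^sub>M past n"
  by (rule measurable_into_past) auto

lemma past_mono: "m \<le> n \<Longrightarrow> (\<lambda>\<omega>. \<omega>) \<in> past n \<rightarrow>\<^sub>M past m"
  by (rule measurable_into_past) (auto intro: X_past)

definition past_law :: "nat \<Rightarrow> 'w measure" where
  "past_law n = distr M (past n) (\<lambda>\<omega>. \<omega>)"

lemma sets_past_law[measurable_cong]: "sets (past_law n) = sets (past n)"
  by (simp add: past_law_def)

lemma prob_space_past_law: "prob_space (past_law n)"
  unfolding past_law_def by (rule prob_space_distr[OF id_into_past])

lemma pair_measurable: "(\<lambda>\<omega>. (\<omega>, X (Suc n) \<omega>)) \<in> M \<rightarrow>\<^sub>M past n \<Otimes>\<^sub>M borel"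
  using id_into_past by (intro measurable_Pair) auto

text \<open>Independence in the form that Fubini's theorem uses: the pair of a sample point, seen through the
  past, and the next observation is distributed according to a product measure.\<close>
lemma next_independent_of_past:
  "distr M (past n \<Otimes>\<^sub>M borel) (\<lambda>\<omega>. (\<omega>, X (Suc n) \<omega>)) = past_law n \<Otimes>\<^sub>M P"
proof -
  let ?H = "\<lambda>\<omega>. \<lambda>i\<in>{1..n}. X i \<omega>" and ?N = "\<Pi>\<^sub>M i\<in>{1..n}. (borel :: 'x measure)"
  have H: "?H \<in> space M \<rightarrow> space ?N" by (auto simp: space_PiM)
  let ?K = "\<lambda>\<omega>. \<lambda>i\<in>{Suc n}. X i \<omega>" and ?L = "\<Pi>\<^sub>M i\<in>{Suc n}. (borel :: 'x measure)"
  have "indep_var ?N ?H ?L ?K"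
    by (rule indep_var_restrict[OF X_indep]) auto
  then have indep: "indep_set (sigma_sets (space M) {?H -` A \<inter> space M | A. A \<in> sets ?N})
      (sigma_sets (space M) {?K -` A \<inter> space M | A. A \<in> sets ?L})"
    unfolding indep_var_eq by simp
  have sets: "sets (past n) = {?H -` A \<inter> space M | A. A \<in> sets ?N}"
    unfolding past_def by (rule sets_vimage_algebra2[OF H])
  interpret P: prob_space P by (rule prob_space_P)
  interpret Q: prob_space "past_law n" by (rule prob_space_past_law)
  have "past_law n \<Otimes>\<^sub>M P = distr M (past n \<Otimes>\<^sub>M borel) (\<lambda>\<omega>. (\<omega>, X (Suc n) \<omega>))"
  proof (rule pair_measure_eqI)
    show "sets (past_law n \<Otimes>\<^sub>M P) = sets (distr M (past n \<Otimes>\<^sub>M borel) (\<lambda>\<omega>. (\<omega>, X (Suc n) \<omega>)))"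
      by (simp add: sets_past_law sets_P cong: sets_pair_measure_cong)
  next
    fix A B assume "A \<in> sets (past_law n)" "B \<in> sets P"
    then have A: "A \<in> sets (past n)" and B[measurable]: "B \<in> sets borel"
      by (auto simp: sets_past_law sets_P)
    have "(\<lambda>\<omega>. \<omega>) -` A \<inter> space M = A" using sets.sets_into_space[OF A] by auto
    then have A_M: "A \<in> sets M" using measurable_sets[OF id_into_past A] by simp
    have "A \<in> sigma_sets (space M) {?H -` A \<inter> space M | A. A \<in> sets ?N}"
      using A unfolding sets by (rule sigma_sets.Basic)
    moreover have "X (Suc n) -` B \<inter> space M = ?K -` ((\<lambda>f. f (Suc n)) -` B \<inter> space ?L) \<inter> space M"
      by (auto simp: space_PiM)
    then have "X (Suc n) -` B \<inter> space M \<in> sigma_sets (space M) {?K -` A \<inter> space M | A. A \<in> sets ?L}"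
      by (intro sigma_sets.Basic CollectI exI[of _ "(\<lambda>f. f (Suc n)) -` B \<inter> space ?L"] conjI) auto
    ultimately have "prob (A \<inter> (X (Suc n) -` B \<inter> space M)) = prob A * prob (X (Suc n) -` B \<inter> space M)"
      by (rule indep_setD[OF indep])
    moreover have "emeasure (past_law n) A = prob A"
    proof -
      have "(\<lambda>\<omega>. \<omega>) -` A \<inter> space M = A" using sets.sets_into_space[OF A_M] by auto
      then show ?thesis unfolding past_law_def by (simp add: emeasure_distr[OF id_into_past A] emeasure_eq_measure)
    qed
    moreover have "emeasure P B = prob (X (Suc n) -` B \<inter> space M)"
      unfolding X_distr[of "Suc n", simplified, symmetric]
      by (subst emeasure_distr) (auto simp: emeasure_eq_measure)
    moreover have "emeasure (distr M (past n \<Otimes>\<^sub>M borel) (\<lambda>\<omega>. (\<omega>, X (Suc n) \<omega>))) (A \<times> B)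
        = prob (A \<inter> (X (Suc n) -` B \<inter> space M))"
    proof -
      have "(\<lambda>\<omega>. (\<omega>, X (Suc n) \<omega>)) -` (A \<times> B) \<inter> space M = A \<inter> (X (Suc n) -` B \<inter> space M)"
        using sets.sets_into_space[OF A_M] by auto
      then show ?thesis
        using A B by (simp add: emeasure_distr[OF pair_measurable] emeasure_eq_measure)
    qed
    ultimately show "emeasure (past_law n) A * emeasure P B
        = emeasure (distr M (past n \<Otimes>\<^sub>M borel) (\<lambda>\<omega>. (\<omega>, X (Suc n) \<omega>))) (A \<times> B)"
      by (simp add: ennreal_mult)
  qed unfold_locales
  then show ?thesis by simp
qed

lemma nn_integral_next:
  assumes [measurable]: "h \<in> borel_measurable (past n \<Otimes>\<^sub>M borel)"
  shows "(\<integral>\<^sup>+\<omega>. h (\<omega>, X (Suc n) \<omega>) \<partial>M) = (\<integral>\<^sup>+\<omega>. \<integral>\<^sup>+y. h (\<omega>, y) \<partial>P \<partial>M)"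
proof -
  interpret P: prob_space P by (rule prob_space_P)
  have [measurable]: "h \<in> borel_measurable (past n \<Otimes>\<^sub>M P)" "h \<in> borel_measurable (past_law n \<Otimes>\<^sub>M P)" by measurable
  have "(\<integral>\<^sup>+\<omega>. h (\<omega>, X (Suc n) \<omega>) \<partial>M) = (\<integral>\<^sup>+z. h z \<partial>(past_law n \<Otimes>\<^sub>M P))"
    unfolding next_independent_of_past[symmetric] by (rule nn_integral_distr[symmetric, OF pair_measurable]) simp
  also have "\<dots> = (\<integral>\<^sup>+\<omega>. \<integral>\<^sup>+y. h (\<omega>, y) \<partial>P \<partial>past_law n)"
    by (rule P.nn_integral_fst[symmetric]) simp
  also have "\<dots> = (\<integral>\<^sup>+\<omega>. \<integral>\<^sup>+y. h (\<omega>, y) \<partial>P \<partial>M)"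
    unfolding past_law_def by (intro nn_integral_distr id_into_past) simp
  finally show ?thesis .
qed

lemma integral_next:
  fixes h :: "'w \<times> 'x \<Rightarrow> real"
  assumes [measurable]: "h \<in> borel_measurable (past n \<Otimes>\<^sub>M borel)"
    and int: "integrable M (\<lambda>\<omega>. h (\<omega>, X (Suc n) \<omega>))"
  shows "(\<integral>\<omega>. h (\<omega>, X (Suc n) \<omega>) \<partial>M) = (\<integral>\<omega>. \<integral>y. h (\<omega>, y) \<partial>P \<partial>M)"
proof -
  interpret P: prob_space P by (rule prob_space_P)
  interpret Q: prob_space "past_law n" by (rule prob_space_past_law)
  interpret PQ: pair_sigma_finite "past_law n" P ..
  have [measurable]: "h \<in> borel_measurable (past n \<Otimes>\<^sub>M P)" "h \<in> borel_measurable (past_law n \<Otimes>\<^sub>M P)" by measurable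
  have i: "integrable (past_law n \<Otimes>\<^sub>M P) h"
    using int unfolding next_independent_of_past[symmetric] by (subst integrable_distr_eq[OF pair_measurable]) auto
  have "(\<integral>\<omega>. h (\<omega>, X (Suc n) \<omega>) \<partial>M) = (\<integral>z. h z \<partial>(past_law n \<Otimes>\<^sub>M P))"
    unfolding next_independent_of_past[symmetric] by (rule integral_distr[symmetric, OF pair_measurable]) simp
  also have "\<dots> = (\<integral>\<omega>. \<integral>y. h (\<omega>, y) \<partial>P \<partial>past_law n)"
    by (rule PQ.integral_fst'[symmetric, OF i])
  also have "\<dots> = (\<integral>\<omega>. \<integral>y. h (\<omega>, y) \<partial>P \<partial>M)"
    unfolding past_law_def by (intro integral_distr id_into_past) measurable
  finally show ?thesis .
qed

text \<open>The conditional mean of \<open>Z n \<omega> (X (Suc n) \<omega>)\<close> given the past is an integral over the law of one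
  observation, so the centred terms are martingale differences, with variances at most a constant times
  the squared weights.\<close>
theorem AE_summable_weighted_innovations:
  fixes Z :: "nat \<Rightarrow> 'w \<Rightarrow> 'x \<Rightarrow> real" and a :: "nat \<Rightarrow> real"
  assumes Z: "\<And>n. case_prod (Z n) \<in> borel_measurable (past n \<Otimes>\<^sub>M borel)"
    and bound: "\<And>n \<omega>. \<omega> \<in> space M \<Longrightarrow> (\<integral>\<^sup>+y. ennreal ((Z n \<omega> y)\<^sup>2) \<partial>P) \<le> ennreal C"
    and a: "summable (\<lambda>n. (a n)\<^sup>2)"
  shows "AE \<omega> in M. summable (\<lambda>n. a n * (Z n \<omega> (X (Suc n) \<omega>) - (\<integral>y. Z n \<omega> y \<partial>P)))"
proof -
  interpret P: prob_space P by (rule prob_space_P)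
  note Z[measurable]
  have Z'[measurable]: "case_prod (Z n) \<in> borel_measurable (past n \<Otimes>\<^sub>M P)" for n
    using Z[of n] by (simp cong: measurable_cong_sets)
  define c where "c n \<omega> = (\<integral>y. Z n \<omega> y \<partial>P)" for n \<omega>
  define V where "V n \<omega> = Z n \<omega> (X (Suc n) \<omega>)" for n \<omega>
  define D where "D n \<omega> = a n * (V n \<omega> - c n \<omega>)" for n \<omega>
  have C0: "0 \<le> max C 0" by simp
  have bound': "(\<integral>\<^sup>+y. ennreal ((Z n \<omega> y)\<^sup>2) \<partial>P) \<le> ennreal (max C 0)" if "\<omega> \<in> space M" for n \<omega>
    by (rule order_trans[OF bound[OF that] ennreal_leI]) simp
  have c_past: "c n \<in> borel_measurable (past n)" for n
    unfolding c_def by measurable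
  have c_M[measurable]: "c n \<in> borel_measurable M" for n
    using measurable_compose[OF id_into_past c_past] by simp
  have V_M[measurable]: "V n \<in> borel_measurable M" for n
    unfolding V_def using measurable_compose[OF pair_measurable Z[of n]] by simp
  have Z_slice: "Z n \<omega> \<in> borel_measurable P" if "\<omega> \<in> space M" for n \<omega>
    using measurable_Pair2[OF Z', of \<omega> n] that by simp
  have Z_sq: "integrable P (\<lambda>y. (Z n \<omega> y)\<^sup>2)" "(\<integral>y. (Z n \<omega> y)\<^sup>2 \<partial>P) \<le> max C 0" if "\<omega> \<in> space M" for n \<omega>
  proof -
    note Z_slice[OF that, measurable]
    show i: "integrable P (\<lambda>y. (Z n \<omega> y)\<^sup>2)"
      using bound'[OF that, of n] by (intro integrableI_bounded) (auto simp: le_less_trans[OF _ ennreal_less_top])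
    show "(\<integral>y. (Z n \<omega> y)\<^sup>2 \<partial>P) \<le> max C 0"
      using bound'[OF that, of n] unfolding nn_integral_eq_integral[OF i, simplified] ennreal_le_iff[OF C0] .
  qed
  have c_le: "(c n \<omega>)\<^sup>2 \<le> max C 0" if "\<omega> \<in> space M" for n \<omega>
  proof -
    note Z_slice[OF that, measurable]
    have i1: "integrable P (Z n \<omega>)" by (rule P.square_integrable_imp_integrable[OF _ Z_sq(1)[OF that]]) simp
    have "0 \<le> (\<integral>y. (Z n \<omega> y - c n \<omega>)\<^sup>2 \<partial>P)" by simp
    also have "\<dots> = (\<integral>y. (Z n \<omega> y)\<^sup>2 \<partial>P) - (c n \<omega>)\<^sup>2"
      unfolding c_def using P.variance_eq[OF i1 Z_sq(1)[OF that]] by simp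
    finally show ?thesis using Z_sq(2)[OF that, of n] by simp
  qed
  have V_sq_nn: "(\<integral>\<^sup>+\<omega>. ennreal ((V n \<omega>)\<^sup>2) \<partial>M) \<le> ennreal (max C 0)" for n
  proof -
    have "(\<integral>\<^sup>+\<omega>. ennreal ((V n \<omega>)\<^sup>2) \<partial>M) = (\<integral>\<^sup>+\<omega>. \<integral>\<^sup>+y. ennreal ((Z n \<omega> y)\<^sup>2) \<partial>P \<partial>M)"
      unfolding V_def using nn_integral_next[of "\<lambda>(\<omega>, y). ennreal ((Z n \<omega> y)\<^sup>2)" n] by simp
    also have "\<dots> \<le> (\<integral>\<^sup>+\<omega>. ennreal (max C 0) \<partial>M)" by (intro nn_integral_mono bound')
    also have "\<dots> = ennreal (max C 0)" by (simp add: emeasure_space_1)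
    finally show ?thesis .
  qed
  have V_sq: "integrable M (\<lambda>\<omega>. (V n \<omega>)\<^sup>2)" for n
    using V_sq_nn[of n] by (intro integrableI_bounded) (auto simp: le_less_trans[OF _ ennreal_less_top])
  have V_sq_le: "(\<integral>\<omega>. (V n \<omega>)\<^sup>2 \<partial>M) \<le> max C 0" for n
    using V_sq_nn[of n] unfolding nn_integral_eq_integral[OF V_sq, simplified] ennreal_le_iff[OF C0] .
  have c_sq: "integrable M (\<lambda>\<omega>. (c n \<omega>)\<^sup>2)" for n
    using c_le by (intro integrable_const_bound[of _ "max C 0"]) auto
  have Vc_sq: "integrable M (\<lambda>\<omega>. (V n \<omega> - c n \<omega>)\<^sup>2)" for n
    using integrable_square_add[of "V n" M "\<lambda>\<omega>. - c n \<omega>"] V_sq c_sq by simp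
  have D_sq_le: "(\<integral>\<omega>. (D n \<omega>)\<^sup>2 \<partial>M) \<le> 4 * max C 0 * (a n)\<^sup>2" for n
  proof -
    have "(\<integral>\<omega>. (V n \<omega> - c n \<omega>)\<^sup>2 \<partial>M) \<le> (\<integral>\<omega>. 2 * (V n \<omega>)\<^sup>2 + 2 * max C 0 \<partial>M)"
    proof (rule integral_mono)
      fix \<omega> assume "\<omega> \<in> space M"
      have "(V n \<omega> - c n \<omega>)\<^sup>2 \<le> 2 * (V n \<omega>)\<^sup>2 + 2 * (c n \<omega>)\<^sup>2"
        using sum_squares_bound[of "V n \<omega>" "- c n \<omega>"] by (simp add: power2_diff)
      then show "(V n \<omega> - c n \<omega>)\<^sup>2 \<le> 2 * (V n \<omega>)\<^sup>2 + 2 * max C 0"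
        using c_le[OF \<open>\<omega> \<in> space M\<close>, of n] by linarith
    qed (use Vc_sq V_sq in auto)
    also have "\<dots> \<le> 4 * max C 0" using V_sq[of n] V_sq_le[of n] by (simp add: prob_space)
    finally have "(a n)\<^sup>2 * (\<integral>\<omega>. (V n \<omega> - c n \<omega>)\<^sup>2 \<partial>M) \<le> (a n)\<^sup>2 * (4 * max C 0)"
      by (rule mult_left_mono) simp
    then show ?thesis by (simp add: D_def power_mult_distrib mult_ac)
  qed
  interpret D: martingale_differences M past D
  proof
    fix m n :: nat and f :: "'w \<Rightarrow> real"
    assume "m \<le> n" "f \<in> borel_measurable (past m)"
    then show "f \<in> borel_measurable (past n)" using measurable_compose[OF past_mono] by auto
  next
    fix n and f :: "'w \<Rightarrow> real" assume "f \<in> borel_measurable (past n)"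
    then show "f \<in> borel_measurable M" using measurable_compose[OF id_into_past] by auto
  next
    fix n
    have "(\<lambda>\<omega>. (\<omega>, X (Suc n) \<omega>)) \<in> past (Suc n) \<rightarrow>\<^sub>M past n \<Otimes>\<^sub>M borel"
      using past_mono[of n "Suc n"] X_past[of "Suc n" "Suc n"] by (intro measurable_Pair) auto
    from measurable_compose[OF this Z[of n]] have "V n \<in> borel_measurable (past (Suc n))"
      by (simp add: V_def[abs_def])
    moreover have "c n \<in> borel_measurable (past (Suc n))"
      using measurable_compose[OF past_mono c_past, of n "Suc n"] by simp
    ultimately show "D n \<in> borel_measurable (past (Suc n))" unfolding D_def by simp
    show "integrable M (\<lambda>\<omega>. (D n \<omega>)\<^sup>2)" using Vc_sq[of n] by (simp add: D_def power_mult_distrib)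
    fix \<phi> :: "'w \<Rightarrow> real" assume \<phi>[measurable]: "\<phi> \<in> borel_measurable (past n)" and \<phi>2: "integrable M (\<lambda>\<omega>. (\<phi> \<omega>)\<^sup>2)"
    have [measurable]: "\<phi> \<in> borel_measurable M" using measurable_compose[OF id_into_past \<phi>] by simp
    have i: "integrable M (\<lambda>\<omega>. \<phi> \<omega> * V n \<omega>)" "integrable M (\<lambda>\<omega>. \<phi> \<omega> * c n \<omega>)"
      by (intro integrable_mult_of_squares \<phi>2 V_sq c_sq; measurable)+
    have "(\<integral>\<omega>. \<phi> \<omega> * V n \<omega> \<partial>M) = (\<integral>\<omega>. \<phi> \<omega> * c n \<omega> \<partial>M)"
      using integral_next[of "\<lambda>(\<omega>, y). \<phi> \<omega> * Z n \<omega> y" n] i(1) by (simp add: V_def c_def)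
    then have "(\<integral>\<omega>. \<phi> \<omega> * V n \<omega> - \<phi> \<omega> * c n \<omega> \<partial>M) = 0" using i by simp
    moreover have "(\<lambda>\<omega>. \<phi> \<omega> * D n \<omega>) = (\<lambda>\<omega>. a n * (\<phi> \<omega> * V n \<omega> - \<phi> \<omega> * c n \<omega>))"
      by (simp add: D_def algebra_simps fun_eq_iff)
    ultimately show "(\<integral>\<omega>. \<phi> \<omega> * D n \<omega> \<partial>M) = 0" by simp
  qed
  have "summable (\<lambda>n. \<integral>\<omega>. (D n \<omega>)\<^sup>2 \<partial>M)"
    by (rule summable_comparison_test'[OF summable_mult[OF a, of "4 * max C 0"], of 0])
      (use D_sq_le in auto)
  from D.AE_summable[OF this] show ?thesis by (simp add: D_def V_def c_def)
qed

text \<open>The expectation of the series is finite, hence the series is finite almost surely.\<close>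
lemma AE_summable_weighted_nonneg:
  fixes Y :: "nat \<Rightarrow> 'w \<Rightarrow> 'x \<Rightarrow> real" and b :: "nat \<Rightarrow> real"
  assumes Y: "\<And>n. case_prod (Y n) \<in> borel_measurable (past n \<Otimes>\<^sub>M borel)"
    and Y0: "\<And>n \<omega> y. 0 \<le> Y n \<omega> y"
    and bound: "\<And>n \<omega>. \<omega> \<in> space M \<Longrightarrow> (\<integral>\<^sup>+y. ennreal (Y n \<omega> y) \<partial>P) \<le> ennreal C"
    and b: "summable b" and b0: "\<And>n. 0 \<le> b n"
  shows "AE \<omega> in M. summable (\<lambda>n. b n * Y n \<omega> (X (Suc n) \<omega>))"
proof -
  note Y[measurable]
  have [measurable]: "(\<lambda>\<omega>. Y n \<omega> (X (Suc n) \<omega>)) \<in> borel_measurable M" for n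
    using measurable_compose[OF pair_measurable Y[of n]] by simp
  have le: "(\<integral>\<^sup>+\<omega>. ennreal (b n * Y n \<omega> (X (Suc n) \<omega>)) \<partial>M) \<le> ennreal (b n * max C 0)" for n
  proof -
    have "(\<integral>\<^sup>+\<omega>. ennreal (b n * Y n \<omega> (X (Suc n) \<omega>)) \<partial>M)
        = ennreal (b n) * (\<integral>\<^sup>+\<omega>. ennreal (Y n \<omega> (X (Suc n) \<omega>)) \<partial>M)"
      using b0 Y0 by (simp add: ennreal_mult nn_integral_cmult)
    also have "(\<integral>\<^sup>+\<omega>. ennreal (Y n \<omega> (X (Suc n) \<omega>)) \<partial>M) = (\<integral>\<^sup>+\<omega>. \<integral>\<^sup>+y. ennreal (Y n \<omega> y) \<partial>P \<partial>M)"
      using nn_integral_next[of "\<lambda>(\<omega>, y). ennreal (Y n \<omega> y)" n] by simp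
    also have "\<dots> \<le> (\<integral>\<^sup>+\<omega>. ennreal (max C 0) \<partial>M)"
      by (intro nn_integral_mono order_trans[OF bound]) (auto intro: ennreal_leI)
    also have "\<dots> = ennreal (max C 0)" by (simp add: emeasure_space_1)
    finally show ?thesis using b0[of n] by (simp add: ennreal_mult mult_left_mono)
  qed
  have "(\<integral>\<^sup>+\<omega>. (\<Sum>n. ennreal (b n * Y n \<omega> (X (Suc n) \<omega>))) \<partial>M)
      = (\<Sum>n. \<integral>\<^sup>+\<omega>. ennreal (b n * Y n \<omega> (X (Suc n) \<omega>)) \<partial>M)"
    by (rule nn_integral_suminf) measurable
  also have "\<dots> \<le> (\<Sum>n. ennreal (b n * max C 0))"
    by (intro suminf_le le) auto
  also have "\<dots> = ennreal (\<Sum>n. b n * max C 0)"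
    using b b0 by (intro suminf_ennreal2 summable_mult2) auto
  finally have "(\<integral>\<^sup>+\<omega>. (\<Sum>n. ennreal (b n * Y n \<omega> (X (Suc n) \<omega>))) \<partial>M) \<noteq> \<infinity>"
    by (auto simp: top_unique)
  then have "AE \<omega> in M. (\<Sum>n. ennreal (b n * Y n \<omega> (X (Suc n) \<omega>))) \<noteq> \<infinity>"
    by (intro nn_integral_PInf_AE) measurable
  then show ?thesis
    by eventually_elim (intro summable_suminf_not_top, use b0 Y0 in auto)
qed

end

section \<open>Mixtures and the second moments of their ratios\<close>

lemma dense_sequence_exists:
  obtains e :: "nat \<Rightarrow> 't::{metric_space,second_countable_topology}"
  where "\<And>r \<theta>. 0 < r \<Longrightarrow> \<exists>i. dist (e i) \<theta> < r"
proof -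
  obtain D :: "'t set" where D: "countable D" "\<And>U. open U \<Longrightarrow> U \<noteq> {} \<Longrightarrow> \<exists>d\<in>D. d \<in> U"
    by (rule countable_dense_setE) blast
  have "\<exists>i. dist (from_nat_into D i) \<theta> < r" if "0 < r" for r \<theta>
  proof -
    obtain d where d: "d \<in> D" "d \<in> ball \<theta> r" using D(2)[of "ball \<theta> r"] \<open>0 < r\<close> by auto
    then obtain i where "from_nat_into D i = d" using D(1) by (meson from_nat_into_surj)
    then show ?thesis using d by (auto simp: dist_commute)
  qed
  then show ?thesis by (rule that)
qed

text \<open>Measurability in one variable and continuity in the other give joint measurability: approximate the
  second argument by points of a countable dense set, and pass to the limit.\<close>
lemma borel_measurable_separately_continuous:
  fixes h :: "'a \<Rightarrow> 't::{metric_space,second_countable_topology} \<Rightarrow> real"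
  assumes meas: "\<And>t. (\<lambda>x. h x t) \<in> borel_measurable M" and cont: "\<And>x. continuous_on UNIV (h x)"
  shows "(\<lambda>(x, t). h x t) \<in> borel_measurable (M \<Otimes>\<^sub>M borel)"
proof -
  obtain e :: "nat \<Rightarrow> 't" where e: "\<And>r t. 0 < r \<Longrightarrow> \<exists>i. dist (e i) t < r"
    by (rule dense_sequence_exists) (rule that)
  define near where "near k t = (LEAST i. dist (e i) t < 1 / real (Suc k))" for k t
  have near: "dist (e (near k t)) t < 1 / real (Suc k)" for k t
    unfolding near_def by (rule LeastI_ex, rule e) simp
  have [measurable]: "near k \<in> borel \<rightarrow>\<^sub>M count_space UNIV" for k
    unfolding near_def by measurable
  show ?thesis
  proof (rule borel_measurable_LIMSEQ_metric)
    fix k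
    have "(\<lambda>z. h (fst z) (e i)) \<in> borel_measurable (M \<Otimes>\<^sub>M borel)" for i
      using measurable_compose[OF measurable_fst meas] .
    then have "(\<lambda>z. h (fst z) (e (near k (snd z)))) \<in> borel_measurable (M \<Otimes>\<^sub>M borel)"
      by (rule measurable_compose_countable[where g="\<lambda>z. near k (snd z)"]) measurable
    then show "(\<lambda>(x, t). h x (e (near k t))) \<in> borel_measurable (M \<Otimes>\<^sub>M borel)"
      by (simp add: case_prod_beta')
  next
    fix z :: "'a \<times> 't"
    have "(\<lambda>k. 1 / real (Suc k)) \<longlonglongrightarrow> 0"
      using LIMSEQ_inverse_real_of_nat by (simp add: inverse_eq_divide)
    then have "(\<lambda>k. dist (e (near k (snd z))) (snd z)) \<longlonglongrightarrow> 0"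
    proof (rule Lim_null_comparison[rotated])
      show "\<forall>\<^sub>F k in sequentially. norm (dist (e (near k (snd z))) (snd z)) \<le> 1 / real (Suc k)"
      proof (rule always_eventually, rule allI)
        fix k
        show "norm (dist (e (near k (snd z))) (snd z)) \<le> 1 / real (Suc k)"
          unfolding real_norm_def abs_of_nonneg[OF zero_le_dist]
          by (rule less_imp_le[OF near[of k "snd z"]])
      qed
    qed
    then have "(\<lambda>k. e (near k (snd z))) \<longlonglongrightarrow> snd z" by (subst tendsto_dist_iff)
    then have "(\<lambda>k. h (fst z) (e (near k (snd z)))) \<longlonglongrightarrow> h (fst z) (snd z)"
      by (rule continuous_on_tendsto_compose[OF cont[of "fst z"]]) simp_all
    then show "(\<lambda>k. case z of (x, t) \<Rightarrow> h x (e (near k t))) \<longlonglongrightarrow> (case z of (x, t) \<Rightarrow> h x t)"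
      by (simp add: case_prod_beta')
  qed
qed

lemma (in prob_space) nn_integral_square_le:
  assumes "f \<in> borel_measurable M"
  shows "(\<integral>\<^sup>+x. f x \<partial>M)\<^sup>2 \<le> (\<integral>\<^sup>+x. (f x)\<^sup>2 \<partial>M)"
  using Cauchy_Schwarz_nn_integral[of f M "\<lambda>_. 1"] assms by (simp add: emeasure_space_1)

text \<open>Convexity of \<open>1/t\<^sup>2\<close>, obtained by applying the Cauchy--Schwarz inequality first to \<open>sqrt f\<close> and \<open>1 / sqrt f\<close>, then to
  \<open>1 / f\<close>.\<close>
lemma (in prob_space) one_le_mean_times_mean_inverse_square:
  fixes f :: "'a \<Rightarrow> real"
  assumes [measurable]: "f \<in> borel_measurable M" and pos: "AE x in M. 0 < f x"
  shows "1 \<le> (\<integral>\<^sup>+x. ennreal (f x) \<partial>M)\<^sup>2 * (\<integral>\<^sup>+x. (1 / ennreal (f x))\<^sup>2 \<partial>M)"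
proof -
  define a b where "a = (\<integral>\<^sup>+x. ennreal (f x) \<partial>M)" and "b = (\<integral>\<^sup>+x. 1 / ennreal (f x) \<partial>M)"
  have "1 = (\<integral>\<^sup>+x. 1 \<partial>M)\<^sup>2" by (simp add: emeasure_space_1)
  also have "(\<integral>\<^sup>+x. 1 \<partial>M) = (\<integral>\<^sup>+x. ennreal (sqrt (f x)) * ennreal (1 / sqrt (f x)) \<partial>M)"
    using pos by (intro nn_integral_cong_AE) (auto simp: ennreal_mult[symmetric])
  also have "\<dots>\<^sup>2 \<le> (\<integral>\<^sup>+x. (ennreal (sqrt (f x)))\<^sup>2 \<partial>M) * (\<integral>\<^sup>+x. (ennreal (1 / sqrt (f x)))\<^sup>2 \<partial>M)"
    by (rule Cauchy_Schwarz_nn_integral) auto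
  also have "(\<integral>\<^sup>+x. (ennreal (sqrt (f x)))\<^sup>2 \<partial>M) = a"
    unfolding a_def using pos by (intro nn_integral_cong_AE) (auto simp: ennreal_power)
  also have "(\<integral>\<^sup>+x. (ennreal (1 / sqrt (f x)))\<^sup>2 \<partial>M) = b"
    unfolding b_def using pos
  proof (intro nn_integral_cong_AE, eventually_elim)
    case (elim x)
    then have "1 / ennreal (f x) = ennreal (1 / f x)" using divide_ennreal[of 1 "f x"] by simp
    with elim show ?case by (simp add: ennreal_power power_divide)
  qed
  finally have "1 \<le> a * b" .
  then have "1 * 1 \<le> (a * b) * (a * b)" by (intro mult_mono) auto
  then have "1 \<le> a\<^sup>2 * b\<^sup>2" by (simp add: power2_eq_square mult_ac)
  also have "\<dots> \<le> a\<^sup>2 * (\<integral>\<^sup>+x. (1 / ennreal (f x))\<^sup>2 \<partial>M)"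
    unfolding b_def by (intro mult_left_mono nn_integral_square_le) auto
  finally show ?thesis unfolding a_def .
qed

definition mixing :: "'t::topological_space measure \<Rightarrow> bool" where
  "mixing G \<longleftrightarrow> prob_space G \<and> sets G = sets borel"

lemma mixingD: "mixing G \<Longrightarrow> prob_space G" "mixing G \<Longrightarrow> sets G = sets borel" "mixing G \<Longrightarrow> space G = UNIV"
  using sets_eq_imp_space_eq[of G borel] by (auto simp: mixing_def)

lemma mixing_return: "mixing (return borel \<theta>)"
  by (simp add: mixing_def prob_space_return)

locale sampling_model =
  fixes \<nu> :: "'x::topological_space measure"
    and p :: "'x \<Rightarrow> 't::{metric_space,second_countable_topology} \<Rightarrow> real"
    and B :: real
  assumes nu_sigma_finite: "sigma_finite_measure \<nu>" and sets_nu: "sets \<nu> = sets borel"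
    and p_density: "\<And>\<theta>. is_prob_density \<nu> (\<lambda>x. p x \<theta>)"
    and p_bounded: "\<And>x. bounded (range (p x))" and p_continuous: "\<And>x. continuous_on UNIV (p x)"
    and p_ratio: "\<And>\<theta>\<^sub>1 \<theta>\<^sub>2 \<theta>\<^sub>3. (\<integral>\<^sup>+x. (ennreal (p x \<theta>\<^sub>1) / ennreal (p x \<theta>\<^sub>2))\<^sup>2 * ennreal (p x \<theta>\<^sub>3) \<partial>\<nu>) \<le> ennreal B"
begin

sublocale \<nu>: sigma_finite_measure \<nu> by (rule nu_sigma_finite)

lemma sets_nu'[measurable_cong]: "sets \<nu> = sets borel" by (rule sets_nu)

abbreviation mix :: "'t measure \<Rightarrow> 'x \<Rightarrow> real" where "mix \<equiv> mixture_of_measure p"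

definition law :: "'t measure \<Rightarrow> 'x measure" where
  "law G = density \<nu> (\<lambda>x. ennreal (mix G x))"

lemma sets_law[measurable_cong]: "sets (law G) = sets borel" by (simp add: law_def sets_nu)

lemma space_law[simp]: "space (law G) = UNIV" using sets_eq_imp_space_eq[OF sets_law] by simp

lemma p_nonneg[simp]: "0 \<le> p x \<theta>"
  using p_density[of \<theta>] by (simp add: is_prob_density_def)

lemma p_integral: "(\<integral>\<^sup>+x. ennreal (p x \<theta>) \<partial>\<nu>) = 1"
  using p_density[of \<theta>] by (simp add: is_prob_density_def)

lemma p_measurable[measurable (raw)]:
  assumes "g \<in> N \<rightarrow>\<^sub>M borel" "h \<in> N \<rightarrow>\<^sub>M borel"
  shows "(\<lambda>z. p (g z) (h z)) \<in> borel_measurable N"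
proof -
  have "(\<lambda>(x, \<theta>). p x \<theta>) \<in> borel_measurable (borel \<Otimes>\<^sub>M borel)"
  proof (rule borel_measurable_separately_continuous[OF _ p_continuous])
    fix \<theta>
    show "(\<lambda>x. p x \<theta>) \<in> borel_measurable borel"
      using p_density[of \<theta>] by (simp add: is_prob_density_def cong: measurable_cong_sets[OF sets_nu refl])
  qed
  from measurable_compose[OF measurable_Pair[OF assms] this] show ?thesis by simp
qed

definition p_sup :: "'x \<Rightarrow> real" where "p_sup x = (SUP \<theta>. p x \<theta>)"

lemma p_le: "p x \<theta> \<le> p_sup x"
  unfolding p_sup_def using p_bounded[of x] by (intro cSUP_upper bounded_imp_bdd_above) auto

lemma p_sup_nonneg: "0 \<le> p_sup x" using order_trans[OF p_nonneg p_le] .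

lemma p_integrable:
  assumes G: "mixing G" shows "integrable G (p x)"
proof -
  interpret prob_space G using G by (rule mixingD)
  have [measurable_cong]: "sets G = sets borel" using G by (rule mixingD)
  show ?thesis using p_le[of x] by (intro integrable_const_bound[of _ "p_sup x"]) auto
qed

lemma mix_measurable[measurable]:
  assumes G: "mixing G" shows "mix G \<in> borel_measurable borel"
proof -
  interpret prob_space G using G by (rule mixingD)
  have [measurable_cong]: "sets G = sets borel" using G by (rule mixingD)
  show ?thesis unfolding mixture_of_measure_def[abs_def] by measurable
qed

lemma mix_nonneg[simp]: "0 \<le> mix G x"
  by (simp add: mixture_of_measure_def)

lemma ennreal_mix: "mixing G \<Longrightarrow> ennreal (mix G x) = (\<integral>\<^sup>+\<theta>. ennreal (p x \<theta>) \<partial>G)"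
  unfolding mixture_of_measure_def by (rule nn_integral_eq_integral[symmetric, OF p_integrable]) auto

lemma mix_return: "mix (return borel \<theta>) x = p x \<theta>"
  unfolding mixture_of_measure_def by (rule integral_return) auto

lemma nn_integral_law:
  assumes G: "mixing G" and [measurable]: "h \<in> borel_measurable borel"
  shows "(\<integral>\<^sup>+x. h x \<partial>law G) = (\<integral>\<^sup>+\<theta>. \<integral>\<^sup>+x. h x * ennreal (p x \<theta>) \<partial>\<nu> \<partial>G)"
proof -
  interpret G: prob_space G using G by (rule mixingD)
  interpret pair_sigma_finite \<nu> G ..
  have [measurable_cong]: "sets G = sets borel" using G by (rule mixingD)
  note mix_measurable[OF G, measurable]
  have "(\<integral>\<^sup>+x. h x \<partial>law G) = (\<integral>\<^sup>+x. h x * (\<integral>\<^sup>+\<theta>. ennreal (p x \<theta>) \<partial>G) \<partial>\<nu>)"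
    unfolding law_def using ennreal_mix[OF G] by (subst nn_integral_density) (auto simp: mult.commute)
  also have "\<dots> = (\<integral>\<^sup>+x. \<integral>\<^sup>+\<theta>. h x * ennreal (p x \<theta>) \<partial>G \<partial>\<nu>)"
    by (simp add: nn_integral_cmult)
  also have "\<dots> = (\<integral>\<^sup>+\<theta>. \<integral>\<^sup>+x. h x * ennreal (p x \<theta>) \<partial>\<nu> \<partial>G)"
    by (rule Fubini'[symmetric]) measurable
  finally show ?thesis .
qed

lemma prob_space_law: assumes G: "mixing G" shows "prob_space (law G)"
proof
  interpret G: prob_space G using G by (rule mixingD)
  show "emeasure (law G) (space (law G)) = 1"
    using nn_integral_law[OF G, of "\<lambda>_. 1"] by (simp add: p_integral G.emeasure_space_1)
qed

text \<open>A finite mean of the squared likelihood ratio rules out that the denominator vanishes where the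
  observation density is positive: all sampling distributions are mutually absolutely continuous.\<close>
lemma AE_law_p_pos: assumes G: "mixing G" shows "AE x in law G. 0 < p x \<theta>"
proof -
  have "(\<integral>\<^sup>+x. indicator {x. p x \<theta> = 0} x * ennreal (p x \<theta>') \<partial>\<nu>) = 0" for \<theta>'
  proof -
    have "(\<integral>\<^sup>+x. (ennreal (p x \<theta>') / ennreal (p x \<theta>))\<^sup>2 * ennreal (p x \<theta>') \<partial>\<nu>) \<noteq> \<infinity>"
      using p_ratio[of \<theta>' \<theta> \<theta>'] by (auto simp: top_unique)
    then have "AE x in \<nu>. (ennreal (p x \<theta>') / ennreal (p x \<theta>))\<^sup>2 * ennreal (p x \<theta>') \<noteq> \<infinity>"
      by (intro nn_integral_PInf_AE) measurable
    then have "AE x in \<nu>. indicator {x. p x \<theta> = 0} x * ennreal (p x \<theta>') = 0"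
    proof eventually_elim
      case (elim x)
      show ?case
      proof (cases "p x \<theta> = 0 \<and> p x \<theta>' \<noteq> 0")
        case True
        then have "0 < p x \<theta>'" using p_nonneg[of x \<theta>'] by linarith
        then show ?thesis using elim True by (simp add: ennreal_divide_eq_top_iff power2_eq_square ennreal_mult_eq_top_iff)
      qed (auto simp: indicator_def)
    qed
    then show ?thesis by (subst nn_integral_0_iff_AE) auto
  qed
  then have "(\<integral>\<^sup>+x. indicator {x. p x \<theta> = 0} x \<partial>law G) = 0"
    by (subst nn_integral_law[OF G]) auto
  then have "AE x in law G. indicator {x. p x \<theta> = 0} x = (0::ennreal)"
    by (subst (asm) nn_integral_0_iff_AE) auto
  then show ?thesis
    by eventually_elim (metis indicator_simps(1) less_eq_real_def mem_Collect_eq p_nonneg zero_neq_one)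
qed

lemma AE_law_AE_p_pos:
  assumes G: "mixing G" and H: "mixing H" shows "AE x in law G. AE \<theta> in H. 0 < p x \<theta>"
proof -
  interpret P: prob_space "law G" using G by (rule prob_space_law)
  interpret H: prob_space H using H by (rule mixingD)
  interpret pair_sigma_finite "law G" H ..
  have [measurable_cong]: "sets H = sets borel" using H by (rule mixingD)
  have sp: "space H = UNIV" using H by (rule mixingD)
  have "(AE x in law G. AE \<theta> in H. 0 < p x \<theta>) \<longleftrightarrow> (AE \<theta> in H. AE x in law G. 0 < p x \<theta>)"
    by (rule AE_commute) measurable
  then show ?thesis using AE_law_p_pos[OF G] by simp
qed

lemma mix_pos: assumes H: "mixing H" and "AE \<theta> in H. 0 < p x \<theta>" shows "0 < mix H x"
proof -
  interpret H: prob_space H using H by (rule mixingD)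
  have "mix H x \<noteq> 0"
  proof
    assume "mix H x = 0"
    then have "AE \<theta> in H. p x \<theta> = 0"
      unfolding mixture_of_measure_def by (subst (asm) integral_nonneg_eq_0_iff_AE[OF p_integrable[OF H]]) auto
    with assms(2) have "AE \<theta> in H. False" by eventually_elim simp
    then show False by simp
  qed
  then show ?thesis using mix_nonneg[of H x] by linarith
qed

lemma AE_law_mix_pos:
  assumes G: "mixing G" and H: "mixing H" shows "AE x in law G. 0 < mix H x"
  using AE_law_AE_p_pos[OF assms] by eventually_elim (rule mix_pos[OF H])

text \<open>The function \<open>a\<^sup>2/b\<^sup>2\<close> is convex in each of its arguments, so the squared ratio of two means is at most
  the mean of the squared ratios.\<close>
lemma mixture_ratio_le:
  assumes G: "mixing G" and H: "mixing H" and pos: "AE \<theta> in H. 0 < p x \<theta>"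
  shows "ennreal ((mix G x / mix H x)\<^sup>2)
    \<le> (\<integral>\<^sup>+\<theta>\<^sub>1. \<integral>\<^sup>+\<theta>\<^sub>2. (ennreal (p x \<theta>\<^sub>1) / ennreal (p x \<theta>\<^sub>2))\<^sup>2 \<partial>H \<partial>G)"
proof -
  interpret G: prob_space G using G by (rule mixingD)
  interpret H: prob_space H using H by (rule mixingD)
  have [measurable_cong]: "sets G = sets borel" "sets H = sets borel" using G H by (auto dest: mixingD)
  define a b where "a = ennreal (mix G x)" and "b = ennreal (mix H x)"
  define c where "c = (\<integral>\<^sup>+\<theta>. (1 / ennreal (p x \<theta>))\<^sup>2 \<partial>H)"
  have H_pos: "0 < mix H x" by (rule mix_pos[OF H pos])
  then have b: "0 < b" "b < \<infinity>" by (auto simp: b_def)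
  have bc: "1 \<le> b\<^sup>2 * c"
    unfolding b_def c_def ennreal_mix[OF H] by (rule H.one_le_mean_times_mean_inverse_square) (use pos in auto)
  have a2: "a\<^sup>2 \<le> (\<integral>\<^sup>+\<theta>. (ennreal (p x \<theta>))\<^sup>2 \<partial>G)"
    unfolding a_def ennreal_mix[OF G] by (rule G.nn_integral_square_le) measurable
  have "ennreal ((mix G x / mix H x)\<^sup>2) = a\<^sup>2 / b\<^sup>2"
    using H_pos by (simp add: a_def b_def ennreal_power divide_ennreal power_divide)
  also have "\<dots> \<le> a\<^sup>2 * c"
  proof -
    have "a\<^sup>2 * 1 \<le> a\<^sup>2 * (b\<^sup>2 * c)" using bc by (rule mult_left_mono) simp
    then have "a\<^sup>2 \<le> b\<^sup>2 * (a\<^sup>2 * c)" by (simp add: mult_ac)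
    moreover have "0 < b\<^sup>2" using b by (simp add: power2_eq_square ennreal_zero_less_mult_iff)
    ultimately show ?thesis by (intro divide_le_posI_ennreal)
  qed
  also have "\<dots> \<le> (\<integral>\<^sup>+\<theta>. (ennreal (p x \<theta>))\<^sup>2 \<partial>G) * c" using a2 by (rule mult_right_mono) simp
  also have "\<dots> = (\<integral>\<^sup>+\<theta>\<^sub>1. \<integral>\<^sup>+\<theta>\<^sub>2. (ennreal (p x \<theta>\<^sub>1) / ennreal (p x \<theta>\<^sub>2))\<^sup>2 \<partial>H \<partial>G)"
  proof -
    have "(\<integral>\<^sup>+\<theta>\<^sub>2. (ennreal (p x \<theta>\<^sub>1) / ennreal (p x \<theta>\<^sub>2))\<^sup>2 \<partial>H) = (ennreal (p x \<theta>\<^sub>1))\<^sup>2 * c" for \<theta>\<^sub>1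
      unfolding c_def by (subst nn_integral_cmult[symmetric]) (auto simp: divide_ennreal_def power_mult_distrib)
    then show ?thesis by (simp add: nn_integral_multc)
  qed
  finally show ?thesis .
qed

text \<open>The bound on likelihood ratios of three single parameters extends to three arbitrary mixing
  distributions. Every moment bound below is an instance of it.\<close>
theorem nn_integral_mixture_ratio:
  assumes F: "mixing F" and G: "mixing G" and H: "mixing H"
  shows "(\<integral>\<^sup>+x. ennreal ((mix G x / mix H x)\<^sup>2) \<partial>law F) \<le> ennreal B"
proof -
  interpret F: prob_space F using F by (rule mixingD)
  interpret G: prob_space G using G by (rule mixingD)
  interpret H: prob_space H using H by (rule mixingD)
  interpret P: prob_space "law F" using F by (rule prob_space_law)
  have [measurable_cong]: "sets G = sets borel" "sets H = sets borel" "sets F = sets borel"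
    using G H F by (auto dest: mixingD)
  interpret PG: pair_sigma_finite "law F" G ..
  interpret PH: pair_sigma_finite "law F" H ..
  let ?\<rho> = "\<lambda>x \<theta>\<^sub>1 \<theta>\<^sub>2. (ennreal (p x \<theta>\<^sub>1) / ennreal (p x \<theta>\<^sub>2))\<^sup>2"
  have "(\<integral>\<^sup>+x. ennreal ((mix G x / mix H x)\<^sup>2) \<partial>law F) \<le> (\<integral>\<^sup>+x. \<integral>\<^sup>+\<theta>\<^sub>1. \<integral>\<^sup>+\<theta>\<^sub>2. ?\<rho> x \<theta>\<^sub>1 \<theta>\<^sub>2 \<partial>H \<partial>G \<partial>law F)"
    using AE_law_AE_p_pos[OF F H] by (intro nn_integral_mono_AE) (auto elim!: eventually_mono intro: mixture_ratio_le[OF G H])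
  also have "\<dots> = (\<integral>\<^sup>+\<theta>\<^sub>1. \<integral>\<^sup>+x. \<integral>\<^sup>+\<theta>\<^sub>2. ?\<rho> x \<theta>\<^sub>1 \<theta>\<^sub>2 \<partial>H \<partial>law F \<partial>G)"
    by (rule PG.Fubini'[symmetric]) measurable
  also have "\<dots> = (\<integral>\<^sup>+\<theta>\<^sub>1. \<integral>\<^sup>+\<theta>\<^sub>2. \<integral>\<^sup>+x. ?\<rho> x \<theta>\<^sub>1 \<theta>\<^sub>2 \<partial>law F \<partial>H \<partial>G)"
    by (intro nn_integral_cong PH.Fubini'[symmetric]) measurable
  also have "\<dots> \<le> (\<integral>\<^sup>+\<theta>\<^sub>1. \<integral>\<^sup>+\<theta>\<^sub>2. ennreal B \<partial>H \<partial>G)"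
  proof (intro nn_integral_mono)
    fix \<theta>\<^sub>1 \<theta>\<^sub>2
    have "(\<integral>\<^sup>+x. ?\<rho> x \<theta>\<^sub>1 \<theta>\<^sub>2 \<partial>law F) = (\<integral>\<^sup>+\<theta>\<^sub>3. \<integral>\<^sup>+x. ?\<rho> x \<theta>\<^sub>1 \<theta>\<^sub>2 * ennreal (p x \<theta>\<^sub>3) \<partial>\<nu> \<partial>F)"
      by (rule nn_integral_law[OF F]) measurable
    also have "\<dots> \<le> (\<integral>\<^sup>+\<theta>\<^sub>3. ennreal B \<partial>F)" by (intro nn_integral_mono p_ratio)
    finally show "(\<integral>\<^sup>+x. ?\<rho> x \<theta>\<^sub>1 \<theta>\<^sub>2 \<partial>law F) \<le> ennreal B" by (simp add: F.emeasure_space_1)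
  qed
  also have "\<dots> = ennreal B" by (simp add: G.emeasure_space_1 H.emeasure_space_1)
  finally show ?thesis .
qed

lemma B_ge_1: "1 \<le> B"
proof -
  have "mixing (return borel (undefined::'t))" (is "mixing ?G") by (rule mixing_return)
  interpret P: prob_space "law ?G" by (rule prob_space_law[OF mixing_return])
  have "1 = (\<integral>\<^sup>+x. ennreal ((mix ?G x / mix ?G x)\<^sup>2) \<partial>law ?G)"
  proof -
    have "(\<integral>\<^sup>+x. ennreal ((mix ?G x / mix ?G x)\<^sup>2) \<partial>law ?G) = (\<integral>\<^sup>+x. 1 \<partial>law ?G)"
      using AE_law_mix_pos[OF mixing_return mixing_return, of undefined undefined]
      by (intro nn_integral_cong_AE, eventually_elim) simp
    then show ?thesis using P.emeasure_space_1 by simp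
  qed
  also have "\<dots> \<le> ennreal B" by (rule nn_integral_mixture_ratio[OF mixing_return mixing_return mixing_return])
  finally show ?thesis by (metis ennreal_1 ennreal_le_iff2 not_one_le_zero)
qed

end

section \<open>The fit of a mixing distribution and the effect of one update\<close>

lemma ln_one_plus_ge_quadratic:
  fixes v :: real assumes "- (1/2) \<le> v"
  shows "v - 2 * v\<^sup>2 \<le> ln (1 + v)"
proof -
  consider "v < 0" | "0 \<le> v" "v \<le> 1" | "1 < v" by linarith
  then show ?thesis
  proof cases
    case 1 then show ?thesis using ln_one_minus_pos_lower_bound[of "- v"] assms by simp
  next
    case 2 then show ?thesis using ln_one_plus_pos_lower_bound[of v] zero_le_power2[of v] by linarith
  next
    case 3
    then have "v * 1 \<le> v * v" by (intro mult_left_mono) auto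
    then have "v - 2 * v\<^sup>2 \<le> 0" using 3 by (simp add: power2_eq_square)
    moreover have "0 \<le> ln (1 + v)" using 3 by simp
    ultimately show ?thesis by linarith
  qed
qed

lemma ennreal_integral_le_nn_integral:
  assumes "\<And>x. 0 \<le> f x"
  shows "ennreal (\<integral>x. f x \<partial>M) \<le> (\<integral>\<^sup>+x. ennreal (f x) \<partial>M)"
  using assms by (cases "integrable M f") (simp_all add: nn_integral_eq_integral not_integrable_integral_eq)

lemma (in prob_space) square_deviation_from_one:
  fixes u :: "'a \<Rightarrow> real"
  assumes u: "\<And>x. 0 \<le> u x" and i: "integrable M u" "integrable M (\<lambda>x. (u x)\<^sup>2)"
  shows "integrable M (\<lambda>x. (u x - 1)\<^sup>2)" and "(\<integral>x. (u x - 1)\<^sup>2 \<partial>M) \<le> (\<integral>x. (u x)\<^sup>2 \<partial>M) + 1"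
proof -
  have eq: "(u x - 1)\<^sup>2 = (u x)\<^sup>2 - 2 * u x + 1" for x by (simp add: power2_eq_square algebra_simps)
  show i2: "integrable M (\<lambda>x. (u x - 1)\<^sup>2)" unfolding eq using i by simp
  have "(\<integral>x. (u x - 1)\<^sup>2 \<partial>M) \<le> (\<integral>x. (u x)\<^sup>2 + 1 \<partial>M)"
    by (intro integral_mono i2) (use i u in \<open>auto simp: eq\<close>)
  also have "\<dots> = (\<integral>x. (u x)\<^sup>2 \<partial>M) + 1" using i prob_space by simp
  finally show "(\<integral>x. (u x - 1)\<^sup>2 \<partial>M) \<le> (\<integral>x. (u x)\<^sup>2 \<partial>M) + 1" .
qed

text \<open>Moving a fraction \<open>w\<close> of the mass multiplies a density by \<open>1 + w (u - 1)\<close>; expanding the logarithm to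
  second order bounds the effect from below. For \<open>w\<close> at most one half, and \<open>u\<close> nonnegative, the argument of
  the logarithm stays away from zero.\<close>
lemma (in prob_space) integral_ln_mixture_step:
  fixes u :: "'a \<Rightarrow> real" and w :: real
  assumes [measurable]: "u \<in> borel_measurable M" and u: "AE x in M. 0 \<le> u x"
    and int: "integrable M (\<lambda>x. (u x - 1)\<^sup>2)" and w: "0 \<le> w" "w \<le> 1/2"
  shows "integrable M (\<lambda>x. ln (1 + w * (u x - 1)))"
    and "w * (\<integral>x. u x - 1 \<partial>M) - 2 * w\<^sup>2 * (\<integral>x. (u x - 1)\<^sup>2 \<partial>M) \<le> (\<integral>x. ln (1 + w * (u x - 1)) \<partial>M)"
proof -
  have i1: "integrable M (\<lambda>x. u x - 1)" by (rule square_integrable_imp_integrable[OF _ int]) simp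
  have ge: "- (1/2) \<le> w * (u x - 1)" if "0 \<le> u x" for x
  proof -
    have "w * (0 - 1) \<le> w * (u x - 1)" using that w by (intro mult_left_mono) auto
    then show ?thesis using w by simp
  qed
  have lower: "w * (u x - 1) - 2 * w\<^sup>2 * (u x - 1)\<^sup>2 \<le> ln (1 + w * (u x - 1))" if "0 \<le> u x" for x
    using ln_one_plus_ge_quadratic[OF ge[OF that]] by (simp add: power_mult_distrib mult.assoc)
  have upper: "ln (1 + w * (u x - 1)) \<le> w * (u x - 1)" if "0 \<le> u x" for x
    using ge[OF that] by (intro ln_add_one_self_le_self2) auto
  have ib: "integrable M (\<lambda>x. w * (u x - 1) - 2 * w\<^sup>2 * (u x - 1)\<^sup>2)"
    by (intro Bochner_Integration.integrable_diff integrable_mult_right i1 int)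
  show i: "integrable M (\<lambda>x. ln (1 + w * (u x - 1)))"
  proof (rule Bochner_Integration.integrable_bound)
    show "integrable M (\<lambda>x. \<bar>w * (u x - 1)\<bar> + 2 * w\<^sup>2 * (u x - 1)\<^sup>2)"
      by (intro Bochner_Integration.integrable_add integrable_abs integrable_mult_right i1 int)
    show "AE x in M. norm (ln (1 + w * (u x - 1))) \<le> norm (\<bar>w * (u x - 1)\<bar> + 2 * w\<^sup>2 * (u x - 1)\<^sup>2)"
      using u
    proof eventually_elim
      case (elim x)
      have "0 \<le> 2 * w\<^sup>2 * (u x - 1)\<^sup>2" by simp
      then show ?case using lower[OF elim] upper[OF elim] unfolding real_norm_def by linarith
    qed
  qed simp
  have "w * (\<integral>x. u x - 1 \<partial>M) - 2 * w\<^sup>2 * (\<integral>x. (u x - 1)\<^sup>2 \<partial>M)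
      = (\<integral>x. w * (u x - 1) \<partial>M) - (\<integral>x. 2 * w\<^sup>2 * (u x - 1)\<^sup>2 \<partial>M)"
    by (simp only: integral_mult_right_zero)
  also have "\<dots> = (\<integral>x. w * (u x - 1) - 2 * w\<^sup>2 * (u x - 1)\<^sup>2 \<partial>M)"
    by (rule Bochner_Integration.integral_diff[symmetric]; intro integrable_mult_right i1 int)
  also have "\<dots> \<le> (\<integral>x. ln (1 + w * (u x - 1)) \<partial>M)"
    using u by (intro integral_mono_AE ib i) (auto elim!: eventually_mono intro: lower)
  finally show "w * (\<integral>x. u x - 1 \<partial>M) - 2 * w\<^sup>2 * (\<integral>x. (u x - 1)\<^sup>2 \<partial>M) \<le> (\<integral>x. ln (1 + w * (u x - 1)) \<partial>M)" .
qed

context sampling_model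
begin

lemma mixture_ratio_square_integrable:
  assumes F: "mixing F" and G: "mixing G" and H: "mixing H"
  shows "integrable (law F) (\<lambda>x. (mix G x / mix H x)\<^sup>2)"
    and "(\<integral>x. (mix G x / mix H x)\<^sup>2 \<partial>law F) \<le> B"
proof -
  note mix_measurable[OF G, measurable] mix_measurable[OF H, measurable]
  show i: "integrable (law F) (\<lambda>x. (mix G x / mix H x)\<^sup>2)"
    using nn_integral_mixture_ratio[OF assms]
    by (intro integrableI_bounded) (auto simp: le_less_trans[OF _ ennreal_less_top])
  show "(\<integral>x. (mix G x / mix H x)\<^sup>2 \<partial>law F) \<le> B"
    using nn_integral_mixture_ratio[OF assms] B_ge_1
    unfolding nn_integral_eq_integral[OF i, simplified] by (subst (asm) ennreal_le_iff) auto
qed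

lemma mixture_ratio_integrable:
  assumes F: "mixing F" and G: "mixing G" and H: "mixing H"
  shows "integrable (law F) (\<lambda>x. mix G x / mix H x)"
proof -
  interpret P: prob_space "law F" using F by (rule prob_space_law)
  note mix_measurable[OF G, measurable] mix_measurable[OF H, measurable]
  show ?thesis by (rule P.square_integrable_imp_integrable[OF _ mixture_ratio_square_integrable(1)[OF assms]]) measurable
qed

lemma mixture_ratio_minus_one:
  assumes F: "mixing F" and G: "mixing G" and H: "mixing H"
  shows "integrable (law F) (\<lambda>x. (mix G x / mix H x - 1)\<^sup>2)"
    and "(\<integral>x. (mix G x / mix H x - 1)\<^sup>2 \<partial>law F) \<le> B + 1"
proof -
  interpret P: prob_space "law F" using F by (rule prob_space_law)
  note i = mixture_ratio_integrable[OF assms] mixture_ratio_square_integrable(1)[OF assms]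
  have nn: "0 \<le> mix G x / mix H x" for x by simp
  show "integrable (law F) (\<lambda>x. (mix G x / mix H x - 1)\<^sup>2)"
    by (rule P.square_deviation_from_one(1)[OF nn i])
  show "(\<integral>x. (mix G x / mix H x - 1)\<^sup>2 \<partial>law F) \<le> B + 1"
    using P.square_deviation_from_one(2)[OF nn i] mixture_ratio_square_integrable(2)[OF assms] by linarith
qed

lemma abs_ln_le:
  fixes t :: real assumes t: "0 < t" shows "\<bar>ln t\<bar> \<le> t + 1 / t"
proof -
  have "0 < 1 / t" "ln t \<le> t - 1" "ln (1 / t) \<le> 1 / t - 1"
    using t ln_le_minus_one[of t] ln_le_minus_one[of "1/t"] by auto
  moreover have "ln (1 / t) = - ln t" using t by (simp add: ln_div)
  ultimately show ?thesis using t by linarith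
qed

lemma log_ratio_integrable:
  assumes F: "mixing F" and G: "mixing G" and H: "mixing H"
  shows "integrable (law F) (\<lambda>x. ln (mix G x / mix H x))"
proof (rule Bochner_Integration.integrable_bound)
  note mix_measurable[OF G, measurable] mix_measurable[OF H, measurable]
  show "integrable (law F) (\<lambda>x. mix G x / mix H x + mix H x / mix G x)"
    by (intro Bochner_Integration.integrable_add mixture_ratio_integrable assms)
  show "(\<lambda>x. ln (mix G x / mix H x)) \<in> borel_measurable (law F)" by measurable
  show "AE x in law F. norm (ln (mix G x / mix H x)) \<le> norm (mix G x / mix H x + mix H x / mix G x)"
    using AE_law_mix_pos[OF F G] AE_law_mix_pos[OF F H]
  proof eventually_elim
    case (elim x)
    then show ?case using abs_ln_le[of "mix G x / mix H x"] by simp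
  qed
qed

text \<open>Minus the Kullback--Leibler divergence of \<open>mix G\<close> from the mixture of the true \<open>F\<close>.\<close>
definition fit :: "'t measure \<Rightarrow> 't measure \<Rightarrow> real" where
  "fit F G = (\<integral>x. ln (mix G x / mix F x) \<partial>law F)"

lemma fit_diff:
  assumes F: "mixing F" and G: "mixing G" and H: "mixing H"
  shows "(\<integral>x. ln (mix H x / mix G x) \<partial>law F) = fit F H - fit F G"
proof -
  have "(\<integral>x. ln (mix H x / mix G x) \<partial>law F) = (\<integral>x. ln (mix H x / mix F x) - ln (mix G x / mix F x) \<partial>law F)"
  proof (rule integral_cong_AE)
    note mix_measurable[OF F, measurable] mix_measurable[OF G, measurable] mix_measurable[OF H, measurable]
    show "(\<lambda>x. ln (mix H x / mix G x)) \<in> borel_measurable (law F)"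
      "(\<lambda>x. ln (mix H x / mix F x) - ln (mix G x / mix F x)) \<in> borel_measurable (law F)" by measurable
    show "AE x in law F. ln (mix H x / mix G x) = ln (mix H x / mix F x) - ln (mix G x / mix F x)"
      using AE_law_mix_pos[OF F G] AE_law_mix_pos[OF F H] AE_law_mix_pos[OF F F]
      by eventually_elim (simp add: ln_div)
  qed
  also have "\<dots> = fit F H - fit F G"
    unfolding fit_def by (intro Bochner_Integration.integral_diff log_ratio_integrable assms)
  finally show ?thesis .
qed

lemma integral_ratio_le_1:
  assumes F: "mixing F" and G: "mixing G"
  shows "(\<integral>x. mix G x / mix F x \<partial>law F) \<le> 1"
proof -
  note mix_measurable[OF F, measurable] mix_measurable[OF G, measurable]
  interpret P: prob_space "law G" using G by (rule prob_space_law)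
  have "ennreal (\<integral>x. mix G x / mix F x \<partial>law F) = (\<integral>\<^sup>+x. ennreal (mix G x / mix F x) \<partial>law F)"
    by (rule nn_integral_eq_integral[symmetric]) (auto intro: mixture_ratio_integrable F G)
  also have "\<dots> = (\<integral>\<^sup>+x. ennreal (mix F x) * ennreal (mix G x / mix F x) \<partial>\<nu>)"
    unfolding law_def by (subst nn_integral_density) auto
  also have "\<dots> \<le> (\<integral>\<^sup>+x. ennreal (mix G x) * 1 \<partial>\<nu>)"
    by (intro nn_integral_mono) (auto simp: ennreal_mult[symmetric])
  also have "\<dots> = (\<integral>\<^sup>+x. 1 \<partial>law G)" unfolding law_def by (subst nn_integral_density) auto
  also have "\<dots> = ennreal 1" using P.emeasure_space_1 by simp
  finally show ?thesis by (subst (asm) ennreal_le_iff) auto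
qed

lemma fit_nonpos:
  assumes F: "mixing F" and G: "mixing G"
  shows "fit F G \<le> 0"
proof -
  interpret P: prob_space "law F" using F by (rule prob_space_law)
  note i = mixture_ratio_integrable[OF F G F]
  have "fit F G \<le> (\<integral>x. mix G x / mix F x - 1 \<partial>law F)"
    unfolding fit_def
  proof (rule integral_mono_AE[OF log_ratio_integrable[OF F G F]])
    show "integrable (law F) (\<lambda>x. mix G x / mix F x - 1)" using i by simp
    show "AE x in law F. ln (mix G x / mix F x) \<le> mix G x / mix F x - 1"
      using AE_law_mix_pos[OF F G] AE_law_mix_pos[OF F F]
      by eventually_elim (intro ln_le_minus_one, simp)
  qed
  also have "\<dots> \<le> 0" using integral_ratio_le_1[OF F G] i P.prob_space by simp
  finally show ?thesis .
qed

definition posterior :: "'t measure \<Rightarrow> 'x \<Rightarrow> 't measure" where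
  "posterior G y = density G (\<lambda>\<theta>. ennreal (p y \<theta> / mix G y))"

lemma mixing_posterior:
  assumes G: "mixing G" and y: "0 < mix G y"
  shows "mixing (posterior G y)"
proof -
  have [measurable_cong]: "sets G = sets borel" using G by (rule mixingD)
  have "emeasure (posterior G y) (space (posterior G y)) = (\<integral>\<^sup>+\<theta>. ennreal (p y \<theta> / mix G y) \<partial>G)"
    unfolding posterior_def by (subst emeasure_density) (auto intro!: nn_integral_cong simp: indicator_def)
  also have "\<dots> = (\<integral>\<^sup>+\<theta>. ennreal (p y \<theta>) / ennreal (mix G y) \<partial>G)"
    using y by (simp add: divide_ennreal)
  also have "\<dots> = ennreal (mix G y) / ennreal (mix G y)"
    unfolding ennreal_mix[OF G] by (rule nn_integral_divide) measurable
  also have "\<dots> = 1" using y by (simp add: divide_ennreal)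
  finally have "prob_space (posterior G y)" by (rule prob_spaceI)
  then show ?thesis using mixingD(2)[OF G] by (simp add: mixing_def posterior_def)
qed

lemma mix_posterior:
  assumes G: "mixing G"
  shows "mix (posterior G y) x = (\<integral>\<theta>. p x \<theta> * p y \<theta> \<partial>G) / mix G y"
proof -
  have [measurable_cong]: "sets G = sets borel" using G by (rule mixingD)
  have "mix (posterior G y) x = (\<integral>\<theta>. p x \<theta> \<partial>density G (\<lambda>\<theta>. ennreal (p y \<theta> / mix G y)))"
    by (simp add: mixture_of_measure_def posterior_def)
  also have "\<dots> = (\<integral>\<theta>. p y \<theta> / mix G y * p x \<theta> \<partial>G)"
    by (subst integral_density) auto
  also have "\<dots> = (\<integral>\<theta>. p x \<theta> * p y \<theta> / mix G y \<partial>G)" by (simp add: mult.commute)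
  finally show ?thesis by simp
qed

lemma p_mult_integrable:
  assumes G: "mixing G" shows "integrable G (\<lambda>\<theta>. p x \<theta> * p y \<theta>)"
proof -
  interpret prob_space G using G by (rule mixingD)
  have [measurable_cong]: "sets G = sets borel" using G by (rule mixingD)
  show ?thesis using p_le by (intro integrable_const_bound[of _ "p_sup x * p_sup y"])
    (auto simp: abs_mult intro!: mult_mono p_sup_nonneg)
qed

text \<open>The recursion replaces \<open>G\<close> by \<open>H\<close>, which shifts a fraction \<open>w\<close> of the mass to the posterior. The
  quadratic error is uniformly bounded because the posterior is itself a mixing distribution, to which the
  ratio bound applies.\<close>
lemma fit_step:
  assumes F: "mixing F" and G: "mixing G" and H: "mixing H" and y: "0 < mix G y"
    and H_eq: "\<And>x. mix H x = (1 - w) * mix G x + w * mix (posterior G y) x" and w: "0 \<le> w" "w \<le> 1/2"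
  defines "Z \<equiv> \<integral>x. mix (posterior G y) x / mix G x - 1 \<partial>law F"
  shows "fit F G + w * Z - 2 * w\<^sup>2 * (B + 1) \<le> fit F H"
    and "Z\<^sup>2 \<le> B + 1"
proof -
  interpret P: prob_space "law F" using F by (rule prob_space_law)
  note post = mixing_posterior[OF G y]
  note mix_measurable[OF G, measurable] mix_measurable[OF post, measurable] mix_measurable[OF H, measurable]
  let ?u = "\<lambda>x. mix (posterior G y) x / mix G x"
  note u2 = mixture_ratio_minus_one[OF F post G]
  have ln: "w * Z - 2 * w\<^sup>2 * (\<integral>x. (?u x - 1)\<^sup>2 \<partial>law F) \<le> (\<integral>x. ln (1 + w * (?u x - 1)) \<partial>law F)"
    unfolding Z_def by (rule P.integral_ln_mixture_step(2)[OF _ _ u2(1) w]) auto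
  have eq: "(\<integral>x. ln (1 + w * (?u x - 1)) \<partial>law F) = (\<integral>x. ln (mix H x / mix G x) \<partial>law F)"
  proof (rule integral_cong_AE)
    show "AE x in law F. ln (1 + w * (?u x - 1)) = ln (mix H x / mix G x)"
      using AE_law_mix_pos[OF F G]
    proof eventually_elim
      case (elim x)
      then have "mix H x / mix G x = 1 + w * (?u x - 1)"
        unfolding H_eq by (simp add: field_simps)
      then show ?case by simp
    qed
  qed measurable
  have "2 * w\<^sup>2 * (\<integral>x. (?u x - 1)\<^sup>2 \<partial>law F) \<le> 2 * w\<^sup>2 * (B + 1)"
    using u2(2) by (intro mult_left_mono) auto
  then show "fit F G + w * Z - 2 * w\<^sup>2 * (B + 1) \<le> fit F H"
    using ln fit_diff[OF F G H] unfolding eq by linarith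
  have i1: "integrable (law F) (\<lambda>x. ?u x - 1)"
    by (rule P.square_integrable_imp_integrable[OF _ u2(1)]) measurable
  have "0 \<le> P.variance (\<lambda>x. ?u x - 1)" by simp
  then show "Z\<^sup>2 \<le> B + 1"
    using P.variance_eq[OF i1 u2(1)] u2(2) unfolding Z_def by linarith
qed

text \<open>Write \<open>a \<theta>\<close> for the mean of \<open>p x \<theta> / mix G x\<close> over the true law of \<open>x\<close>. Exchanging integrals turns
  the expectation over the observation \<open>y\<close> into \<open>\<integral> a\<^sup>2 \<partial>G - 1\<close>. Since \<open>a\<close> has mean one under \<open>G\<close>, the
  Cauchy--Schwarz inequality makes this nonnegative: on average a posterior update improves the fit.\<close>
lemma expected_gain_nonneg:
  assumes F: "mixing F" and G: "mixing G"
    and meas: "(\<lambda>(y, x). mix (posterior G y) x) \<in> borel_measurable (borel \<Otimes>\<^sub>M borel)"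
  shows "0 \<le> (\<integral>y. (\<integral>x. mix (posterior G y) x / mix G x - 1 \<partial>law F) \<partial>law F)"
proof -
  interpret P: prob_space "law F" using F by (rule prob_space_law)
  interpret G: prob_space G using G by (rule mixingD)
  have [measurable_cong]: "sets G = sets borel" using G by (rule mixingD)
  interpret PG: pair_sigma_finite "law F" G ..
  note mix_measurable[OF G, measurable]
  have [measurable]: "(\<lambda>z. mix (posterior G (f z)) (g z)) \<in> borel_measurable N"
    if "f \<in> N \<rightarrow>\<^sub>M borel" "g \<in> N \<rightarrow>\<^sub>M borel" for f g and N :: "'n measure"
    using measurable_compose[OF measurable_Pair[OF that] meas] by simp
  have meas': "(\<lambda>(y, x). mix (posterior G y) x) \<in> borel_measurable (law F \<Otimes>\<^sub>M law F)"
    using meas by simp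
  define a where "a \<theta> = (\<integral>\<^sup>+x. ennreal (p x \<theta> / mix G x) \<partial>law F)" for \<theta>
  have [measurable]: "a \<in> borel_measurable borel" unfolding a_def by measurable
  have pos: "AE x in law F. 0 < mix G x" by (rule AE_law_mix_pos[OF F G])
  have a1: "(\<integral>\<^sup>+\<theta>. a \<theta> \<partial>G) = 1"
  proof -
    have "(\<integral>\<^sup>+\<theta>. a \<theta> \<partial>G) = (\<integral>\<^sup>+x. \<integral>\<^sup>+\<theta>. ennreal (p x \<theta> / mix G x) \<partial>G \<partial>law F)"
      unfolding a_def by (rule PG.Fubini') measurable
    also have "\<dots> = (\<integral>\<^sup>+x. 1 \<partial>law F)"
      using pos
    proof (intro nn_integral_cong_AE, eventually_elim)
      case (elim x)
      have "(\<integral>\<^sup>+\<theta>. ennreal (p x \<theta> / mix G x) \<partial>G) = (\<integral>\<^sup>+\<theta>. ennreal (p x \<theta>) / ennreal (mix G x) \<partial>G)"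
        using elim by (simp add: divide_ennreal)
      also have "\<dots> = ennreal (mix G x) / ennreal (mix G x)"
        unfolding ennreal_mix[OF G] by (rule nn_integral_divide) measurable
      finally show ?case using elim by (simp add: divide_ennreal)
    qed
    finally show ?thesis using P.emeasure_space_1 by simp
  qed
  \<comment> \<open>\<open>S y\<close> is the gain plus one, as an integral of a nonnegative function, for which integrals may be
    exchanged freely.\<close>
  define S where "S y = (\<integral>\<^sup>+x. ennreal (mix (posterior G y) x / mix G x) \<partial>law F)" for y
  have S_meas[measurable]: "S \<in> borel_measurable (law F)"
    unfolding S_def using meas' by measurable
  have S_eq: "S y = (\<integral>\<^sup>+\<theta>. a \<theta> * ennreal (p y \<theta> / mix G y) \<partial>G)" if y: "0 < mix G y" for y
  proof -
    have "S y = (\<integral>\<^sup>+x. \<integral>\<^sup>+\<theta>. ennreal (p x \<theta> / mix G x) * ennreal (p y \<theta> / mix G y) \<partial>G \<partial>law F)"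
      unfolding S_def using pos
    proof (intro nn_integral_cong_AE, eventually_elim)
      case (elim x)
      have "ennreal (mix (posterior G y) x / mix G x) = ennreal (\<integral>\<theta>. p x \<theta> * p y \<theta> / (mix G x * mix G y) \<partial>G)"
        by (simp add: mix_posterior[OF G] mult.commute)
      also have "\<dots> = (\<integral>\<^sup>+\<theta>. ennreal (p x \<theta> * p y \<theta> / (mix G x * mix G y)) \<partial>G)"
        by (rule nn_integral_eq_integral[symmetric]) (use p_mult_integrable[OF G] in auto)
      also have "\<dots> = (\<integral>\<^sup>+\<theta>. ennreal (p x \<theta> / mix G x) * ennreal (p y \<theta> / mix G y) \<partial>G)"
        by (intro nn_integral_cong) (simp add: ennreal_mult[symmetric])
      finally show ?case .
    qed
    also have "\<dots> = (\<integral>\<^sup>+\<theta>. \<integral>\<^sup>+x. ennreal (p x \<theta> / mix G x) * ennreal (p y \<theta> / mix G y) \<partial>law F \<partial>G)"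
      by (rule PG.Fubini'[symmetric]) measurable
    also have "\<dots> = (\<integral>\<^sup>+\<theta>. a \<theta> * ennreal (p y \<theta> / mix G y) \<partial>G)"
      unfolding a_def by (intro nn_integral_cong nn_integral_multc) measurable
    finally show ?thesis .
  qed
  have "1 = (\<integral>\<^sup>+\<theta>. a \<theta> \<partial>G)\<^sup>2" using a1 by simp
  also have "\<dots> \<le> (\<integral>\<^sup>+\<theta>. (a \<theta>)\<^sup>2 \<partial>G)" by (rule G.nn_integral_square_le) measurable
  also have "\<dots> = (\<integral>\<^sup>+\<theta>. \<integral>\<^sup>+y. a \<theta> * ennreal (p y \<theta> / mix G y) \<partial>law F \<partial>G)"
    by (intro nn_integral_cong) (simp add: nn_integral_cmult a_def[symmetric] power2_eq_square)
  also have "\<dots> = (\<integral>\<^sup>+y. \<integral>\<^sup>+\<theta>. a \<theta> * ennreal (p y \<theta> / mix G y) \<partial>G \<partial>law F)"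
    by (rule PG.Fubini') measurable
  also have "\<dots> = (\<integral>\<^sup>+y. S y \<partial>law F)"
    using pos by (intro nn_integral_cong_AE) (auto elim!: eventually_mono simp: S_eq)
  finally have S1: "1 \<le> (\<integral>\<^sup>+y. S y \<partial>law F)" .
  define Z where "Z y = (\<integral>x. mix (posterior G y) x / mix G x - 1 \<partial>law F)" for y
  have Z_meas[measurable]: "Z \<in> borel_measurable (law F)"
    unfolding Z_def using meas' by measurable
  have Z: "S y = ennreal (Z y + 1)" "-1 \<le> Z y" "(Z y)\<^sup>2 \<le> B + 1" if y: "0 < mix G y" for y
  proof -
    note post = mixing_posterior[OF G y]
    note i = mixture_ratio_integrable[OF F post G]
    have Z1: "Z y + 1 = (\<integral>x. mix (posterior G y) x / mix G x \<partial>law F)"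
      unfolding Z_def using i P.prob_space by simp
    then have "0 \<le> Z y + 1" by simp
    then show "-1 \<le> Z y" by simp
    show "S y = ennreal (Z y + 1)"
      unfolding Z1 S_def by (rule nn_integral_eq_integral[OF i]) simp
    show "(Z y)\<^sup>2 \<le> B + 1"
      unfolding Z_def using fit_step(2)[OF F G G y, of 0] by simp
  qed
  have Zsq: "integrable (law F) (\<lambda>y. (Z y)\<^sup>2)"
    using pos by (intro P.integrable_const_bound[of _ "B + 1"]) (auto elim!: eventually_mono simp: Z(3))
  then have Zi: "integrable (law F) Z" by (rule P.square_integrable_imp_integrable[rotated]) simp
  have "(\<integral>\<^sup>+y. S y \<partial>law F) = (\<integral>\<^sup>+y. ennreal (Z y + 1) \<partial>law F)"
    using pos by (intro nn_integral_cong_AE) (auto elim!: eventually_mono simp: Z(1))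
  also have "\<dots> = ennreal (\<integral>y. Z y + 1 \<partial>law F)"
    using pos Zi by (intro nn_integral_eq_integral) (auto elim!: eventually_mono dest: Z(2))
  finally have "1 \<le> (\<integral>y. Z y + 1 \<partial>law F)" using S1 by (simp add: ennreal_1[symmetric] ennreal_le_iff2 del: ennreal_1)
  then show ?thesis using Zi P.prob_space unfolding Z_def[symmetric] by simp
qed

text \<open>The right-hand side is the expected first-order growth, in an update of \<open>G\<close>, of the logarithm of the
  density averaged over \<open>Q\<close>. It is positive as long as \<open>Q\<close> fits better than \<open>G\<close>.\<close>
lemma expected_gain_towards:
  assumes F: "mixing F" and G: "mixing G" and Q: "mixing Q"
  shows "fit F Q - fit F G \<le> (\<integral>y. mix Q y / mix G y - 1 \<partial>law F)"
  unfolding fit_diff[OF F G Q, symmetric]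
proof (rule integral_mono_AE[OF log_ratio_integrable[OF F Q G]])
  interpret P: prob_space "law F" using F by (rule prob_space_law)
  show "integrable (law F) (\<lambda>x. mix Q x / mix G x - 1)" using mixture_ratio_integrable[OF F Q G] by simp
  show "AE x in law F. ln (mix Q x / mix G x) \<le> mix Q x / mix G x - 1"
    using AE_law_mix_pos[OF F G] AE_law_mix_pos[OF F Q]
    by eventually_elim (intro ln_le_minus_one, simp)
qed

lemma likelihood_ratio_fluctuation:
  assumes F: "mixing F" and G: "mixing G" and Q: "mixing Q"
  shows "(\<integral>\<^sup>+y. ennreal (\<integral>\<theta>. (p y \<theta> / mix G y - 1)\<^sup>2 \<partial>Q) \<partial>law F) \<le> ennreal (B + 1)"
proof -
  interpret P: prob_space "law F" using F by (rule prob_space_law)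
  interpret Q: prob_space Q using Q by (rule mixingD)
  have [measurable_cong]: "sets Q = sets borel" using Q by (rule mixingD)
  interpret PQ: pair_sigma_finite "law F" Q ..
  note mix_measurable[OF G, measurable]
  have "(\<integral>\<^sup>+y. ennreal (\<integral>\<theta>. (p y \<theta> / mix G y - 1)\<^sup>2 \<partial>Q) \<partial>law F)
      \<le> (\<integral>\<^sup>+y. \<integral>\<^sup>+\<theta>. ennreal ((p y \<theta> / mix G y - 1)\<^sup>2) \<partial>Q \<partial>law F)"
    by (intro nn_integral_mono ennreal_integral_le_nn_integral) auto
  also have "\<dots> = (\<integral>\<^sup>+\<theta>. \<integral>\<^sup>+y. ennreal ((p y \<theta> / mix G y - 1)\<^sup>2) \<partial>law F \<partial>Q)"
    by (rule PQ.Fubini'[symmetric]) measurable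
  also have "\<dots> \<le> (\<integral>\<^sup>+\<theta>. ennreal (B + 1) \<partial>Q)"
  proof (intro nn_integral_mono)
    fix \<theta>
    note r = mixture_ratio_minus_one[OF F mixing_return G, of \<theta>, unfolded mix_return]
    show "(\<integral>\<^sup>+y. ennreal ((p y \<theta> / mix G y - 1)\<^sup>2) \<partial>law F) \<le> ennreal (B + 1)"
      by (subst nn_integral_eq_integral[OF r(1)]) (auto intro: ennreal_leI r(2))
  qed
  also have "\<dots> = ennreal (B + 1)" by (simp add: Q.emeasure_space_1)
  finally show ?thesis .
qed

end

section \<open>Approximating the truth by bounded densities\<close>

lemma integral_wrt_density:
  fixes q :: "'t::topological_space \<Rightarrow> real" and g :: "'t \<Rightarrow> real"
  assumes "mixing F0" and "q \<in> borel_measurable borel" "g \<in> borel_measurable borel" "\<And>\<theta>. 0 \<le> q \<theta>"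
  shows "(\<integral>\<theta>. g \<theta> \<partial>density F0 (\<lambda>\<theta>. ennreal (q \<theta>))) = (\<integral>\<theta>. q \<theta> * g \<theta> \<partial>F0)"
proof -
  have [measurable_cong]: "sets F0 = sets borel" using assms(1) by (rule mixingD)
  note assms(2,3)[measurable]
  show ?thesis using assms(4) by (subst integral_density) auto
qed

lemma abs_average_diff_le:
  fixes g :: "'t::metric_space \<Rightarrow> real"
  assumes F0: "mixing F0" and g: "g \<in> borel_measurable borel" "\<And>\<theta>. \<bar>g \<theta>\<bar> \<le> C"
    and U: "U \<in> sets borel" "0 < measure F0 U" and close: "\<And>\<theta>. \<theta> \<in> U \<Longrightarrow> \<bar>g \<theta> - c\<bar> \<le> e"
  shows "\<bar>(\<integral>\<theta>. indicator U \<theta> * g \<theta> \<partial>F0) / measure F0 U - c\<bar> \<le> e"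
proof -
  interpret F0: prob_space F0 using F0 by (rule mixingD)
  have [measurable_cong]: "sets F0 = sets borel" using F0 by (rule mixingD)
  note g(1)[measurable] U(1)[measurable]
  have iU: "integrable F0 (indicat_real U)"
    by (intro F0.integrable_const_bound[of _ 1]) (auto simp: indicator_def)
  have ig: "integrable F0 (\<lambda>\<theta>. indicat_real U \<theta> * g \<theta>)"
    using g(2) order_trans[OF abs_ge_zero g(2)[of undefined]]
    by (intro F0.integrable_const_bound[of _ C]) (auto simp: indicator_def)
  have mU: "(\<integral>\<theta>. indicat_real U \<theta> \<partial>F0) = measure F0 U" using mixingD(3)[OF F0] by simp
  have "(\<integral>\<theta>. indicator U \<theta> * g \<theta> \<partial>F0) - c * measure F0 U
      = (\<integral>\<theta>. indicat_real U \<theta> * g \<theta> - c * indicat_real U \<theta> \<partial>F0)"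
    using ig iU mU by (subst Bochner_Integration.integral_diff) auto
  also have "\<bar>\<dots>\<bar> \<le> (\<integral>\<theta>. e * indicat_real U \<theta> \<partial>F0)"
  proof (rule order_trans[OF integral_abs_bound integral_mono])
    show "integrable F0 (\<lambda>\<theta>. \<bar>indicat_real U \<theta> * g \<theta> - c * indicat_real U \<theta>\<bar>)"
      using ig iU by (intro integrable_abs Bochner_Integration.integrable_diff) auto
    show "integrable F0 (\<lambda>\<theta>. e * indicat_real U \<theta>)" using iU by auto
    show "\<bar>indicat_real U \<theta> * g \<theta> - c * indicat_real U \<theta>\<bar> \<le> e * indicat_real U \<theta>" for \<theta>
      using close[of \<theta>] by (auto simp: indicator_def)
  qed
  also have "\<dots> = e * measure F0 U" using mU by simp
  finally have "\<bar>(\<integral>\<theta>. indicator U \<theta> * g \<theta> \<partial>F0) - c * measure F0 U\<bar> / measure F0 U \<le> e"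
    using U(2) by (simp add: pos_divide_le_eq)
  moreover have "(\<integral>\<theta>. indicator U \<theta> * g \<theta> \<partial>F0) / measure F0 U - c
      = ((\<integral>\<theta>. indicator U \<theta> * g \<theta> \<partial>F0) - c * measure F0 U) / measure F0 U"
    using U(2) by (simp add: field_simps)
  ultimately show ?thesis using U(2) by (simp add: abs_divide)
qed

text \<open>Cut the space into cells contained in balls \<open>U k i\<close> of radius \<open>1 / Suc k\<close>, and replace the restriction
  of \<open>F\<close> to a cell by the normalised restriction of \<open>F0\<close> to the whole ball. Balls are used because the
  support condition concerns open sets only: a cell charged by \<open>F\<close> may be null for \<open>F0\<close>, but its ball is
  not. All but finitely many cells are merged and replaced by \<open>F0\<close> itself, which keeps the density
  bounded. Integrating \<open>g\<close> against the result amounts to integrating against \<open>F\<close> a function \<open>G g k\<close> that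
  is locally an average of \<open>g\<close>.\<close>
theorem bounded_densities_weakly_dense:
  fixes F F0 :: "'t::{metric_space,second_countable_topology} measure"
  assumes F: "mixing F" and F0: "mixing F0"
    and supp: "\<And>U. open U \<Longrightarrow> emeasure F0 U = 0 \<Longrightarrow> emeasure F U = 0"
  obtains q :: "nat \<Rightarrow> 't \<Rightarrow> real" where "\<And>k. q k \<in> borel_measurable borel" "\<And>k \<theta>. 0 \<le> q k \<theta>"
    "\<And>k. \<exists>C. \<forall>\<theta>. q k \<theta> \<le> C" "\<And>k. mixing (density F0 (\<lambda>\<theta>. ennreal (q k \<theta>)))"
    "weakly_converges (\<lambda>k. density F0 (\<lambda>\<theta>. ennreal (q k \<theta>))) F"
proof -
  interpret F: prob_space F using F by (rule mixingD)
  interpret F0: prob_space F0 using F0 by (rule mixingD)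
  have [measurable_cong]: "sets F = sets borel" "sets F0 = sets borel" using F F0 by (auto dest: mixingD)
  have sp: "space F = UNIV" "space F0 = UNIV" using F F0 by (auto dest: mixingD)
  obtain e :: "nat \<Rightarrow> 't" where e: "\<And>r \<theta>. 0 < r \<Longrightarrow> \<exists>i. dist (e i) \<theta> < r"
    by (rule dense_sequence_exists) (rule that)
  define U where "U k i = ball (e i) (1 / real (Suc k))" for k i
  have U_ex: "\<exists>i. \<theta> \<in> U k i" for \<theta> k
    using e[of "1 / real (Suc k)" \<theta>] by (simp add: U_def)
  define j where "j k \<theta> = (LEAST i. \<theta> \<in> U k i)" for k \<theta>
  have j: "\<theta> \<in> U k (j k \<theta>)" for k \<theta> unfolding j_def using U_ex by (rule LeastI_ex)
  have U_open: "open (U k i)" for k i by (simp add: U_def)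
  have U_borel[measurable]: "U k i \<in> sets borel" for k i using U_open by auto
  have [measurable]: "j k \<in> borel \<rightarrow>\<^sub>M count_space UNIV" for k
    unfolding j_def by measurable
  define A where "A k i = {\<theta>. j k \<theta> = i}" for k i
  define T where "T k n = {\<theta>. n \<le> j k \<theta>}" for k n
  have [measurable]: "A k i \<in> sets borel" "T k i \<in> sets borel" for k i
    unfolding A_def T_def by measurable
  have "\<exists>n. measure F (T k n) < (1/2) ^ k" for k
  proof -
    have "(\<lambda>n. measure F (T k n)) \<longlonglongrightarrow> measure F (\<Inter>n. T k n)"
      by (intro F.finite_Lim_measure_decseq) (auto simp: decseq_def T_def)
    moreover have "(\<Inter>n. T k n) = {}" by (auto simp: T_def) (metis Suc_n_not_le_n)
    ultimately have "(\<lambda>n. measure F (T k n)) \<longlonglongrightarrow> 0" by simp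
    then have "eventually (\<lambda>n. measure F (T k n) < (1/2) ^ k) sequentially"
      by (rule order_tendstoD) simp
    then show ?thesis by (auto simp: eventually_sequentially)
  qed
  then obtain N where N: "\<And>k. measure F (T k (N k)) < (1/2) ^ k" by metis
  \<comment> \<open>A ball that is null for \<open>F0\<close> is null for \<open>F\<close>, so its quotient is \<open>0 / 0 = 0\<close>.\<close>
  define q where "q k \<theta> = (\<Sum>i<N k. measure F (A k i) / measure F0 (U k i) * indicator (U k i) \<theta>) + measure F (T k (N k))" for k \<theta>
  have q_meas[measurable]: "q k \<in> borel_measurable borel" for k unfolding q_def by measurable
  have q_nonneg: "0 \<le> q k \<theta>" for k \<theta>
    unfolding q_def by (intro add_nonneg_nonneg sum_nonneg) auto
  have q_bounded: "\<exists>C. \<forall>\<theta>. q k \<theta> \<le> C" for k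
  proof (intro exI allI)
    show "q k \<theta> \<le> (\<Sum>i<N k. measure F (A k i) / measure F0 (U k i) * 1) + measure F (T k (N k))" for \<theta>
      unfolding q_def by (intro add_right_mono sum_mono mult_left_mono) (auto simp: indicator_def)
  qed
  define avg where "avg g k i = (\<integral>\<theta>. indicator (U k i) \<theta> * g \<theta> \<partial>F0) / measure F0 (U k i)" for g :: "'t \<Rightarrow> real" and k i
  define G where "G g k \<theta> = (\<Sum>i<N k. indicator (A k i) \<theta> * avg g k i) + indicator (T k (N k)) \<theta> * (\<integral>\<theta>. g \<theta> \<partial>F0)" for g :: "'t \<Rightarrow> real" and k \<theta>
  have [measurable]: "G g k \<in> borel_measurable borel" for g k unfolding G_def by measurable
  have G_head: "G g k \<theta> = avg g k (j k \<theta>)" if "\<theta> \<notin> T k (N k)" for g k \<theta>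
  proof -
    have "(\<Sum>i<N k. indicator (A k i) \<theta> * avg g k i) = (\<Sum>i\<in>{j k \<theta>}. indicator (A k i) \<theta> * avg g k i)"
      using that by (intro sum.mono_neutral_right) (auto simp: A_def T_def)
    then show ?thesis using that by (simp add: G_def A_def)
  qed
  have G_tail: "G g k \<theta> = (\<integral>\<theta>. g \<theta> \<partial>F0)" if "\<theta> \<in> T k (N k)" for g k \<theta>
  proof -
    have "(\<Sum>i<N k. indicator (A k i) \<theta> * avg g k i) = 0"
      using that by (intro sum.neutral) (auto simp: A_def T_def)
    then show ?thesis using that by (simp add: G_def)
  qed
  have int_q: "(\<integral>\<theta>. q k \<theta> * g \<theta> \<partial>F0) = (\<integral>\<theta>. G g k \<theta> \<partial>F)"
    if [measurable]: "g \<in> borel_measurable borel" and bd: "\<And>\<theta>. \<bar>g \<theta>\<bar> \<le> C" for g k C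
  proof -
    have C: "0 \<le> C" using order_trans[OF abs_ge_zero bd[of undefined]] .
    have ig: "integrable F0 g" using bd by (intro F0.integrable_const_bound[of _ C]) auto
    have iUg: "integrable F0 (\<lambda>\<theta>. indicat_real (U k i) \<theta> * g \<theta>)" for i
      using bd C by (intro F0.integrable_const_bound[of _ C]) (auto simp: indicator_def)
    have iA: "integrable F (indicat_real S)" if "S \<in> sets borel" for S
      using that by (intro F.integrable_const_bound[of _ 1]) (auto simp: indicator_def)
    have "(\<integral>\<theta>. q k \<theta> * g \<theta> \<partial>F0) = (\<integral>\<theta>. (\<Sum>i<N k. measure F (A k i) / measure F0 (U k i) * (indicator (U k i) \<theta> * g \<theta>)) + measure F (T k (N k)) * g \<theta> \<partial>F0)"
      by (intro Bochner_Integration.integral_cong) (auto simp: q_def ring_distribs sum_distrib_right mult.assoc)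
    also have "\<dots> = (\<Sum>i<N k. measure F (A k i) * avg g k i) + measure F (T k (N k)) * (\<integral>\<theta>. g \<theta> \<partial>F0)"
      using ig iUg by (simp add: avg_def)
    also have "\<dots> = (\<Sum>i<N k. \<integral>\<theta>. indicator (A k i) \<theta> * avg g k i \<partial>F) + (\<integral>\<theta>. indicator (T k (N k)) \<theta> * (\<integral>\<theta>. g \<theta> \<partial>F0) \<partial>F)"
    proof -
      have mA: "(\<integral>\<theta>. indicat_real (A k i) \<theta> \<partial>F) = measure F (A k i)"
        and mT: "(\<integral>\<theta>. indicat_real (T k i) \<theta> \<partial>F) = measure F (T k i)" for i by (simp_all add: sp)
      show ?thesis unfolding integral_mult_left_zero mA mT ..
    qed
    also have "\<dots> = (\<integral>\<theta>. (\<Sum>i<N k. indicator (A k i) \<theta> * avg g k i) \<partial>F) + (\<integral>\<theta>. indicator (T k (N k)) \<theta> * (\<integral>\<theta>. g \<theta> \<partial>F0) \<partial>F)"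
      by (subst Bochner_Integration.integral_sum) (auto intro!: integrable_mult_left iA)
    also have "\<dots> = (\<integral>\<theta>. G g k \<theta> \<partial>F)"
      unfolding G_def
      by (intro Bochner_Integration.integral_add[symmetric] Bochner_Integration.integrable_sum integrable_mult_left iA) auto
    finally show ?thesis .
  qed
  have q_mixing: "mixing (density F0 (\<lambda>\<theta>. ennreal (q k \<theta>)))" for k
  proof -
    obtain C where C: "\<And>\<theta>. q k \<theta> \<le> C" using q_bounded by blast
    have iq: "integrable F0 (q k)"
      using C q_nonneg by (intro F0.integrable_const_bound[of _ C]) auto
    have "AE \<theta> in F. G (\<lambda>_. 1) k \<theta> = 1"
    proof -
      have "AE \<theta> in F. \<forall>i. measure F0 (U k i) = 0 \<longrightarrow> \<theta> \<notin> U k i"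
        unfolding AE_all_countable
        using supp[OF U_open] by (auto intro!: AE_not_in null_setsI simp: F0.emeasure_eq_measure)
      then show ?thesis
      proof eventually_elim
        case (elim \<theta>)
        then have "measure F0 (U k (j k \<theta>)) \<noteq> 0" using j by blast
        then have "avg (\<lambda>_. 1) k (j k \<theta>) = 1" by (simp add: avg_def sp)
        then show ?case using G_head[of \<theta> k] G_tail[of \<theta> k] F0.prob_space by (cases "\<theta> \<in> T k (N k)") auto
      qed
    qed
    then have "(\<integral>\<theta>. G (\<lambda>_. 1) k \<theta> \<partial>F) = (\<integral>\<theta>. 1 \<partial>F)"
      by (intro integral_cong_AE) auto
    then have "(\<integral>\<theta>. q k \<theta> \<partial>F0) = 1"
      using int_q[of "\<lambda>_. 1" 1 k] F.prob_space by simp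
    then have "(\<integral>\<^sup>+\<theta>. ennreal (q k \<theta>) \<partial>F0) = 1"
      using q_nonneg by (subst nn_integral_eq_integral[OF iq]) auto
    then have "prob_space (density F0 (\<lambda>\<theta>. ennreal (q k \<theta>)))"
      by (intro prob_spaceI) (simp add: emeasure_density sp)
    then show ?thesis using mixingD(2)[OF F0] by (simp add: mixing_def)
  qed
  have "weakly_converges (\<lambda>k. density F0 (\<lambda>\<theta>. ennreal (q k \<theta>))) F"
    unfolding weakly_converges_def
  proof (intro allI impI)
    fix g :: "'t \<Rightarrow> real" assume g: "continuous_on UNIV g" "bounded (range g)"
    obtain C where C: "\<And>x. \<bar>g x\<bar> \<le> C" using g(2) by (auto simp: bounded_iff)
    have gm[measurable]: "g \<in> borel_measurable borel" by (rule borel_measurable_continuous_onI[OF g(1)])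
    have C0: "0 \<le> C" using order_trans[OF abs_ge_zero C[of undefined]] .
    have avg_bd: "\<bar>avg g k i\<bar> \<le> C" for k i
    proof (cases "measure F0 (U k i) = 0")
      case False
      then show ?thesis
        using abs_average_diff_le[OF F0 gm C U_borel, of k i 0 C] C
        by (simp add: avg_def zero_less_measure_iff)
    qed (simp add: avg_def C0)
    have F0_bd: "\<bar>\<integral>\<theta>. g \<theta> \<partial>F0\<bar> \<le> C"
      using abs_average_diff_le[OF F0 gm C, of UNIV 0 C] C F0.prob_space by (simp add: sp)
    have G_bd: "\<bar>G g k \<theta>\<bar> \<le> C" for k \<theta>
      using G_head[of \<theta> k g] G_tail[of \<theta> k g] avg_bd F0_bd by (cases "\<theta> \<in> T k (N k)") auto
    have pos: "AE \<theta> in F. \<forall>k i. measure F0 (U k i) = 0 \<longrightarrow> \<theta> \<notin> U k i"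
      unfolding AE_all_countable
      using supp[OF U_open] by (auto intro!: AE_not_in null_setsI simp: F0.emeasure_eq_measure)
    have head: "AE \<theta> in F. eventually (\<lambda>k. \<theta> \<in> space F - T k (N k)) sequentially"
    proof (rule borel_cantelli_AE1)
      show "summable (\<lambda>k. measure F (T k (N k)))"
      proof (rule summable_comparison_test'[of "\<lambda>k. (1/2::real) ^ k" 0])
        show "norm (measure F (T k (N k))) \<le> (1/2) ^ k" for k
          using less_imp_le[OF N[of k]] by simp
      qed (simp add: summable_geometric)
    qed (auto simp: less_top[symmetric])
    have lim: "AE \<theta> in F. (\<lambda>k. G g k \<theta>) \<longlonglongrightarrow> g \<theta>"
      using pos head
    proof eventually_elim
      case (elim \<theta>)
      show ?case
      proof (rule LIMSEQ_I)
        fix r :: real assume r: "0 < r"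
        have "continuous (at \<theta>) g" using g(1) by (simp add: continuous_on_eq_continuous_at)
        then obtain d where d: "0 < d" "\<And>\<theta>'. dist \<theta>' \<theta> < d \<Longrightarrow> dist (g \<theta>') (g \<theta>) < r / 2"
          unfolding continuous_at_eps_delta using half_gt_zero[OF r] by blast
        obtain k0 where k0: "1 / real (Suc k0) < d / 2"
          using reals_Archimedean[of "d/2"] d(1) by (auto simp: inverse_eq_divide)
        obtain k1 where k1: "\<And>k. k1 \<le> k \<Longrightarrow> \<theta> \<notin> T k (N k)"
          using elim(2) by (auto simp: eventually_sequentially)
        have "norm (G g k \<theta> - g \<theta>) < r" if k: "max k0 k1 \<le> k" for k
        proof -
          have "1 / real (Suc k) \<le> 1 / real (Suc k0)" using k by (intro divide_left_mono) auto
          then have rad: "1 / real (Suc k) < d / 2" using k0 by simp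
          have near: "\<bar>g \<theta>' - g \<theta>\<bar> \<le> r / 2" if "\<theta>' \<in> U k (j k \<theta>)" for \<theta>'
          proof -
            have "dist (e (j k \<theta>)) \<theta>' < d / 2" "dist (e (j k \<theta>)) \<theta> < d / 2"
              using that j[of \<theta> k] rad unfolding U_def mem_ball by linarith+
            then have "dist \<theta>' \<theta> < d" using dist_triangle_half_r by blast
            then have "dist (g \<theta>') (g \<theta>) < r / 2" by (rule d(2))
            then show ?thesis unfolding dist_real_def by (rule less_imp_le)
          qed
          have "measure F0 (U k (j k \<theta>)) \<noteq> 0" using elim(1) j by blast
          then have "\<bar>avg g k (j k \<theta>) - g \<theta>\<bar> \<le> r / 2"
            unfolding avg_def by (intro abs_average_diff_le[OF F0 gm C U_borel _ near]) (simp_all add: zero_less_measure_iff)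
          then show ?thesis using G_head[OF k1, of k g] k r by simp
        qed
        then show "\<exists>no. \<forall>n\<ge>no. norm (G g n \<theta> - g \<theta>) < r" by blast
      qed
    qed
    have "(\<lambda>k. \<integral>\<theta>. G g k \<theta> \<partial>F) \<longlonglongrightarrow> (\<integral>\<theta>. g \<theta> \<partial>F)"
    proof (rule integral_dominated_convergence[where w="\<lambda>_. C"])
      show "G g k \<in> borel_measurable F" for k by measurable
    qed (use lim G_bd in auto)
    moreover have "(\<integral>\<theta>. g \<theta> \<partial>density F0 (\<lambda>\<theta>. ennreal (q k \<theta>))) = (\<integral>\<theta>. G g k \<theta> \<partial>F)" for k
      using int_q[OF gm C] integral_wrt_density[OF F0 q_meas gm q_nonneg] by simp
    ultimately show "(\<lambda>k. \<integral>\<theta>. g \<theta> \<partial>density F0 (\<lambda>\<theta>. ennreal (q k \<theta>))) \<longlonglongrightarrow> (\<integral>\<theta>. g \<theta> \<partial>F)" by simp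
  qed
  then show ?thesis by (rule that[OF q_meas q_nonneg q_bounded q_mixing])
qed

context sampling_model
begin

lemma weakly_converges_mix:
  assumes "weakly_converges Gs G" shows "(\<lambda>k. mix (Gs k) x) \<longlonglongrightarrow> mix G x"
  using assms p_bounded[of x] p_continuous[of x]
  unfolding weakly_converges_def mixture_of_measure_def by blast

text \<open>By weak convergence the ratios \<open>t k = mix F / mix (Q k)\<close> tend to one pointwise. Their second moments are
  bounded, so they are uniformly integrable and their means tend to one as well, and these means control
  the fit through \<open>1 - t \<le> - ln t\<close>.\<close>
lemma fit_weakly_continuous_at_truth:
  assumes F: "mixing F" and Q: "\<And>k. mixing (Q k)" and conv: "weakly_converges Q F" and \<delta>: "0 < \<delta>"
  shows "eventually (\<lambda>k. - \<delta> \<le> fit F (Q k)) sequentially"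
proof -
  interpret P: prob_space "law F" using F by (rule prob_space_law)
  note mix_measurable[OF F, measurable] mix_measurable[OF Q, measurable]
  define t where "t k x = mix F x / mix (Q k) x" for k x
  \<comment> \<open>The level at which \<open>t k\<close> is truncated; the part above it has mean at most \<open>B / K\<close>.\<close>
  define K where "K = 1 + 2 * B / \<delta>"
  have K: "1 \<le> K" "B / K \<le> \<delta> / 2" using B_ge_1 \<delta> by (auto simp: K_def field_simps)
  have t0: "0 \<le> t k x" for k x by (simp add: t_def)
  have [measurable]: "t k \<in> borel_measurable borel" for k unfolding t_def by measurable
  have it: "integrable (law F) (t k)" "integrable (law F) (\<lambda>x. (t k x)\<^sup>2)" "(\<integral>x. (t k x)\<^sup>2 \<partial>law F) \<le> B" for k
    unfolding t_def using mixture_ratio_integrable[OF F F Q] mixture_ratio_square_integrable[OF F F Q] by auto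
  have imin: "integrable (law F) (\<lambda>x. min (t k x) K)" for k
    using t0 K by (intro P.integrable_const_bound[of _ K]) (auto simp: abs_le_iff min_def)
  have "(\<lambda>k. \<integral>x. min (t k x) K \<partial>law F) \<longlonglongrightarrow> (\<integral>x. 1 \<partial>law F)"
  proof (rule integral_dominated_convergence[where w="\<lambda>_. K"])
    show "AE x in law F. (\<lambda>k. min (t k x) K) \<longlonglongrightarrow> 1"
      using AE_law_mix_pos[OF F F]
    proof eventually_elim
      case (elim x)
      have "(\<lambda>k. t k x) \<longlonglongrightarrow> mix F x / mix F x"
        unfolding t_def using elim by (intro tendsto_divide tendsto_const weakly_converges_mix[OF conv]) auto
      then have "(\<lambda>k. min (t k x) K) \<longlonglongrightarrow> min 1 K" using elim by (intro tendsto_min) auto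
      then show ?case using K by simp
    qed
    show "AE x in law F. norm (min (t k x) K) \<le> K" for k
      using t0 K by (auto simp: abs_le_iff min_def)
  qed auto
  then have "(\<lambda>k. \<integral>x. min (t k x) K \<partial>law F) \<longlonglongrightarrow> 1" using P.prob_space by simp
  then have "eventually (\<lambda>k. (\<integral>x. min (t k x) K \<partial>law F) < 1 + \<delta> / 2) sequentially"
    using \<delta> by (intro order_tendstoD) auto
  then show ?thesis
  proof eventually_elim
    case (elim k)
    have trunc: "t k x \<le> min (t k x) K + (t k x)\<^sup>2 / K" for x
    proof (cases "t k x \<le> K")
      case False
      then have "K * t k x \<le> t k x * t k x" using t0 by (intro mult_right_mono) auto
      then have "t k x \<le> t k x * t k x / K" using K by (simp add: pos_le_divide_eq mult.commute)
      then show ?thesis using False K by (simp add: power2_eq_square)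
    qed (use K in auto)
    have "(\<integral>x. t k x \<partial>law F) \<le> (\<integral>x. min (t k x) K + (t k x)\<^sup>2 / K \<partial>law F)"
      using it imin by (intro integral_mono trunc) auto
    also have "\<dots> = (\<integral>x. min (t k x) K \<partial>law F) + (\<integral>x. (t k x)\<^sup>2 \<partial>law F) / K"
      using it imin by simp
    also have "\<dots> \<le> 1 + \<delta> / 2 + B / K"
      using elim it(3)[of k] K by (intro add_mono divide_right_mono) auto
    finally have t1: "(\<integral>x. t k x \<partial>law F) \<le> 1 + \<delta>" using K(2) by linarith
    have "(\<integral>x. 1 - t k x \<partial>law F) \<le> fit F (Q k)"
      unfolding fit_def
    proof (rule integral_mono_AE)
      show "AE x in law F. 1 - t k x \<le> ln (mix (Q k) x / mix F x)"
        using AE_law_mix_pos[OF F F] AE_law_mix_pos[OF F Q[of k]]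
      proof eventually_elim
        case (elim x)
        then have "ln (t k x) \<le> t k x - 1" unfolding t_def by (intro ln_le_minus_one) simp
        moreover have "ln (mix (Q k) x / mix F x) = - ln (t k x)" using elim by (simp add: t_def ln_div)
        ultimately show ?case by linarith
      qed
    qed (use it log_ratio_integrable[OF F Q F] in auto)
    moreover have "(\<integral>x. 1 - t k x \<partial>law F) = 1 - (\<integral>x. t k x \<partial>law F)" using it P.prob_space by simp
    ultimately show ?case using t1 by linarith
  qed
qed

lemma bounded_density_with_good_fit:
  assumes F: "mixing F" and F0: "mixing F0"
    and supp: "\<And>U. open U \<Longrightarrow> emeasure F0 U = 0 \<Longrightarrow> emeasure F U = 0" and \<delta>: "0 < \<delta>"
  obtains q :: "'t \<Rightarrow> real" and C where "q \<in> borel_measurable borel" "\<And>\<theta>. 0 \<le> q \<theta>" "\<And>\<theta>. q \<theta> \<le> C"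
    "mixing (density F0 (\<lambda>\<theta>. ennreal (q \<theta>)))" "- \<delta> \<le> fit F (density F0 (\<lambda>\<theta>. ennreal (q \<theta>)))"
proof -
  obtain q :: "nat \<Rightarrow> 't \<Rightarrow> real" where q: "\<And>k. q k \<in> borel_measurable borel" "\<And>k \<theta>. 0 \<le> q k \<theta>"
    "\<And>k. \<exists>C. \<forall>\<theta>. q k \<theta> \<le> C" "\<And>k. mixing (density F0 (\<lambda>\<theta>. ennreal (q k \<theta>)))"
    "weakly_converges (\<lambda>k. density F0 (\<lambda>\<theta>. ennreal (q k \<theta>))) F"
    using bounded_densities_weakly_dense[OF F F0 supp] by metis
  obtain k where k: "- \<delta> \<le> fit F (density F0 (\<lambda>\<theta>. ennreal (q k \<theta>)))"
    using fit_weakly_continuous_at_truth[OF F q(4,5) \<delta>] by (auto simp: eventually_sequentially)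
  obtain C where "\<And>\<theta>. q k \<theta> \<le> C" using q(3) by blast
  then show ?thesis using that[OF q(1,2) _ q(4) k] by blast
qed

end

section \<open>Almost sure convergence of the fit\<close>

text \<open>The drift \<open>d\<close> may have either sign; only its accumulated value is bounded. The starting index \<open>N\<close> is
  there because the quadratic expansion of the logarithm needs small weights.\<close>
lemma increments_bounded:
  fixes V s d :: "nat \<Rightarrow> real"
  assumes bd: "\<And>n. V n \<le> C" and s: "summable s"
    and step: "\<And>n. N \<le> n \<Longrightarrow> V n + s n + d n \<le> V (Suc n)"
  obtains K where "\<And>m. (\<Sum>i=N..<m. d i) \<le> K"
proof -
  obtain S where S: "\<And>n. \<bar>\<Sum>i<n. s i\<bar> \<le> S"
    using convergent_imp_Bseq[OF s[unfolded summable_iff_convergent]] by (auto simp: Bseq_def)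
  define W where "W n = V n - (\<Sum>i<n. s i)" for n
  have W: "W N + (\<Sum>i=N..<m. d i) \<le> W m" if "N \<le> m" for m
    using that
  proof (induction m rule: dec_induct)
    case (step n)
    then show ?case using assms(3)[of n] by (simp add: W_def)
  qed simp
  have "(\<Sum>i=N..<m. d i) \<le> max 0 (C + S - W N)" for m
  proof (cases "N \<le> m")
    case True
    have "W m \<le> C + S" using bd[of m] S[of m] by (simp add: W_def)
    then show ?thesis using W[OF True] by linarith
  qed simp
  then show ?thesis by (rule that)
qed

lemma almost_increasing_convergent:
  fixes V s :: "nat \<Rightarrow> real"
  assumes bd: "\<And>n. V n \<le> C" and s: "summable s"
    and step: "\<And>n. N \<le> n \<Longrightarrow> V n + s n \<le> V (Suc n)"
  shows "convergent V"
proof -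
  obtain S where S: "\<And>n. \<bar>\<Sum>i<n. s i\<bar> \<le> S"
    using convergent_imp_Bseq[OF s[unfolded summable_iff_convergent]] by (auto simp: Bseq_def)
  define W where "W n = V n - (\<Sum>i<n. s i)" for n
  have W_mono: "W (n + N) \<le> W (Suc n + N)" for n
    using step[of "n + N"] by (simp add: W_def)
  have W_bd: "W n \<le> C + S" for n using bd[of n] S[of n] by (simp add: W_def)
  have "convergent (\<lambda>n. W (n + N))"
  proof (rule Bseq_mono_convergent)
    have mono: "W (0 + N) \<le> W (n + N)" for n
      by (induction n) (use W_mono order_trans in auto)
    show "Bseq (\<lambda>n. W (n + N))"
    proof (rule BseqI'[of _ "\<bar>W N\<bar> + \<bar>C + S\<bar>"])
      show "norm (W (n + N)) \<le> \<bar>W N\<bar> + \<bar>C + S\<bar>" for n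
        using mono[of n] W_bd[of "n + N"] unfolding real_norm_def by simp
    qed
    show "\<forall>m n. m \<le> n \<longrightarrow> W (m + N) \<le> W (n + N)"
      using lift_Suc_mono_le[of "\<lambda>n. W (n + N)", OF W_mono] by blast
  qed
  then obtain l where "(\<lambda>n. W (n + N)) \<longlonglongrightarrow> l" by (auto simp: convergent_def)
  then have "W \<longlonglongrightarrow> l" by (rule LIMSEQ_offset)
  from tendsto_add[OF this summable_LIMSEQ[OF s]]
  have "V \<longlonglongrightarrow> l + suminf s" by (simp add: W_def)
  then show ?thesis by (rule convergentI)
qed

lemma divergent_weights_force_small_gain:
  fixes a d :: "nat \<Rightarrow> real"
  assumes a: "\<And>n. 0 \<le> a n" and div: "\<not> summable a"
    and bd: "\<And>m. (\<Sum>i=N..<m. a i * d i) \<le> K" and ev: "eventually (\<lambda>n. \<eta> \<le> d n) sequentially"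
  shows "\<eta> \<le> 0"
proof (rule ccontr)
  assume "\<not> \<eta> \<le> 0"
  then have \<eta>: "0 < \<eta>" by simp
  obtain n0 where n0: "\<And>n. n0 \<le> n \<Longrightarrow> \<eta> \<le> d n" using ev by (auto simp: eventually_sequentially)
  define L where "L = max N n0"
  define K' where "K' = K - (\<Sum>i=N..<L. a i * d i)"
  have part: "\<eta> * (\<Sum>i=L..<m. a i) \<le> K'" if "L \<le> m" for m
  proof -
    have "\<eta> * (\<Sum>i=L..<m. a i) = (\<Sum>i=L..<m. a i * \<eta>)" by (simp add: sum_distrib_left mult.commute)
    also have "\<dots> \<le> (\<Sum>i=L..<m. a i * d i)"
      using a n0 by (intro sum_mono mult_left_mono) (auto simp: L_def)
    also have "\<dots> = (\<Sum>i=N..<m. a i * d i) - (\<Sum>i=N..<L. a i * d i)"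
      using that sum.atLeastLessThan_concat[of N L m "\<lambda>i. a i * d i"] by (simp add: L_def)
    also have "\<dots> \<le> K'" using bd[of m] by (simp add: K'_def)
    finally show ?thesis .
  qed
  have "summable (\<lambda>i. a (i + L))"
  proof (rule summableI_nonneg_bounded)
    fix n
    have "(\<Sum>i<n. a (i + L)) = (\<Sum>i=L..<n+L. a i)"
      using sum.shift_bounds_nat_ivl[of a 0 L n] by (simp add: atLeast0LessThan)
    also have "\<dots> \<le> K' / \<eta>" using part[of "n + L"] \<eta> by (simp add: pos_le_divide_eq mult.commute)
    finally show "(\<Sum>i<n. a (i + L)) \<le> K' / \<eta>" .
  qed (rule a)
  then show False using div by (simp add: summable_iff_shift)
qed

text \<open>The initial estimate enters as the measure \<open>F0\<close>, and the estimates as their densities with respect to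
  \<open>F0\<close>. The observations are supposed to avoid, at every sample point, the points of zero density
  under the initial mixture; then no update divides by zero and every estimate is a probability measure.
  Almost surely the actual observations satisfy this, so they can be modified on a null event.\<close>
locale predictive_recursion =
  sampling_model \<nu> p B + iid_sequence M X "sampling_model.law \<nu> p F"
  for \<nu> :: "'x::topological_space measure"
    and p :: "'x \<Rightarrow> 't::{metric_space,second_countable_topology} \<Rightarrow> real" and B :: real
    and M :: "'w measure" and X :: "nat \<Rightarrow> 'w \<Rightarrow> 'x" and F :: "'t measure" +
  fixes F0 :: "'t measure" and w :: "nat \<Rightarrow> real"
  assumes F: "mixing F" and F0: "mixing F0"
    and w_range: "\<And>i. 1 \<le> i \<Longrightarrow> 0 < w i \<and> w i < 1"
    and w_square: "summable (\<lambda>n. (w (Suc n))\<^sup>2)" and w_div: "\<not> summable (\<lambda>n. w (Suc n))"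
    and X_good: "\<And>i \<omega>. 1 \<le> i \<Longrightarrow> \<omega> \<in> space M \<Longrightarrow> 0 < mixture_of_measure p F0 (X i \<omega>)"
    and support: "\<And>U. open U \<Longrightarrow> emeasure F0 U = 0 \<Longrightarrow> emeasure F U = 0"
begin

definition R :: "nat \<Rightarrow> 'w \<Rightarrow> 't \<Rightarrow> real" where
  "R n \<omega> = recursive_estimate F0 p w (\<lambda>_. 1) (\<lambda>i. X i \<omega>) n"

definition est :: "nat \<Rightarrow> 'w \<Rightarrow> 't measure" where
  "est n \<omega> = density F0 (\<lambda>\<theta>. ennreal (R n \<omega> \<theta>))"

lemma sets_F0[measurable_cong]: "sets F0 = sets borel" using F0 by (rule mixingD)

sublocale F0: prob_space F0 using F0 by (rule mixingD)
sublocale P: prob_space "law F" using F by (rule prob_space_law)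

lemma R_0: "R 0 \<omega> \<theta> = 1" by (simp add: R_def)

lemma R_Suc: "R (Suc n) \<omega> \<theta> = (1 - w (Suc n)) * R n \<omega> \<theta>
    + w (Suc n) * (p (X (Suc n) \<omega>) \<theta> * R n \<omega> \<theta> / mixture_density F0 p (R n \<omega>) (X (Suc n) \<omega>))"
  by (simp add: R_def)

text \<open>The second claim, for the mixture density, is needed to carry the first one through the induction.\<close>
lemma R_past:
  "(\<lambda>(\<omega>, \<theta>). R n \<omega> \<theta>) \<in> borel_measurable (past n \<Otimes>\<^sub>M borel)"
  "(\<lambda>(\<omega>, x). mixture_density F0 p (R n \<omega>) x) \<in> borel_measurable (past n \<Otimes>\<^sub>M borel)"
proof (induction n)
  case 0
  { case 1 show ?case by (simp add: R_0)
  next case 2 show ?case unfolding mixture_density_def by (simp add: R_0) }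
next
  case (Suc n)
  have id: "(\<lambda>\<omega>. \<omega>) \<in> past (Suc n) \<rightarrow>\<^sub>M past n" by (rule past_mono) simp
  have [measurable]: "X (Suc n) \<in> past (Suc n) \<rightarrow>\<^sub>M borel" by (rule X_past) auto
  have R[measurable]: "(\<lambda>z. R n (f z) (g z)) \<in> borel_measurable N"
    if [measurable]: "f \<in> N \<rightarrow>\<^sub>M past (Suc n)" "g \<in> N \<rightarrow>\<^sub>M borel" for f g and N :: "'n measure"
    using measurable_compose[OF measurable_Pair[OF measurable_compose[OF that(1) id] that(2)] Suc(1)] by simp
  have m[measurable]: "(\<lambda>z. mixture_density F0 p (R n (f z)) (g z)) \<in> borel_measurable N"
    if [measurable]: "f \<in> N \<rightarrow>\<^sub>M past (Suc n)" "g \<in> N \<rightarrow>\<^sub>M borel" for f g and N :: "'n measure"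
    using measurable_compose[OF measurable_Pair[OF measurable_compose[OF that(1) id] that(2)] Suc(2)] by simp
  have R'[measurable]: "(\<lambda>z. R (Suc n) (f z) (g z)) \<in> borel_measurable N"
    if [measurable]: "f \<in> N \<rightarrow>\<^sub>M past (Suc n)" "g \<in> N \<rightarrow>\<^sub>M borel" for f g and N :: "'n measure"
    unfolding R_Suc by measurable
  { case 1 show ?case by measurable
  next case 2 show ?case unfolding mixture_density_def by measurable }
qed

lemma R_past_compose[measurable (raw)]:
  assumes "f \<in> N \<rightarrow>\<^sub>M past n" "g \<in> N \<rightarrow>\<^sub>M borel"
  shows "(\<lambda>z. R n (f z) (g z)) \<in> borel_measurable N"
  using measurable_compose[OF measurable_Pair[OF assms] R_past(1)] by simp

lemma mixture_density_R_compose[measurable (raw)]: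
  assumes "f \<in> N \<rightarrow>\<^sub>M past n" "g \<in> N \<rightarrow>\<^sub>M borel"
  shows "(\<lambda>z. mixture_density F0 p (R n (f z)) (g z)) \<in> borel_measurable N"
  using measurable_compose[OF measurable_Pair[OF assms] R_past(2)] by simp

lemma R_slice[measurable]: "\<omega> \<in> space M \<Longrightarrow> R n \<omega> \<in> borel_measurable borel"
  using R_past_compose[of "\<lambda>_. \<omega>" borel n "\<lambda>\<theta>. \<theta>"] by simp

lemma integral_est:
  fixes h :: "'t \<Rightarrow> real"
  assumes \<omega>: "\<omega> \<in> space M" and [measurable]: "h \<in> borel_measurable borel" and R: "\<And>\<theta>. 0 \<le> R n \<omega> \<theta>"
  shows "(\<integral>\<theta>. h \<theta> \<partial>est n \<omega>) = (\<integral>\<theta>. R n \<omega> \<theta> * h \<theta> \<partial>F0)"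
  unfolding est_def by (rule integral_wrt_density[OF F0 R_slice[OF \<omega>] _ R]) measurable

lemma mix_est:
  assumes "\<omega> \<in> space M" and R: "\<And>\<theta>. 0 \<le> R n \<omega> \<theta>"
  shows "mix (est n \<omega>) x = mixture_density F0 p (R n \<omega>) x"
  unfolding mixture_of_measure_def mixture_density_def
  using integral_est[OF assms(1) _ R, of "p x"] by (simp add: mult.commute)

lemma mix_est_lower_bound:
  assumes \<omega>: "\<omega> \<in> space M" and c: "0 < c" "\<And>\<theta>. c \<le> R n \<omega> \<theta>" and C: "\<And>\<theta>. R n \<omega> \<theta> \<le> C"
  shows "c * mix F0 x \<le> mix (est n \<omega>) x"
proof -
  have [measurable]: "R n \<omega> \<in> borel_measurable borel" by (rule R_slice[OF \<omega>])
  have R0: "0 \<le> R n \<omega> \<theta>" for \<theta> using c(1) c(2)[of \<theta>] by linarith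
  have C0: "0 \<le> C" using order_trans[OF R0 C] .
  have "c * mix F0 x = (\<integral>\<theta>. c * p x \<theta> \<partial>F0)" by (simp add: mixture_of_measure_def)
  also have "\<dots> \<le> (\<integral>\<theta>. R n \<omega> \<theta> * p x \<theta> \<partial>F0)"
  proof (rule integral_mono)
    show "integrable F0 (\<lambda>\<theta>. R n \<omega> \<theta> * p x \<theta>)"
      using R0 C C0 p_le[of x]
      by (intro F0.integrable_const_bound[of _ "C * p_sup x"]) (auto simp: abs_mult intro!: mult_mono)
  qed (use c p_integrable[OF F0] in \<open>auto intro: mult_right_mono\<close>)
  also have "\<dots> = mix (est n \<omega>) x"
    unfolding mixture_of_measure_def using integral_est[OF \<omega> _ R0, of "p x"] by simp
  finally show ?thesis .
qed

text \<open>An update multiplies the density by a factor that is bounded and at least \<open>1 - w\<close>. The positive lower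
  bound keeps the mixture positive wherever the initial one is, and both bounds make logarithms of the
  density integrable.\<close>
lemma est_invariant:
  assumes \<omega>: "\<omega> \<in> space M"
  shows "mixing (est n \<omega>) \<and> (\<exists>c>0. \<forall>\<theta>. c \<le> R n \<omega> \<theta>) \<and> (\<exists>C. \<forall>\<theta>. R n \<omega> \<theta> \<le> C)"
proof (induction n)
  case 0
  have "est 0 \<omega> = F0" by (simp add: est_def R_0 density_1)
  then show ?case using F0 by (auto simp: R_0 intro: exI[of _ "1::real"])
next
  case (Suc n)
  let ?y = "X (Suc n) \<omega>" and ?w = "w (Suc n)"
  note G = conjunct1[OF Suc]
  obtain c where c: "0 < c" "\<And>\<theta>. c \<le> R n \<omega> \<theta>" using Suc by blast
  obtain C where C: "\<And>\<theta>. R n \<omega> \<theta> \<le> C" using Suc by blast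
  have R0: "0 \<le> R n \<omega> \<theta>" for \<theta> using c(1) c(2)[of \<theta>] by linarith
  have C0: "0 \<le> C" using order_trans[OF R0 C] .
  note m = mix_est[OF \<omega> R0]
  have wr: "0 < ?w" "?w < 1" using w_range[of "Suc n"] by auto
  have [measurable]: "R n \<omega> \<in> borel_measurable borel" by (rule R_slice[OF \<omega>])
  have "0 < c * mix F0 ?y" using c(1) X_good[OF _ \<omega>, of "Suc n"] by simp
  then have pos: "0 < mix (est n \<omega>) ?y"
    using mix_est_lower_bound[OF \<omega> c C] by (rule less_le_trans)
  have step: "R (Suc n) \<omega> \<theta> = R n \<omega> \<theta> * ((1 - ?w) + ?w * (p ?y \<theta> / mix (est n \<omega>) ?y))" for \<theta>
    unfolding R_Suc m by (simp add: algebra_simps)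
  have low: "R n \<omega> \<theta> * (1 - ?w) \<le> R (Suc n) \<omega> \<theta>" for \<theta>
    unfolding step using R0 wr pos by (intro mult_left_mono) auto
  have "(1 - ?w) * c \<le> R (Suc n) \<omega> \<theta>" for \<theta>
    using order_trans[OF mult_right_mono[OF c(2)] low] wr by (simp add: mult.commute)
  moreover have "0 < (1 - ?w) * c" using wr c by simp
  moreover have "R (Suc n) \<omega> \<theta> \<le> C * ((1 - ?w) + ?w * (p_sup ?y / mix (est n \<omega>) ?y))" for \<theta>
    unfolding step using R0 C C0 wr pos p_le[of ?y]
    by (intro mult_mono add_left_mono mult_left_mono divide_right_mono) auto
  moreover have "mixing (est (Suc n) \<omega>)"
  proof -
    have est_Suc: "est (Suc n) \<omega> = density (est n \<omega>) (\<lambda>\<theta>. ennreal (1 - ?w) + ennreal ?w * ennreal (p ?y \<theta> / mix (est n \<omega>) ?y))"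
    proof -
      define r where "r \<theta> = p ?y \<theta> / mix (est n \<omega>) ?y" for \<theta>
      have r0: "0 \<le> r \<theta>" for \<theta> by (simp add: r_def)
      have [measurable]: "r \<in> borel_measurable borel" unfolding r_def by measurable
      have "R (Suc n) \<omega> \<theta> = R n \<omega> \<theta> * ((1 - ?w) + ?w * r \<theta>)" for \<theta> unfolding step r_def ..
      then have "ennreal (R (Suc n) \<omega> \<theta>) = ennreal (R n \<omega> \<theta>) * (ennreal (1 - ?w) + ennreal ?w * ennreal (r \<theta>))" for \<theta>
        using wr r0 R0 by (simp add: ennreal_mult ennreal_plus)
      then show ?thesis
        unfolding est_def[of "Suc n"] r_def[symmetric] by (simp add: est_def density_density_eq)
    qed
    have [measurable_cong]: "sets (est n \<omega>) = sets borel" using G by (rule mixingD)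
    interpret G: prob_space "est n \<omega>" using G by (rule mixingD)
    interpret H: prob_space "posterior (est n \<omega>) ?y" by (rule mixingD[OF mixing_posterior[OF G pos]])
    have "(\<integral>\<^sup>+\<theta>. ennreal (p ?y \<theta> / mix (est n \<omega>) ?y) \<partial>est n \<omega>) = emeasure (posterior (est n \<omega>) ?y) (space (posterior (est n \<omega>) ?y))"
      unfolding posterior_def by (subst emeasure_density) (auto intro!: nn_integral_cong simp: indicator_def)
    then have I: "(\<integral>\<^sup>+\<theta>. ennreal (p ?y \<theta> / mix (est n \<omega>) ?y) \<partial>est n \<omega>) = 1" using H.emeasure_space_1 by simp
    have "emeasure (est (Suc n) \<omega>) (space (est (Suc n) \<omega>))
        = (\<integral>\<^sup>+\<theta>. ennreal (1 - ?w) + ennreal ?w * ennreal (p ?y \<theta> / mix (est n \<omega>) ?y) \<partial>est n \<omega>)"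
      unfolding est_Suc by (subst emeasure_density) (auto intro!: nn_integral_cong simp: indicator_def)
    also have "\<dots> = ennreal (1 - ?w) + ennreal ?w"
      using I G.emeasure_space_1 by (subst nn_integral_add) (auto simp: nn_integral_cmult)
    also have "\<dots> = 1" using wr by (simp add: ennreal_plus[symmetric] del: ennreal_plus)
    finally show ?thesis using F0 by (auto simp: mixing_def est_def intro: prob_spaceI)
  qed
  ultimately show ?case by blast
qed

context
  fixes \<omega> assumes \<omega>: "\<omega> \<in> space M"
begin

lemma est_mixing: "mixing (est n \<omega>)" using est_invariant[OF \<omega>] by blast

lemma R_pos: "0 < R n \<omega> \<theta>" using est_invariant[OF \<omega>, of n] by (auto intro: less_le_trans)

lemma R_nonneg: "0 \<le> R n \<omega> \<theta>" by (rule less_imp_le[OF R_pos])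

lemma R_bounds: obtains c C where "0 < c" "\<And>\<theta>. c \<le> R n \<omega> \<theta>" "\<And>\<theta>. R n \<omega> \<theta> \<le> C"
  using est_invariant[OF \<omega>, of n] by blast

lemma mix_est_density: "mix (est n \<omega>) x = mixture_density F0 p (R n \<omega>) x"
  by (rule mix_est[OF \<omega> R_nonneg])

lemma X_pos: "0 < mix (est n \<omega>) (X (Suc n) \<omega>)"
proof -
  obtain c C where c: "0 < c" "\<And>\<theta>. c \<le> R n \<omega> \<theta>" and C: "\<And>\<theta>. R n \<omega> \<theta> \<le> C" by (rule R_bounds[of n]) blast
  have "0 < c * mix F0 (X (Suc n) \<omega>)" using c(1) X_good[OF _ \<omega>, of "Suc n"] by simp
  then show ?thesis using mix_est_lower_bound[OF \<omega> c C] by (rule less_le_trans)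
qed

lemma R_step: "R (Suc n) \<omega> \<theta> = R n \<omega> \<theta> * (1 + w (Suc n) * (p (X (Suc n) \<omega>) \<theta> / mix (est n \<omega>) (X (Suc n) \<omega>) - 1))"
  unfolding R_Suc mix_est_density by (simp add: algebra_simps)

lemma mix_est_Suc: "mix (est (Suc n) \<omega>) x = (1 - w (Suc n)) * mix (est n \<omega>) x
    + w (Suc n) * mix (posterior (est n \<omega>) (X (Suc n) \<omega>)) x"
proof -
  let ?y = "X (Suc n) \<omega>" and ?w = "w (Suc n)"
  have [measurable]: "R n \<omega> \<in> borel_measurable borel" by (rule R_slice[OF \<omega>])
  obtain c C where c: "0 < c" "\<And>\<theta>. c \<le> R n \<omega> \<theta>" and C: "\<And>\<theta>. R n \<omega> \<theta> \<le> C" by (rule R_bounds[of n]) blast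
  have C0: "0 \<le> C" using order_trans[OF R_nonneg C] .
  have i1: "integrable F0 (\<lambda>\<theta>. R n \<omega> \<theta> * p x \<theta>)"
    using R_nonneg C C0 p_le[of x]
    by (intro F0.integrable_const_bound[of _ "C * p_sup x"]) (auto simp: abs_mult intro!: mult_mono)
  have i2: "integrable F0 (\<lambda>\<theta>. R n \<omega> \<theta> * (p x \<theta> * p ?y \<theta>))"
    using R_nonneg C C0 p_le p_sup_nonneg
    by (intro F0.integrable_const_bound[of _ "C * (p_sup x * p_sup ?y)"]) (auto simp: abs_mult intro!: mult_mono)
  have "mix (est (Suc n) \<omega>) x = (\<integral>\<theta>. R (Suc n) \<omega> \<theta> * p x \<theta> \<partial>F0)"
    unfolding mixture_of_measure_def by (rule integral_est[OF \<omega> _ R_nonneg]) measurable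
  also have "\<dots> = (\<integral>\<theta>. (1 - ?w) * (R n \<omega> \<theta> * p x \<theta>) + ?w * (R n \<omega> \<theta> * (p x \<theta> * p ?y \<theta>) / mix (est n \<omega>) ?y) \<partial>F0)"
    unfolding R_step by (intro Bochner_Integration.integral_cong) (auto simp: algebra_simps)
  also have "\<dots> = (1 - ?w) * (\<integral>\<theta>. R n \<omega> \<theta> * p x \<theta> \<partial>F0) + ?w * ((\<integral>\<theta>. R n \<omega> \<theta> * (p x \<theta> * p ?y \<theta>) \<partial>F0) / mix (est n \<omega>) ?y)"
    using i1 i2 by simp
  also have "(\<integral>\<theta>. R n \<omega> \<theta> * p x \<theta> \<partial>F0) = mix (est n \<omega>) x"
    unfolding mixture_of_measure_def by (rule integral_est[OF \<omega> _ R_nonneg, symmetric]) measurable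
  also have "(\<integral>\<theta>. R n \<omega> \<theta> * (p x \<theta> * p ?y \<theta>) \<partial>F0) / mix (est n \<omega>) ?y = mix (posterior (est n \<omega>) ?y) x"
    unfolding mix_posterior[OF est_mixing] by (subst integral_est[OF \<omega> _ R_nonneg]) auto
  finally show ?thesis .
qed

end

lemma weights_tendsto_0: "(\<lambda>n. w (Suc n)) \<longlonglongrightarrow> 0"
proof -
  have "(\<lambda>n. sqrt ((w (Suc n))\<^sup>2)) \<longlonglongrightarrow> sqrt 0"
    by (rule tendsto_real_sqrt[OF summable_LIMSEQ_zero[OF w_square]])
  moreover have "sqrt ((w (Suc n))\<^sup>2) = w (Suc n)" for n using w_range[of "Suc n"] by simp
  ultimately show ?thesis by simp
qed

lemma small_weights: obtains N where "\<And>n. N \<le> n \<Longrightarrow> 0 \<le> w (Suc n) \<and> w (Suc n) \<le> 1/2"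
proof -
  have "eventually (\<lambda>n. w (Suc n) < 1/2) sequentially"
    by (rule order_tendstoD(2)[OF weights_tendsto_0]) simp
  then obtain N where "\<And>n. N \<le> n \<Longrightarrow> w (Suc n) < 1/2" by (auto simp: eventually_sequentially)
  moreover have "0 \<le> w (Suc n)" for n using w_range[of "Suc n"] by simp
  ultimately show ?thesis using that less_imp_le by metis
qed

text \<open>A formula for the mixture of the posterior given the observation \<open>y\<close>, jointly measurable in all
  arguments; \<open>posterior\<close> itself takes values in measures.\<close>
definition cross :: "nat \<Rightarrow> 'w \<Rightarrow> 'x \<Rightarrow> 'x \<Rightarrow> real" where
  "cross n \<omega> y x = (\<integral>\<theta>. R n \<omega> \<theta> * (p x \<theta> * p y \<theta>) \<partial>F0) / mixture_density F0 p (R n \<omega>) y"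

lemma cross_measurable[measurable (raw)]:
  assumes [measurable]: "f \<in> N \<rightarrow>\<^sub>M past n" "g \<in> N \<rightarrow>\<^sub>M borel" "h \<in> N \<rightarrow>\<^sub>M borel"
  shows "(\<lambda>z. cross n (f z) (g z) (h z)) \<in> borel_measurable N"
  unfolding cross_def by measurable

lemma cross_eq: "\<omega> \<in> space M \<Longrightarrow> mix (posterior (est n \<omega>) y) x = cross n \<omega> y x"
  unfolding mix_posterior[OF est_mixing] cross_def mix_est_density
  by (subst integral_est[OF _ _ R_nonneg]) auto

text \<open>The fit is bounded above by zero and grows on conditional average, up to a summable error. Subtracting
  the convergent martingale and the error leaves an eventually increasing bounded sequence.\<close>
theorem fit_convergent: "AE \<omega> in M. convergent (\<lambda>n. fit F (est n \<omega>))"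
proof -
  define Z where "Z n \<omega> y = (\<integral>x. cross n \<omega> y x / mixture_density F0 p (R n \<omega>) x - 1 \<partial>law F)" for n \<omega> y
  have Z_eq: "Z n \<omega> y = (\<integral>x. mix (posterior (est n \<omega>) y) x / mix (est n \<omega>) x - 1 \<partial>law F)"
    if "\<omega> \<in> space M" for n \<omega> y
    using that by (simp add: Z_def cross_eq mix_est_density)
  have "AE \<omega> in M. summable (\<lambda>n. w (Suc n) * (Z n \<omega> (X (Suc n) \<omega>) - (\<integral>y. Z n \<omega> y \<partial>law F)))"
  proof (rule AE_summable_weighted_innovations[OF _ _ w_square])
    show "case_prod (Z n) \<in> borel_measurable (past n \<Otimes>\<^sub>M borel)" for n
      unfolding Z_def by measurable
    fix n \<omega> assume \<omega>: "\<omega> \<in> space M"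
    note G = est_mixing[OF \<omega>, of n]
    have "(\<integral>\<^sup>+y. ennreal ((Z n \<omega> y)\<^sup>2) \<partial>law F) \<le> (\<integral>\<^sup>+y. ennreal (B + 1) \<partial>law F)"
      using AE_law_mix_pos[OF F G]
    proof (intro nn_integral_mono_AE, eventually_elim)
      case (elim y)
      show ?case unfolding Z_eq[OF \<omega>] using fit_step(2)[OF F G G elim(2), of 0] by (intro ennreal_leI) simp
    qed
    also have "\<dots> = ennreal (B + 1)" using P.emeasure_space_1 by simp
    finally show "(\<integral>\<^sup>+y. ennreal ((Z n \<omega> y)\<^sup>2) \<partial>law F) \<le> ennreal (B + 1)" .
  qed
  with AE_space show ?thesis
  proof eventually_elim
    case (elim \<omega>)
    note \<omega> = elim(1)
    obtain N where N: "\<And>n. N \<le> n \<Longrightarrow> 0 \<le> w (Suc n) \<and> w (Suc n) \<le> 1/2" by (rule small_weights) blast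
    let ?s = "\<lambda>n. w (Suc n) * (Z n \<omega> (X (Suc n) \<omega>) - (\<integral>y. Z n \<omega> y \<partial>law F)) - 2 * (B + 1) * (w (Suc n))\<^sup>2"
    have gain: "0 \<le> (\<integral>y. Z n \<omega> y \<partial>law F)" for n
      unfolding Z_eq[OF \<omega>]
    proof (rule expected_gain_nonneg[OF F est_mixing[OF \<omega>]])
      show "(\<lambda>(y, x). mix (posterior (est n \<omega>) y) x) \<in> borel_measurable (borel \<Otimes>\<^sub>M borel)"
        unfolding cross_eq[OF \<omega>] case_prod_beta'
        by (rule cross_measurable[where f="\<lambda>_. \<omega>", OF measurable_const measurable_fst measurable_snd])
          (simp add: \<omega>)
    qed
    show ?case
    proof (rule almost_increasing_convergent)
      show "fit F (est n \<omega>) \<le> 0" for n by (rule fit_nonpos[OF F est_mixing[OF \<omega>]])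
      show "summable ?s"
        by (intro summable_diff elim(2) summable_mult w_square)
      fix n assume n: "N \<le> n"
      have "0 \<le> w (Suc n) * (\<integral>y. Z n \<omega> y \<partial>law F)" using gain N[OF n] by simp
      moreover have "fit F (est n \<omega>) + w (Suc n) * Z n \<omega> (X (Suc n) \<omega>) - 2 * (w (Suc n))\<^sup>2 * (B + 1) \<le> fit F (est (Suc n) \<omega>)"
        unfolding Z_eq[OF \<omega>]
        using N[OF n] by (intro fit_step(1)[OF F est_mixing[OF \<omega>] est_mixing[OF \<omega>] X_pos[OF \<omega>]] mix_est_Suc[OF \<omega>]) auto
      ultimately show "fit F (est n \<omega>) + ?s n \<le> fit F (est (Suc n) \<omega>)"
        by (simp add: algebra_simps)
    qed
  qed
qed

text \<open>The potential is \<open>V n\<close>, the \<open>Q\<close>-mean of \<open>ln (R n)\<close>. It is bounded above because \<open>ln R \<le> R\<close>, \<open>Q\<close> is at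
  most \<open>C\<close> times \<open>F0\<close>, and \<open>R n\<close> has \<open>F0\<close>-mean one.\<close>
theorem gain_towards_bounded:
  fixes q :: "'t \<Rightarrow> real"
  assumes q[measurable]: "q \<in> borel_measurable borel" and q0: "\<And>\<theta>. 0 \<le> q \<theta>" and qC: "\<And>\<theta>. q \<theta> \<le> C"
    and Q_mixing: "mixing (density F0 (\<lambda>\<theta>. ennreal (q \<theta>)))"
  defines "Q \<equiv> density F0 (\<lambda>\<theta>. ennreal (q \<theta>))"
  shows "AE \<omega> in M. \<exists>K N. \<forall>m. (\<Sum>i=N..<m. w (Suc i) * (\<integral>y. mix Q y / mix (est i \<omega>) y - 1 \<partial>law F)) \<le> K"
proof -
  have Q: "mixing Q" using Q_mixing by (simp add: Q_def)
  interpret Q: prob_space Q using Q by (rule mixingD)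
  have [measurable_cong]: "sets Q = sets borel" using Q by (rule mixingD)
  note mix_measurable[OF Q, measurable]
  define Z where "Z n \<omega> y = mix Q y / mixture_density F0 p (R n \<omega>) y - 1" for n \<omega> y
  define Y where "Y n \<omega> y = (\<integral>\<theta>. (p y \<theta> / mixture_density F0 p (R n \<omega>) y - 1)\<^sup>2 \<partial>Q)" for n \<omega> y
  have Z_eq: "Z n \<omega> y = mix Q y / mix (est n \<omega>) y - 1"
    and Y_eq: "Y n \<omega> y = (\<integral>\<theta>. (p y \<theta> / mix (est n \<omega>) y - 1)\<^sup>2 \<partial>Q)" if "\<omega> \<in> space M" for n \<omega> y
    using that by (simp_all add: Z_def Y_def mix_est_density)
  have "AE \<omega> in M. summable (\<lambda>n. w (Suc n) * (Z n \<omega> (X (Suc n) \<omega>) - (\<integral>y. Z n \<omega> y \<partial>law F)))"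
  proof (rule AE_summable_weighted_innovations[OF _ _ w_square])
    show "case_prod (Z n) \<in> borel_measurable (past n \<Otimes>\<^sub>M borel)" for n
      unfolding Z_def by measurable
    fix n \<omega> assume \<omega>: "\<omega> \<in> space M"
    note r = mixture_ratio_minus_one[OF F Q est_mixing[OF \<omega>, of n]]
    show "(\<integral>\<^sup>+y. ennreal ((Z n \<omega> y)\<^sup>2) \<partial>law F) \<le> ennreal (B + 1)"
      unfolding Z_eq[OF \<omega>] by (subst nn_integral_eq_integral[OF r(1)]) (auto intro: ennreal_leI r(2))
  qed
  moreover have "AE \<omega> in M. summable (\<lambda>n. (w (Suc n))\<^sup>2 * Y n \<omega> (X (Suc n) \<omega>))"
  proof (rule AE_summable_weighted_nonneg[OF _ _ _ w_square])
    show "case_prod (Y n) \<in> borel_measurable (past n \<Otimes>\<^sub>M borel)" for n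
      unfolding Y_def by measurable
    show "0 \<le> Y n \<omega> y" for n \<omega> y by (simp add: Y_def)
    fix n \<omega> assume \<omega>: "\<omega> \<in> space M"
    show "(\<integral>\<^sup>+y. ennreal (Y n \<omega> y) \<partial>law F) \<le> ennreal (B + 1)"
      unfolding Y_eq[OF \<omega>] by (rule likelihood_ratio_fluctuation[OF F est_mixing[OF \<omega>] Q])
  qed simp
  ultimately show ?thesis using AE_space
  proof eventually_elim
    case (elim \<omega>)
    note \<omega> = elim(3)
    obtain N where N: "\<And>n. N \<le> n \<Longrightarrow> 0 \<le> w (Suc n) \<and> w (Suc n) \<le> 1/2" by (rule small_weights) blast
    have R_meas[measurable]: "R n \<omega> \<in> borel_measurable borel" for n by (rule R_slice[OF \<omega>])
    have iR: "integrable F0 (R n \<omega>)" and R1: "(\<integral>\<theta>. R n \<omega> \<theta> \<partial>F0) = 1" for n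
    proof -
      obtain c D where D: "\<And>\<theta>. R n \<omega> \<theta> \<le> D" by (rule R_bounds[OF \<omega>, of n]) blast
      show "integrable F0 (R n \<omega>)"
        using D R_nonneg[OF \<omega>] by (intro F0.integrable_const_bound[of _ D]) auto
      interpret G: prob_space "est n \<omega>" by (rule mixingD[OF est_mixing[OF \<omega>]])
      show "(\<integral>\<theta>. R n \<omega> \<theta> \<partial>F0) = 1"
        using integral_est[OF \<omega> _ R_nonneg[OF \<omega>], of "\<lambda>_. 1" n] G.prob_space by simp
    qed
    have i_ln: "integrable Q (\<lambda>\<theta>. ln (R n \<omega> \<theta>))" for n
    proof -
      obtain c D where c: "0 < c" "\<And>\<theta>. c \<le> R n \<omega> \<theta>" and D: "\<And>\<theta>. R n \<omega> \<theta> \<le> D" by (rule R_bounds[OF \<omega>, of n]) blast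
      have "\<bar>ln (R n \<omega> \<theta>)\<bar> \<le> \<bar>ln c\<bar> + \<bar>ln D\<bar>" for \<theta>
      proof -
        have "ln c \<le> ln (R n \<omega> \<theta>)" "ln (R n \<omega> \<theta>) \<le> ln D"
          using c c(2)[of \<theta>] D[of \<theta>] R_pos[OF \<omega>, of n \<theta>] by (auto intro!: ln_mono)
        then show ?thesis by linarith
      qed
      then show ?thesis by (intro Q.integrable_const_bound[of _ "\<bar>ln c\<bar> + \<bar>ln D\<bar>"]) auto
    qed
    define V where "V n = (\<integral>\<theta>. ln (R n \<omega> \<theta>) \<partial>Q)" for n
    have V_le: "V n \<le> C" for n
    proof -
      have iqR: "integrable F0 (\<lambda>\<theta>. q \<theta> * R n \<omega> \<theta>)"
      proof (rule Bochner_Integration.integrable_bound)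
        show "integrable F0 (\<lambda>\<theta>. C * R n \<omega> \<theta>)" using iR by simp
        show "AE \<theta> in F0. norm (q \<theta> * R n \<omega> \<theta>) \<le> norm (C * R n \<omega> \<theta>)"
          using q0 qC R_nonneg[OF \<omega>] order_trans[OF q0 qC] by (auto simp: abs_mult intro!: mult_right_mono)
      qed simp
      have iRQ: "integrable Q (R n \<omega>)"
        unfolding Q_def using q0 iqR by (subst integrable_density) auto
      have "V n \<le> (\<integral>\<theta>. R n \<omega> \<theta> \<partial>Q)"
        unfolding V_def
      proof (rule integral_mono[OF i_ln iRQ])
        show "ln (R n \<omega> \<theta>) \<le> R n \<omega> \<theta>" for \<theta>
          using ln_le_minus_one[OF R_pos[OF \<omega>, of n \<theta>]] by linarith
      qed
      also have "\<dots> = (\<integral>\<theta>. q \<theta> * R n \<omega> \<theta> \<partial>F0)"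
        unfolding Q_def by (rule integral_wrt_density[OF F0 q R_meas q0])
      also have "\<dots> \<le> (\<integral>\<theta>. C * R n \<omega> \<theta> \<partial>F0)"
        using iqR iR qC R_nonneg[OF \<omega>] by (intro integral_mono mult_right_mono) auto
      also have "\<dots> = C" using R1 by simp
      finally show ?thesis .
    qed
    let ?s = "\<lambda>n. w (Suc n) * (Z n \<omega> (X (Suc n) \<omega>) - (\<integral>y. Z n \<omega> y \<partial>law F)) - 2 * ((w (Suc n))\<^sup>2 * Y n \<omega> (X (Suc n) \<omega>))"
    have s: "summable ?s" by (intro summable_diff elim summable_mult)
    have step: "V n + ?s n + w (Suc n) * (\<integral>y. Z n \<omega> y \<partial>law F) \<le> V (Suc n)" if n: "N \<le> n" for n
    proof -
      define y where "y = X (Suc n) \<omega>"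
      define u where "u \<theta> = p y \<theta> / mix (est n \<omega>) y" for \<theta>
      have pos: "0 < mix (est n \<omega>) y" unfolding y_def by (rule X_pos[OF \<omega>])
      have [measurable]: "u \<in> borel_measurable borel" unfolding u_def by measurable
      have u: "0 \<le> u \<theta>" "u \<theta> \<le> p_sup y / mix (est n \<omega>) y" for \<theta>
        using pos p_le[of y \<theta>] by (auto simp: u_def divide_right_mono)
      have iu: "integrable Q u"
        using u by (intro Q.integrable_const_bound[of _ "p_sup y / mix (est n \<omega>) y"]) auto
      have iu2: "integrable Q (\<lambda>\<theta>. (u \<theta>)\<^sup>2)"
        using u by (intro Q.integrable_const_bound[of _ "(p_sup y / mix (est n \<omega>) y)\<^sup>2"]) (auto intro!: power_mono)
      note sq = Q.square_deviation_from_one(1)[OF u(1) iu iu2]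
      note wN = N[OF n, THEN conjunct1] N[OF n, THEN conjunct2]
      have ln_step: "integrable Q (\<lambda>\<theta>. ln (1 + w (Suc n) * (u \<theta> - 1)))"
        "w (Suc n) * (\<integral>\<theta>. u \<theta> - 1 \<partial>Q) - 2 * (w (Suc n))\<^sup>2 * (\<integral>\<theta>. (u \<theta> - 1)\<^sup>2 \<partial>Q)
          \<le> (\<integral>\<theta>. ln (1 + w (Suc n) * (u \<theta> - 1)) \<partial>Q)"
        using Q.integral_ln_mixture_step[OF _ _ sq wN] u(1) by auto
      have "(\<integral>\<theta>. u \<theta> - 1 \<partial>Q) = Z n \<omega> y"
      proof -
        have "(\<integral>\<theta>. u \<theta> \<partial>Q) = mix Q y / mix (est n \<omega>) y"
          unfolding u_def by (simp only: integral_divide_zero mixture_of_measure_def)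
        then show ?thesis unfolding Z_eq[OF \<omega>] using iu Q.prob_space by simp
      qed
      moreover have "(\<integral>\<theta>. (u \<theta> - 1)\<^sup>2 \<partial>Q) = Y n \<omega> y" by (simp add: Y_eq[OF \<omega>] u_def)
      moreover have "V (Suc n) = V n + (\<integral>\<theta>. ln (1 + w (Suc n) * (u \<theta> - 1)) \<partial>Q)"
      proof -
        have "ln (R (Suc n) \<omega> \<theta>) = ln (R n \<omega> \<theta>) + ln (1 + w (Suc n) * (u \<theta> - 1))" for \<theta>
        proof -
          have "R (Suc n) \<omega> \<theta> = R n \<omega> \<theta> * (1 + w (Suc n) * (u \<theta> - 1))"
            unfolding R_step[OF \<omega>] u_def y_def ..
          moreover have "0 < 1 + w (Suc n) * (u \<theta> - 1)"
            using calculation R_pos[OF \<omega>, of n \<theta>] R_pos[OF \<omega>, of "Suc n" \<theta>] by (simp add: zero_less_mult_iff)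
          ultimately show ?thesis using R_pos[OF \<omega>, of n \<theta>] by (simp add: ln_mult)
        qed
        then show ?thesis unfolding V_def using i_ln ln_step(1) by simp
      qed
      ultimately show ?thesis using ln_step(2) unfolding y_def by (simp add: algebra_simps)
    qed
    obtain K where "\<And>m. (\<Sum>i=N..<m. w (Suc i) * (\<integral>y. Z i \<omega> y \<partial>law F)) \<le> K"
      using increments_bounded[OF V_le s step] by blast
    then show ?case unfolding Z_eq[OF \<omega>] by blast
  qed
qed

text \<open>If the fit had a negative limit, some \<open>Q\<close> of the approximating sequence would fit better than all late
  estimates by a fixed margin, and the accumulated gain towards \<open>Q\<close> would diverge with the sum of the
  weights.\<close>
theorem fit_tendsto_0: "AE \<omega> in M. (\<lambda>n. fit F (est n \<omega>)) \<longlonglongrightarrow> 0"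
proof -
  have "\<exists>q C. q \<in> borel_measurable borel \<and> (\<forall>\<theta>. 0 \<le> q \<theta> \<and> q \<theta> \<le> C)
      \<and> mixing (density F0 (\<lambda>\<theta>. ennreal (q \<theta>))) \<and> - (1 / real (Suc k)) \<le> fit F (density F0 (\<lambda>\<theta>. ennreal (q \<theta>)))" for k
    using bounded_density_with_good_fit[OF F F0 support, of "1 / real (Suc k)"] by (metis of_nat_0_less_iff zero_less_Suc zero_less_divide_1_iff)
  then obtain q C where q: "\<And>k. q k \<in> borel_measurable borel" "\<And>k \<theta>. 0 \<le> q k \<theta>" "\<And>k \<theta>. q k \<theta> \<le> C k"
    and Q: "\<And>k. mixing (density F0 (\<lambda>\<theta>. ennreal (q k \<theta>)))"
    and fit_Q: "\<And>k. - (1 / real (Suc k)) \<le> fit F (density F0 (\<lambda>\<theta>. ennreal (q k \<theta>)))"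
    by metis
  define Q where "Q k = density F0 (\<lambda>\<theta>. ennreal (q k \<theta>))" for k
  have "AE \<omega> in M. \<forall>k. \<exists>K N. \<forall>m. (\<Sum>i=N..<m. w (Suc i) * (\<integral>y. mix (Q k) y / mix (est i \<omega>) y - 1 \<partial>law F)) \<le> K"
    unfolding AE_all_countable Q_def using gain_towards_bounded[OF q Q] by blast
  with fit_convergent AE_space show ?thesis
  proof eventually_elim
    case (elim \<omega>)
    note \<omega> = elim(2)
    obtain l where l: "(\<lambda>n. fit F (est n \<omega>)) \<longlonglongrightarrow> l" using elim(1) by (auto simp: convergent_def)
    have "l \<le> 0" by (rule LIMSEQ_le_const2[OF l]) (use fit_nonpos[OF F est_mixing[OF \<omega>]] in auto)
    moreover have "\<not> l < 0"
    proof
      assume "l < 0"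
      then obtain k where k: "1 / real (Suc k) < - l / 2"
        using reals_Archimedean[of "- l / 2"] by (auto simp: inverse_eq_divide)
      obtain K N where K: "\<And>m. (\<Sum>i=N..<m. w (Suc i) * (\<integral>y. mix (Q k) y / mix (est i \<omega>) y - 1 \<partial>law F)) \<le> K"
        using elim(3) by blast
      have "eventually (\<lambda>n. fit F (est n \<omega>) < 3 * l / 4) sequentially"
        by (rule order_tendstoD(2)[OF l]) (use \<open>l < 0\<close> in simp)
      then have "eventually (\<lambda>n. - l / 4 \<le> (\<integral>y. mix (Q k) y / mix (est n \<omega>) y - 1 \<partial>law F)) sequentially"
      proof eventually_elim
        case (elim n)
        show ?case
          using expected_gain_towards[OF F est_mixing[OF \<omega>, of n] Q[of k]] fit_Q[of k] k elim
          unfolding Q_def by linarith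
      qed
      from divergent_weights_force_small_gain[OF _ w_div K this]
      have "- l / 4 \<le> 0" using w_range[of "Suc _"] by (simp add: less_imp_le)
      then show False using \<open>l < 0\<close> by simp
    qed
    ultimately show ?case using l by simp
  qed
qed

end

section \<open>From the fit to weak convergence\<close>

lemma not_tendsto_subsequence:
  fixes X :: "nat \<Rightarrow> 'a::metric_space"
  assumes "\<not> X \<longlonglongrightarrow> l"
  obtains s e where "strict_mono s" "0 < e" "\<And>n::nat. e \<le> dist (X (s n)) l"
proof -
  obtain e where e: "0 < e" "\<not> eventually (\<lambda>n. dist (X n) l < e) sequentially"
    using assms unfolding tendsto_iff by blast
  have "infinite {n. e \<le> dist (X n) l}"
    using e(2) unfolding infinite_nat_iff_unbounded_le eventually_sequentially by (auto simp: not_less)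
  then obtain s :: "nat \<Rightarrow> nat" where "strict_mono s" "\<And>n. s n \<in> {n. e \<le> dist (X n) l}"
    using infinite_enumerate by blast
  then show ?thesis using that e(1) by blast
qed

context sampling_model
begin

text \<open>Pinsker's inequality in a form linear in the divergence. With \<open>r = sqrt t\<close>, factor \<open>t - 1\<close> as
  \<open>(r - 1) (r + 1)\<close> and split the product with the weight \<open>\<eta>\<close>; the first square is controlled by
  \<open>t - 1 - ln t\<close> and the second by \<open>t + 1\<close>.\<close>
lemma L1_distance_le_fit:
  assumes F: "mixing F" and G: "mixing G" and \<eta>: "0 < \<eta>"
  shows "integrable (law F) (\<lambda>x. \<bar>mix G x / mix F x - 1\<bar>)"
    and "(\<integral>x. \<bar>mix G x / mix F x - 1\<bar> \<partial>law F) \<le> - fit F G / (2 * \<eta>) + 2 * \<eta>"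
proof -
  interpret P: prob_space "law F" using F by (rule prob_space_law)
  define t where "t x = mix G x / mix F x" for x
  have it: "integrable (law F) t" unfolding t_def by (rule mixture_ratio_integrable[OF F G F])
  have iln: "integrable (law F) (\<lambda>x. ln (t x))" unfolding t_def by (rule log_ratio_integrable[OF F G F])
  have t1: "(\<integral>x. t x \<partial>law F) \<le> 1" unfolding t_def by (rule integral_ratio_le_1[OF F G])
  have fit: "fit F G = (\<integral>x. ln (t x) \<partial>law F)" by (simp add: fit_def t_def)
  show i: "integrable (law F) (\<lambda>x. \<bar>mix G x / mix F x - 1\<bar>)"
    using it unfolding t_def[symmetric] by auto
  have pw: "\<bar>s - 1\<bar> \<le> (s - 1 - ln s) / (2 * \<eta>) + \<eta> * (s + 1)" if s: "0 < s" for s :: real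
  proof -
    define r where "r = sqrt s"
    have r: "0 < r" "s = r\<^sup>2" using s by (auto simp: r_def)
    have "ln s = 2 * ln r" using r by (simp add: ln_realpow)
    moreover have "ln r \<le> r - 1" using r by (intro ln_le_minus_one)
    ultimately have a: "(r - 1)\<^sup>2 \<le> s - 1 - ln s"
      unfolding r(2) by (simp add: power2_eq_square algebra_simps)
    have b: "(r + 1)\<^sup>2 \<le> 2 * (s + 1)"
      using zero_le_power2[of "r - 1"] unfolding r(2) by (simp add: power2_eq_square algebra_simps)
    have "s - 1 = (r - 1) * (r + 1)" unfolding r(2) by (simp add: power2_eq_square algebra_simps)
    then have "\<bar>s - 1\<bar> = \<bar>r - 1\<bar> * (r + 1)" using r by (simp add: abs_mult)
    also have "\<dots> \<le> (r - 1)\<^sup>2 / (2 * \<eta>) + \<eta> * (r + 1)\<^sup>2 / 2"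
    proof -
      have "0 \<le> (\<bar>r - 1\<bar> - \<eta> * (r + 1))\<^sup>2" by simp
      then have "2 * \<eta> * (\<bar>r - 1\<bar> * (r + 1)) \<le> (r - 1)\<^sup>2 + \<eta>\<^sup>2 * (r + 1)\<^sup>2"
        by (simp add: power2_diff power_mult_distrib mult_ac)
      also have "\<dots> = 2 * \<eta> * ((r - 1)\<^sup>2 / (2 * \<eta>) + \<eta> * (r + 1)\<^sup>2 / 2)"
        using \<eta> by (simp add: field_simps power2_eq_square)
      finally show ?thesis using \<eta> by simp
    qed
    also have "\<dots> \<le> (s - 1 - ln s) / (2 * \<eta>) + \<eta> * (s + 1)"
    proof (rule add_mono)
      show "(r - 1)\<^sup>2 / (2 * \<eta>) \<le> (s - 1 - ln s) / (2 * \<eta>)" using a \<eta> by (intro divide_right_mono) auto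
      have "\<eta> * (r + 1)\<^sup>2 \<le> \<eta> * (2 * (s + 1))" using b \<eta> by (intro mult_left_mono) auto
      then show "\<eta> * (r + 1)\<^sup>2 / 2 \<le> \<eta> * (s + 1)" by (simp add: algebra_simps)
    qed
    finally show ?thesis .
  qed
  have "(\<integral>x. \<bar>t x - 1\<bar> \<partial>law F) \<le> (\<integral>x. (t x - 1 - ln (t x)) / (2 * \<eta>) + \<eta> * (t x + 1) \<partial>law F)"
  proof (rule integral_mono_AE)
    show "AE x in law F. \<bar>t x - 1\<bar> \<le> (t x - 1 - ln (t x)) / (2 * \<eta>) + \<eta> * (t x + 1)"
      using AE_law_mix_pos[OF F G] AE_law_mix_pos[OF F F]
      by eventually_elim (intro pw, simp add: t_def)
  qed (use it iln in auto)
  also have "\<dots> = ((\<integral>x. t x \<partial>law F) - 1 - fit F G) / (2 * \<eta>) + \<eta> * ((\<integral>x. t x \<partial>law F) + 1)"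
    using it iln P.prob_space by (simp add: fit)
  also have "\<dots> \<le> - fit F G / (2 * \<eta>) + 2 * \<eta>"
  proof (rule add_mono)
    show "((\<integral>x. t x \<partial>law F) - 1 - fit F G) / (2 * \<eta>) \<le> - fit F G / (2 * \<eta>)"
      using t1 \<eta> by (intro divide_right_mono) auto
    have "\<eta> * ((\<integral>x. t x \<partial>law F) + 1) \<le> \<eta> * 2" using t1 \<eta> by (intro mult_left_mono) auto
    then show "\<eta> * ((\<integral>x. t x \<partial>law F) + 1) \<le> 2 * \<eta>" by simp
  qed
  finally show "(\<integral>x. \<bar>mix G x / mix F x - 1\<bar> \<partial>law F) \<le> - fit F G / (2 * \<eta>) + 2 * \<eta>"
    unfolding t_def .
qed

lemma fit_tendsto_0_imp_L1:
  assumes F: "mixing F" and G: "\<And>n. mixing (Gs n)" and fit: "(\<lambda>n. fit F (Gs n)) \<longlonglongrightarrow> 0"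
  shows "(\<lambda>n. \<integral>x. \<bar>mix (Gs n) x / mix F x - 1\<bar> \<partial>law F) \<longlonglongrightarrow> 0"
proof (rule tendstoI)
  fix e :: real assume e: "0 < e"
  have "eventually (\<lambda>n. - (e\<^sup>2 / 4) < fit F (Gs n)) sequentially"
    by (rule order_tendstoD(1)[OF fit]) (use e in simp)
  then show "eventually (\<lambda>n. dist (\<integral>x. \<bar>mix (Gs n) x / mix F x - 1\<bar> \<partial>law F) 0 < e) sequentially"
  proof eventually_elim
    case (elim n)
    have "- fit F (Gs n) / (2 * (e / 4)) < (e\<^sup>2 / 4) / (2 * (e / 4))"
      using elim e by (intro divide_strict_right_mono) auto
    also have "\<dots> = e / 2" using e by (simp add: power2_eq_square field_simps)
    finally have "(\<integral>x. \<bar>mix (Gs n) x / mix F x - 1\<bar> \<partial>law F) < e"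
      using L1_distance_le_fit(2)[OF F G[of n], of "e / 4"] e by simp
    then show ?case by (simp add: dist_real_def)
  qed
qed

lemma measure_law_ge:
  assumes F: "mixing F" and G: "mixing G" and K[measurable]: "K \<in> sets borel"
  shows "measure (law F) K - (\<integral>x. \<bar>mix G x / mix F x - 1\<bar> \<partial>law F) \<le> measure (law G) K"
proof -
  interpret P: prob_space "law F" using F by (rule prob_space_law)
  interpret Q: prob_space "law G" using G by (rule prob_space_law)
  note mix_measurable[OF F, measurable] mix_measurable[OF G, measurable]
  note i = mixture_ratio_integrable[OF F G F] L1_distance_le_fit(1)[OF F G zero_less_one]
  have iK: "integrable (law F) (indicat_real K)"
    by (intro P.integrable_const_bound[of _ 1]) (auto simp: indicator_def)
  have iKt: "integrable (law F) (\<lambda>x. indicat_real K x * (mix G x / mix F x))"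
    by (rule Bochner_Integration.integrable_bound[OF i(1)]) (auto simp: indicator_def)
  have "ennreal (\<integral>x. indicat_real K x * (mix G x / mix F x) \<partial>law F)
      = (\<integral>\<^sup>+x. ennreal (indicat_real K x * (mix G x / mix F x)) \<partial>law F)"
    by (rule nn_integral_eq_integral[symmetric, OF iKt]) auto
  also have "\<dots> = (\<integral>\<^sup>+x. ennreal (mix F x) * ennreal (indicat_real K x * (mix G x / mix F x)) \<partial>\<nu>)"
    unfolding law_def by (subst nn_integral_density) auto
  also have "\<dots> \<le> (\<integral>\<^sup>+x. ennreal (mix G x) * indicator K x \<partial>\<nu>)"
    by (intro nn_integral_mono) (auto simp: ennreal_mult[symmetric] indicator_def)
  also have "\<dots> = emeasure (law G) K" unfolding law_def by (subst emeasure_density) (auto simp: sets_nu)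
  finally have "(\<integral>x. indicat_real K x * (mix G x / mix F x) \<partial>law F) \<le> measure (law G) K"
    unfolding Q.emeasure_eq_measure by (subst (asm) ennreal_le_iff) auto
  moreover have "measure (law F) K - (\<integral>x. \<bar>mix G x / mix F x - 1\<bar> \<partial>law F)
      = (\<integral>x. indicat_real K x - \<bar>mix G x / mix F x - 1\<bar> \<partial>law F)"
    using iK i(2) by simp
  moreover have "\<dots> \<le> (\<integral>x. indicat_real K x * (mix G x / mix F x) \<partial>law F)"
  proof (intro integral_mono iKt)
    show "integrable (law F) (\<lambda>x. indicat_real K x - \<bar>mix G x / mix F x - 1\<bar>)" using iK i(2) by simp
    show "indicat_real K x - \<bar>mix G x / mix F x - 1\<bar> \<le> indicat_real K x * (mix G x / mix F x)" for x
      by (auto simp: indicator_def)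
  qed
  ultimately show ?thesis by linarith
qed

text \<open>Parameters outside \<open>T\<close> contribute at most \<open>e\<close> to the mass of \<open>K\<close>. This turns mass of the mixture on a
  compact set of observations into mass of the mixing distribution on a compact set of parameters.\<close>
lemma mass_of_compact_le:
  assumes G: "mixing G" and K[measurable]: "K \<in> sets borel" and T[measurable]: "T \<in> sets borel"
    and small: "\<And>\<theta>. \<theta> \<notin> T \<Longrightarrow> (\<integral>\<^sup>+x\<in>K. ennreal (p x \<theta>) \<partial>\<nu>) \<le> ennreal e" and e: "0 \<le> e"
  shows "measure (law G) K \<le> measure G T + e"
proof -
  interpret G: prob_space G using G by (rule mixingD)
  interpret Q: prob_space "law G" using G by (rule prob_space_law)
  have [measurable_cong]: "sets G = sets borel" using G by (rule mixingD)
  have "ennreal (measure (law G) K) = (\<integral>\<^sup>+x. indicator K x \<partial>law G)"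
    by (simp add: Q.emeasure_eq_measure[symmetric] sets_law)
  also have "\<dots> = (\<integral>\<^sup>+\<theta>. \<integral>\<^sup>+x. indicator K x * ennreal (p x \<theta>) \<partial>\<nu> \<partial>G)"
    by (rule nn_integral_law[OF G]) measurable
  also have "\<dots> \<le> (\<integral>\<^sup>+\<theta>. indicator T \<theta> + ennreal e \<partial>G)"
  proof (intro nn_integral_mono)
    fix \<theta>
    show "(\<integral>\<^sup>+x. indicator K x * ennreal (p x \<theta>) \<partial>\<nu>) \<le> indicator T \<theta> + ennreal e"
    proof (cases "\<theta> \<in> T")
      case True
      have "(\<integral>\<^sup>+x. indicator K x * ennreal (p x \<theta>) \<partial>\<nu>) \<le> (\<integral>\<^sup>+x. ennreal (p x \<theta>) \<partial>\<nu>)"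
        by (intro nn_integral_mono) (auto simp: indicator_def)
      then show ?thesis using True p_integral by (auto intro: order_trans[of _ 1] add_increasing2)
    next
      case False
      then show ?thesis using small[OF False] by (simp add: mult.commute)
    qed
  qed
  also have "\<dots> = emeasure G T + ennreal e"
    using G.emeasure_space_1 mixingD(2)[OF G] by (subst nn_integral_add) auto
  also have "\<dots> = ennreal (measure G T + e)"
    using e by (simp add: G.emeasure_eq_measure ennreal_plus)
  finally show ?thesis using e by (subst (asm) ennreal_le_iff) auto
qed

text \<open>Fatou's lemma identifies the two mixtures where the true one is positive. Both have total mass one, so
  they agree elsewhere too.\<close>
lemma weak_limit_has_same_mixture:
  assumes F: "mixing F" and Gs: "\<And>n. mixing (Gs n)" and G: "mixing G" and conv: "weakly_converges Gs G"
    and L1: "(\<lambda>n. \<integral>x. \<bar>mix (Gs n) x / mix F x - 1\<bar> \<partial>law F) \<longlonglongrightarrow> 0"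
  shows "AE x in \<nu>. mix G x = mix F x"
proof -
  interpret P: prob_space "law F" using F by (rule prob_space_law)
  note mix_measurable[OF F, measurable] mix_measurable[OF G, measurable] mix_measurable[OF Gs, measurable]
  have "(\<integral>\<^sup>+x. ennreal \<bar>mix G x / mix F x - 1\<bar> \<partial>law F)
      = (\<integral>\<^sup>+x. liminf (\<lambda>n. ennreal \<bar>mix (Gs n) x / mix F x - 1\<bar>) \<partial>law F)"
    using AE_law_mix_pos[OF F F]
  proof (intro nn_integral_cong_AE, eventually_elim)
    case (elim x)
    have "(\<lambda>n. ennreal \<bar>mix (Gs n) x / mix F x - 1\<bar>) \<longlonglongrightarrow> ennreal \<bar>mix G x / mix F x - 1\<bar>"
      using elim by (intro tendsto_ennrealI tendsto_intros weakly_converges_mix[OF conv]) auto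
    from lim_imp_Liminf[OF sequentially_bot this] show ?case by simp
  qed
  also have "\<dots> \<le> liminf (\<lambda>n. \<integral>\<^sup>+x. ennreal \<bar>mix (Gs n) x / mix F x - 1\<bar> \<partial>law F)"
    by (rule nn_integral_liminf) measurable
  also have "\<dots> = liminf (\<lambda>n. ennreal (\<integral>x. \<bar>mix (Gs n) x / mix F x - 1\<bar> \<partial>law F))"
    by (subst nn_integral_eq_integral[OF L1_distance_le_fit(1)[OF F Gs zero_less_one]]) auto
  also have "\<dots> = 0" using lim_imp_Liminf[OF sequentially_bot tendsto_ennrealI[OF L1]] by simp
  finally have "(\<integral>\<^sup>+x. ennreal \<bar>mix G x / mix F x - 1\<bar> \<partial>law F) = 0" by simp
  then have "AE x in law F. ennreal \<bar>mix G x / mix F x - 1\<bar> = 0"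
    by (subst (asm) nn_integral_0_iff_AE) auto
  then have "AE x in \<nu>. 0 < ennreal (mix F x) \<longrightarrow> ennreal \<bar>mix G x / mix F x - 1\<bar> = 0"
    unfolding law_def by (subst (asm) AE_density) auto
  then have le: "AE x in \<nu>. mix F x \<le> mix G x"
  proof eventually_elim
    case (elim x)
    then show ?case by (cases "0 < mix F x") (auto simp: not_less intro: order_trans[OF _ mix_nonneg])
  qed
  have one: "(\<integral>\<^sup>+x. ennreal (mix H x) \<partial>\<nu>) = 1" if "mixing H" for H
  proof -
    interpret Q: prob_space "law H" using that by (rule prob_space_law)
    note mix_measurable[OF that, measurable]
    have "(\<integral>\<^sup>+x. ennreal (mix H x) \<partial>\<nu>) = (\<integral>\<^sup>+x. 1 \<partial>law H)"
      unfolding law_def by (subst nn_integral_density) auto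
    then show ?thesis using Q.emeasure_space_1 by simp
  qed
  have "(\<integral>\<^sup>+x. ennreal (mix G x) \<partial>\<nu>) = (\<integral>\<^sup>+x. ennreal (mix G x - mix F x) + ennreal (mix F x) \<partial>\<nu>)"
    using le by (intro nn_integral_cong_AE) (auto elim!: eventually_mono simp: ennreal_plus[symmetric] simp del: ennreal_plus)
  also have "\<dots> = (\<integral>\<^sup>+x. ennreal (mix G x - mix F x) \<partial>\<nu>) + 1"
    using one[OF F] by (subst nn_integral_add) auto
  finally have "1 + (\<integral>\<^sup>+x. ennreal (mix G x - mix F x) \<partial>\<nu>) = 1 + 0"
    unfolding one[OF G] by (simp only: add.commute add_0_right)
  then have "(\<integral>\<^sup>+x. ennreal (mix G x - mix F x) \<partial>\<nu>) = 0"
    unfolding ennreal_add_left_cancel by simp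
  then have "AE x in \<nu>. ennreal (mix G x - mix F x) = 0"
    by (subst (asm) nn_integral_0_iff_AE) auto
  with le show ?thesis by eventually_elim (simp add: ennreal_eq_0_iff)
qed

end

theorem fit_tendsto_0_imp_weakly_converges:
  fixes \<nu> :: "'x::polish_space measure"
    and p :: "'x \<Rightarrow> 't::{metric_space,second_countable_topology} \<Rightarrow> real"
  assumes model: "sampling_model \<nu> p B" and F: "mixing F" and Gs: "\<And>n. mixing (Gs n)"
    and fit: "(\<lambda>n. sampling_model.fit \<nu> p F (Gs n)) \<longlonglongrightarrow> 0"
    and ident: "identifiable_mixing \<nu> p"
    and compact: "\<And>(\<epsilon>::real) X0. 0 < \<epsilon> \<Longrightarrow> compact X0 \<Longrightarrow>
               \<exists>\<Theta>0. compact \<Theta>0 \<and> (\<forall>\<theta>. \<theta> \<notin> \<Theta>0 \<longrightarrow> (\<integral>\<^sup>+x\<in>X0. ennreal (p x \<theta>) \<partial>\<nu>) < ennreal \<epsilon>)"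
  shows "weakly_converges Gs F"
proof -
  interpret sampling_model \<nu> p B by (rule model)
  interpret P: prob_space "law F" using F by (rule prob_space_law)
  note L1 = fit_tendsto_0_imp_L1[OF F Gs fit]
  have tight: "\<exists>K. compact K \<and> eventually (\<lambda>n. 1 - e \<le> measure (Gs n) K) sequentially" if e: "0 < e" for e
  proof -
    have "(SUP K\<in>{K. K \<subseteq> UNIV \<and> compact K}. emeasure (law F) K) = 1"
      using inner_regular[of "law F" UNIV] P.emeasure_space_1 by (simp add: sets_law)
    moreover have "ennreal (1 - e / 4) < 1" using e ennreal_lessI[of 1 "1 - e / 4"] by simp
    ultimately obtain X0 where X0: "compact X0" "ennreal (1 - e / 4) < emeasure (law F) X0"
      using less_SUP_iff[of "ennreal (1 - e / 4)"] by (metis (no_types, lifting) mem_Collect_eq)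
    have X0b: "X0 \<in> sets borel" using X0 by (auto intro: borel_closed compact_imp_closed)
    have X0m: "1 - e / 4 < measure (law F) X0"
      using X0(2) unfolding P.emeasure_eq_measure by (metis ennreal_leI not_less)
    obtain T where T: "compact T" "\<And>\<theta>. \<theta> \<notin> T \<Longrightarrow> (\<integral>\<^sup>+x\<in>X0. ennreal (p x \<theta>) \<partial>\<nu>) < ennreal (e / 2)"
      using compact[OF half_gt_zero[OF e] X0(1)] by blast
    have Tb: "T \<in> sets borel" using T by (auto intro: borel_closed compact_imp_closed)
    have "eventually (\<lambda>n. (\<integral>x. \<bar>mix (Gs n) x / mix F x - 1\<bar> \<partial>law F) < e / 4) sequentially"
      by (rule order_tendstoD(2)[OF L1]) (use e in simp)
    then have "eventually (\<lambda>n. 1 - e \<le> measure (Gs n) T) sequentially"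
    proof eventually_elim
      case (elim n)
      have "measure (law (Gs n)) X0 \<le> measure (Gs n) T + e / 2"
        using e by (intro mass_of_compact_le[OF Gs X0b Tb less_imp_le[OF T(2)]]) auto
      then show ?case using measure_law_ge[OF F Gs[of n] X0b] elim X0m e by linarith
    qed
    then show ?thesis using T(1) by blast
  qed
  show ?thesis
    unfolding weakly_converges_def
  proof (intro allI impI, rule ccontr)
    fix g :: "'t \<Rightarrow> real"
    assume g: "continuous_on UNIV g" "bounded (range g)" and no: "\<not> (\<lambda>n. \<integral>z. g z \<partial>Gs n) \<longlonglongrightarrow> (\<integral>z. g z \<partial>F)"
    obtain s e where s: "strict_mono s" "0 < e" "\<And>n::nat. e \<le> dist (\<integral>z. g z \<partial>Gs (s n)) (\<integral>z. g z \<partial>F)"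
      using not_tendsto_subsequence[OF no] by blast
    have "\<exists>K. compact K \<and> eventually (\<lambda>n. 1 - e \<le> measure (Gs (s n)) K) sequentially" if "0 < e" for e
      using tight[OF that] eventually_subseq[OF s(1)] by blast
    then obtain r G where r: "strict_mono r" "prob_space G" "sets G = sets borel"
        "weakly_converges (\<lambda>n. Gs (s (r n))) G"
      using tight_imp_weakly_convergent_subsequence[of "\<lambda>n. Gs (s n)"] mixingD(1,2)[OF Gs] by blast
    have G: "mixing G" using r by (simp add: mixing_def)
    have "(\<lambda>n. \<integral>x. \<bar>mix (Gs (s (r n))) x / mix F x - 1\<bar> \<partial>law F) \<longlonglongrightarrow> 0"
      using LIMSEQ_subseq_LIMSEQ[OF L1 strict_mono_o[OF s(1) r(1)]] by (simp add: comp_def)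
    then have "AE x in \<nu>. mix G x = mix F x"
      by (rule weak_limit_has_same_mixture[OF F Gs G r(4)])
    then have "G = F"
      using ident G F unfolding identifiable_mixing_def mixing_def by blast
    then have "(\<lambda>n. \<integral>z. g z \<partial>Gs (s (r n))) \<longlonglongrightarrow> (\<integral>z. g z \<partial>F)"
      using r(4) g unfolding weakly_converges_def by blast
    from tendstoD[OF this s(2)] have "eventually (\<lambda>n. False) sequentially"
      by eventually_elim (use s(3) in \<open>auto simp: not_less[symmetric]\<close>)
    then show False by simp
  qed
qed

lemma recursive_estimate_cong:
  assumes "\<And>i. 1 \<le> i \<Longrightarrow> xs i = ys i"
  shows "recursive_estimate \<mu> p w f0 xs n = recursive_estimate \<mu> p w f0 ys n"
  by (induction n) (simp_all add: assms)

text \<open>Passing to the dominating measure \<open>F0\<close> makes the initial density constant, and every later estimate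
  acquires the factor \<open>f0\<close>.\<close>
lemma recursive_estimate_change_base:
  fixes f0 :: "'t::topological_space \<Rightarrow> real"
  assumes sets: "sets \<mu> = sets borel" and p: "\<And>x. p x \<in> borel_measurable borel"
    and f0: "f0 \<in> borel_measurable borel" "\<And>\<theta>. 0 \<le> f0 \<theta>"
  defines "F0 \<equiv> density \<mu> (\<lambda>\<theta>. ennreal (f0 \<theta>))"
  shows "recursive_estimate \<mu> p w f0 xs n = (\<lambda>\<theta>. f0 \<theta> * recursive_estimate F0 p w (\<lambda>_. 1) xs n \<theta>)
    \<and> recursive_estimate F0 p w (\<lambda>_. 1) xs n \<in> borel_measurable borel"
proof (induction n)
  case (Suc n)
  have [measurable_cong]: "sets \<mu> = sets borel" by (rule sets)
  note p[measurable] f0(1)[measurable]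
  define r where "r = recursive_estimate F0 p w (\<lambda>_. 1) xs n"
  have r[measurable]: "r \<in> borel_measurable borel" and eq: "recursive_estimate \<mu> p w f0 xs n = (\<lambda>\<theta>. f0 \<theta> * r \<theta>)"
    using Suc by (auto simp: r_def)
  have "mixture_density F0 p r x = mixture_density \<mu> p (\<lambda>\<theta>. f0 \<theta> * r \<theta>) x" for x
    unfolding mixture_density_def F0_def using f0(2) by (subst integral_density) (auto simp: mult_ac)
  then show ?case
    unfolding recursive_estimate.simps eq r_def[symmetric]
    by (auto simp: fun_eq_iff algebra_simps)
qed simp

theorem corollary4:
  fixes \<nu> :: "'x::polish_space measure"
    and \<mu> :: "'t::{metric_space, second_countable_topology} measure"
    and p :: "'x \<Rightarrow> 't \<Rightarrow> real"
    and f f0 :: "'t \<Rightarrow> real"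
    and w :: "nat \<Rightarrow> real"
    and M :: "'w measure"
    and X :: "nat \<Rightarrow> 'w \<Rightarrow> 'x"
  assumes nu: "sigma_finite_measure \<nu>" "sets \<nu> = sets borel"
    and mu: "sigma_finite_measure \<mu>" "sets \<mu> = sets borel"
    and p_density: "\<And>\<theta>. is_prob_density \<nu> (\<lambda>x. p x \<theta>)"
    and f_density: "is_prob_density \<mu> f"
    and f0_density: "is_prob_density \<mu> f0"
    and f0_support: "\<And>U. open U \<Longrightarrow> emeasure (density \<mu> (\<lambda>\<theta>. ennreal (f0 \<theta>))) U = 0
                         \<Longrightarrow> emeasure (density \<mu> (\<lambda>\<theta>. ennreal (f \<theta>))) U = 0"
    and M: "prob_space M"
    and X_indep: "prob_space.indep_vars M (\<lambda>_. borel) X {1..}"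
    and X_distr: "\<And>i. 1 \<le> i \<Longrightarrow> distributed M \<nu> (X i) (\<lambda>x. ennreal (mixture_density \<mu> p f x))"
    and w_range: "\<And>i. 1 \<le> i \<Longrightarrow> 0 < w i \<and> w i < 1"
    and A1: "filterlim (\<lambda>n. \<Sum>i=1..n. w i) at_top sequentially"
            "summable (\<lambda>i. (w (Suc i))\<^sup>2)"
    and A2: "identifiable_mixing \<nu> p"
    and A3: "\<And>x. bounded (range (\<lambda>\<theta>. p x \<theta>)) \<and> continuous_on UNIV (\<lambda>\<theta>. p x \<theta>)"
    and A4: "\<And>(\<epsilon>::real) X0. 0 < \<epsilon> \<Longrightarrow> compact X0 \<Longrightarrow>
               \<exists>\<Theta>0. compact \<Theta>0 \<and>
                 (\<forall>\<theta>. \<theta> \<notin> \<Theta>0 \<longrightarrow> (\<integral>\<^sup>+x\<in>X0. ennreal (p x \<theta>) \<partial>\<nu>) < ennreal \<epsilon>)"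
    and A5: "\<exists>B::real. \<forall>\<theta>1 \<theta>2 \<theta>3.
               (\<integral>\<^sup>+x. (ennreal (p x \<theta>1) / ennreal (p x \<theta>2))\<^sup>2 * ennreal (p x \<theta>3) \<partial>\<nu>) < ennreal B"
  shows "AE \<omega> in M. weakly_converges
           (\<lambda>n. density \<mu> (\<lambda>\<theta>. ennreal (recursive_estimate \<mu> p w f0 (\<lambda>i. X i \<omega>) n \<theta>)))
           (density \<mu> (\<lambda>\<theta>. ennreal (f \<theta>)))"
proof -
  have [measurable_cong]: "sets \<mu> = sets borel" by (rule mu)
  have sp_mu: "space \<mu> = UNIV" using sets_eq_imp_space_eq[OF mu(2)] by simp
  obtain B where B: "\<And>\<theta>1 \<theta>2 \<theta>3. (\<integral>\<^sup>+x. (ennreal (p x \<theta>1) / ennreal (p x \<theta>2))\<^sup>2 * ennreal (p x \<theta>3) \<partial>\<nu>) < ennreal B"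
    using A5 by blast
  interpret sampling_model \<nu> p B
    by (rule sampling_model.intro) (use nu p_density A3 less_imp_le[OF B] in auto)
  interpret M: prob_space M by (rule M)
  define F where "F = density \<mu> (\<lambda>\<theta>. ennreal (f \<theta>))"
  define F0 where "F0 = density \<mu> (\<lambda>\<theta>. ennreal (f0 \<theta>))"
  have dens: "g \<in> borel_measurable borel" "\<And>z. 0 \<le> g z" "mixing (density \<mu> (\<lambda>\<theta>. ennreal (g \<theta>)))"
    if "is_prob_density \<mu> g" for g
  proof -
    show [measurable]: "g \<in> borel_measurable borel" and "\<And>z. 0 \<le> g z"
      using that mu(2) by (auto simp: is_prob_density_def cong: measurable_cong_sets)
    have "emeasure (density \<mu> (\<lambda>\<theta>. ennreal (g \<theta>))) (space (density \<mu> (\<lambda>\<theta>. ennreal (g \<theta>)))) = 1"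
      using that by (simp add: is_prob_density_def emeasure_density sp_mu)
    then show "mixing (density \<mu> (\<lambda>\<theta>. ennreal (g \<theta>)))"
      using mu(2) by (auto simp: mixing_def intro: prob_spaceI)
  qed
  have F: "mixing F" and F0: "mixing F0"
    using dens(3)[OF f_density] dens(3)[OF f0_density] by (auto simp: F_def F0_def)
  note mix_measurable[OF F0, measurable]
  have mix_F: "mixture_density \<mu> p f x = mix F x" for x
    unfolding mixture_density_def mixture_of_measure_def F_def
    using dens(1,2)[OF f_density] by (subst integral_density) (auto simp: mult.commute)
  have X_law: "distr M borel (X i) = law F" and X_meas[measurable]: "X i \<in> M \<rightarrow>\<^sub>M borel" if "1 \<le> i" for i
  proof -
    have "distr M borel (X i) = distr M \<nu> (X i)" by (rule distr_cong) (auto simp: nu(2))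
    then show "distr M borel (X i) = law F"
      using X_distr[OF that] by (simp add: distributed_def law_def mix_F)
    show "X i \<in> M \<rightarrow>\<^sub>M borel"
      using X_indep that by (auto simp: M.indep_vars_def)
  qed
  have X_pos: "AE \<omega> in M. 0 < mix F0 (X i \<omega>)" if "1 \<le> i" for i
  proof -
    have "AE x in distr M borel (X i). 0 < mix F0 x"
      unfolding X_law[OF that] by (rule AE_law_mix_pos[OF F F0])
    then show ?thesis by (rule AE_distrD[OF X_meas[OF that]])
  qed
  obtain x0 where x0: "0 < mix F0 x0"
  proof (rule ccontr)
    assume "\<not> thesis"
    then have "\<not> 0 < mix F0 (X 1 \<omega>)" for \<omega> using that by blast
    then have "AE \<omega> in M. False" using X_pos[of 1] by simp
    then show False by simp
  qed
  \<comment> \<open>Observations in the null set where the initial mixture vanishes are moved to a fixed good point.\<close>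
  define \<phi> where "\<phi> x = (if 0 < mix F0 x then x else x0)" for x
  have \<phi>[measurable]: "\<phi> \<in> borel \<rightarrow>\<^sub>M borel" unfolding \<phi>_def by measurable
  define X' where "X' i \<omega> = \<phi> (X i \<omega>)" for i \<omega>
  have X'_eq: "AE \<omega> in M. \<forall>i\<ge>1. X' i \<omega> = X i \<omega>"
    unfolding AE_all_countable
  proof
    fix i
    show "AE \<omega> in M. 1 \<le> i \<longrightarrow> X' i \<omega> = X i \<omega>"
    proof (cases "1 \<le> i")
      case True
      from X_pos[OF this] show ?thesis by eventually_elim (simp add: X'_def \<phi>_def)
    qed simp
  qed
  interpret predictive_recursion \<nu> p B M X' F F0 w
  proof unfold_locales
    show "M.indep_vars (\<lambda>_. borel) X' {1..}"
      unfolding X'_def by (rule M.indep_vars_compose2[OF X_indep]) simp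
    show "distr M borel (X' i) = law F" if i: "1 \<le> i" for i
      unfolding X_law[OF i, symmetric]
    proof (rule distr_cong_AE)
      show "AE \<omega> in M. X' i \<omega> = X i \<omega>" using X'_eq by eventually_elim (use i in blast)
      show "X i \<in> M \<rightarrow>\<^sub>M borel" by (rule X_meas[OF i])
      then show "X' i \<in> M \<rightarrow>\<^sub>M borel" unfolding X'_def by (rule measurable_compose) (rule \<phi>)
    qed simp_all
    show "0 < mix F0 (X' i \<omega>)" for i \<omega> using x0 by (simp add: X'_def \<phi>_def)
    show "\<not> summable (\<lambda>n. w (Suc n))"
    proof
      assume "summable (\<lambda>n. w (Suc n))"
      then have "(\<lambda>n. \<Sum>i<n. w (Suc i)) \<longlonglongrightarrow> (\<Sum>i. w (Suc i))" by (rule summable_LIMSEQ)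
      moreover have "filterlim (\<lambda>n. \<Sum>i<n. w (Suc i)) at_top sequentially"
        using A1(1) by (simp add: sum.atLeast1_atMost_eq)
      ultimately show False
        using not_tendsto_and_filterlim_at_infinity[OF sequentially_bot] filterlim_at_top_imp_at_infinity by blast
    qed
    show "emeasure F U = 0" if "open U" "emeasure F0 U = 0" for U
      using f0_support that by (simp add: F_def F0_def)
  qed (use F F0 w_range A1 in auto)
  from fit_tendsto_0 X'_eq AE_space show ?thesis
  proof eventually_elim
    case (elim \<omega>)
    have "weakly_converges (\<lambda>n. est n \<omega>) F"
      by (rule fit_tendsto_0_imp_weakly_converges[OF sampling_model_axioms F est_mixing[OF elim(3)] elim(1) A2 A4])
    moreover have "est n \<omega> = density \<mu> (\<lambda>\<theta>. ennreal (recursive_estimate \<mu> p w f0 (\<lambda>i. X i \<omega>) n \<theta>))" for n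
    proof -
      have p_m: "p x \<in> borel_measurable borel" for x using A3[of x] by (auto intro: borel_measurable_continuous_onI)
      note base = recursive_estimate_change_base[where p=p and w=w and xs="\<lambda>i. X i \<omega>" and n=n,
        OF mu(2) p_m dens(1,2)[OF f0_density], folded F0_def]
      have "recursive_estimate F0 p w (\<lambda>_. 1) (\<lambda>i. X i \<omega>) n = R n \<omega>"
        unfolding R_def by (rule recursive_estimate_cong) (use elim(2) in auto)
      then have eq: "recursive_estimate \<mu> p w f0 (\<lambda>i. X i \<omega>) n = (\<lambda>\<theta>. f0 \<theta> * R n \<omega> \<theta>)"
        and [measurable]: "R n \<omega> \<in> borel_measurable borel" using base by auto
      have [measurable]: "f0 \<in> borel_measurable borel" by (rule dens(1)[OF f0_density])
      have "density F0 (\<lambda>\<theta>. ennreal (r \<theta>)) = density \<mu> (\<lambda>\<theta>. ennreal (f0 \<theta> * r \<theta>))"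
        if [measurable]: "r \<in> borel_measurable borel" for r
        unfolding F0_def using dens(2)[OF f0_density]
        by (subst density_density_eq) (auto simp: ennreal_mult')
      then show ?thesis unfolding eq est_def by simp
    qed
    ultimately show ?case unfolding F_def by simp
  qed
qed

end
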